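(* Let $d\ge1$. The canonical map $$\Upsilon\colon BV([0,1]^d)\to SCH([0,1]^d)^*,\qquad \Upsilon(u)(\alpha)=\alpha(u)\quad(\alpha\in SCH([0,1]^d)),$$ is an isomorphism of Banach spaces (a linear bijection, continuous with continuous inverse).
   Context: $BV([0,1]^d)$ is the space of $u\in BV(\mathbb{R}^d)$ that vanish a.e. outside $[0,1]^d$, with norm $\|u\|_{BV}=\|u\|_1+\|Du\|(\mathbb{R}^d)$, where $\|Du\|$ is the total variation measure of the distributional gradient $Du$. For $f\in L^d([0,1]^d)$, $T_f\in BV([0,1]^d)^*$ is the continuous functional $T_f(u)=\int_{[0,1]^d}fu$. $SCH([0,1]^d)$, the Banach space of strong charge functionals, is the closure of $\{T_f: f\in L^d([0,1]^d)\}$ in the dual Banach space $BV([0,1]^d)^*$ with its operator norm. *)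

theory Defs
  imports "HOL-Analysis.Analysis" "HOL-Computational_Algebra.Polynomial"
begin

section \<open>Test functions\<close>

definition partial_deriv :: "'n \<Rightarrow> (real^'n::finite \<Rightarrow> real) \<Rightarrow> real^'n \<Rightarrow> real"
  where "partial_deriv i f x = frechet_derivative f (at x) (axis i 1)"

text \<open>Differentiability of all iterated partial derivatives, the function itself included
  (\<open>js = []\<close>), makes each of them continuous, so this is the class \<open>C\<^sup>\<infinity>\<close>.\<close>

definition smooth_fun :: "(real^'n::finite \<Rightarrow> real) \<Rightarrow> bool"
  where "smooth_fun f \<longleftrightarrow> (\<forall>js x. foldr partial_deriv js f differentiable (at x))"

definition test_functions :: "(real^'n::finite \<Rightarrow> real) set"
  where "test_functions = {\<phi>. smooth_fun \<phi> \<and> compact (closure {x. \<phi> x \<noteq> 0})}"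

section \<open>Functions of bounded variation\<close>

text \<open>An \<open>\<real>\<^sup>n\<close>-valued Borel measure is a set function \<open>\<mu>\<close> whose components are finite signed
  measures, i.e. differences \<open>P - N\<close> of finite Borel measures; integrals against a component are
  \<open>\<integral>\<phi> dP - \<integral>\<phi> dN\<close>, which does not depend on the choice of \<open>P\<close> and \<open>N\<close>.  As \<^const>\<open>measure\<close> is \<open>0\<close> on
  non-measurable sets, \<open>\<mu>\<close> is normalised to vanish there, which makes it unique.\<close>

definition is_gradient_measure ::
    "(real^'n::finite \<Rightarrow> real) \<Rightarrow> ((real^'n) set \<Rightarrow> real^'n) \<Rightarrow> bool"
  where "is_gradient_measure u \<mu> \<longleftrightarrow>
    (\<forall>i. \<exists>P N. finite_measure P \<and> finite_measure N \<and> sets P = sets borel \<and> sets N = sets borel \<and>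
      (\<forall>E. \<mu> E $ i = measure P E - measure N E) \<and>
      (\<forall>\<phi>\<in>test_functions. (LINT x|lborel. u x * partial_deriv i \<phi> x)
                           = - ((LINT x|P. \<phi> x) - (LINT x|N. \<phi> x))))"

definition gradient_measure :: "(real^'n::finite \<Rightarrow> real) \<Rightarrow> (real^'n) set \<Rightarrow> real^'n"
  where "gradient_measure u = (THE \<mu>. is_gradient_measure u \<mu>)"

definition variation_measure :: "((real^'n::finite) set \<Rightarrow> real^'n) \<Rightarrow> (real^'n) set \<Rightarrow> ennreal"
  where "variation_measure \<mu> E =
    (SUP A\<in>{A :: nat \<Rightarrow> _. range A \<subseteq> sets borel \<and> disjoint_family A \<and> (\<Union>k. A k) = E}.
       \<Sum>k. ennreal (norm (\<mu> (A k))))"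

definition BV :: "(real^'n::finite \<Rightarrow> real) set"
  where "BV = {u. integrable lborel u \<and> (\<exists>\<mu>. is_gradient_measure u \<mu>)}"

definition BV_norm :: "(real^'n::finite \<Rightarrow> real) \<Rightarrow> real"
  where "BV_norm u = (LINT x|lborel. \<bar>u x\<bar>)
                     + enn2real (variation_measure (gradient_measure u) UNIV)"

text \<open>In \<^typ>\<open>real^'n\<close> the vector \<open>1\<close> has all coordinates equal to \<open>1\<close>, so \<open>cbox 0 1\<close> is the unit cube.\<close>

definition BV_cube :: "(real^'n::finite \<Rightarrow> real) set"
  where "BV_cube = {u\<in>BV. AE x in lborel. x \<notin> cbox 0 1 \<longrightarrow> u x = 0}"

lemma test_function_props:
  assumes "\<phi> \<in> test_functions"
  shows "continuous_on UNIV \<phi>" and "continuous_on UNIV (partial_deriv i \<phi>)"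
    and "\<exists>B. \<forall>x. \<bar>\<phi> x\<bar> \<le> B" and "\<exists>B. \<forall>x. \<bar>partial_deriv i \<phi> x\<bar> \<le> B"
proof -
  define K where "K = closure {x. \<phi> x \<noteq> 0}"
  from assms have sm: "\<And>js x. foldr partial_deriv js \<phi> differentiable (at x)" and K: "compact K"
    by (auto simp: test_functions_def smooth_fun_def K_def)
  show c0: "continuous_on UNIV \<phi>"
    using sm[of "[]"] by (auto intro!: continuous_at_imp_continuous_on differentiable_imp_continuous_within)
  show c1: "continuous_on UNIV (partial_deriv i \<phi>)"
    using sm[of "[i]"] by (auto intro!: continuous_at_imp_continuous_on differentiable_imp_continuous_within)
  have "{x. \<phi> x \<noteq> 0} \<subseteq> K" unfolding K_def by (rule closure_subset)
  then have z0: "\<phi> x = 0" if "x \<notin> K" for x using that by auto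
  have z1: "partial_deriv i \<phi> x = 0" if "x \<notin> K" for x
  proof -
    have "((\<lambda>_. 0) has_derivative (\<lambda>_. 0)) (at x)" by simp
    then have "(\<phi> has_derivative (\<lambda>_. 0)) (at x)"
      by (rule has_derivative_transform_within_open[where s = "- K"]) (use that z0 K in \<open>auto simp: compact_imp_closed\<close>)
    then show ?thesis unfolding partial_deriv_def using frechet_derivative_at by metis
  qed
  have bdd: "\<exists>B. \<forall>x. \<bar>f x\<bar> \<le> B" if "continuous_on UNIV f" "\<And>x. x \<notin> K \<Longrightarrow> f x = 0" for f :: "_ \<Rightarrow> real"
  proof -
    have "bounded (f ` K)"
      by (intro compact_imp_bounded compact_continuous_image K continuous_on_subset[OF that(1)]) auto
    then obtain B where B: "\<forall>x\<in>K. \<bar>f x\<bar> \<le> B" by (auto simp: bounded_iff)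
    have "\<bar>f x\<bar> \<le> max B 0" for x using B that(2)[of x] by (cases "x \<in> K") (auto simp: le_max_iff_disj)
    then show ?thesis by blast
  qed
  show "\<exists>B. \<forall>x. \<bar>\<phi> x\<bar> \<le> B" by (rule bdd[OF c0 z0])
  show "\<exists>B. \<forall>x. \<bar>partial_deriv i \<phi> x\<bar> \<le> B" by (rule bdd[OF c1 z1])
qed

lemma test_function_measurable [measurable]:
  assumes "\<phi> \<in> test_functions"
  shows "\<phi> \<in> borel_measurable borel" and "partial_deriv i \<phi> \<in> borel_measurable borel"
  by (intro borel_measurable_continuous_onI test_function_props assms)+

lemma test_function_integrable:
  assumes "\<phi> \<in> test_functions" "finite_measure P" "sets P = sets borel"
  shows "integrable P \<phi>"
proof -
  obtain B where "\<forall>x. \<bar>\<phi> x\<bar> \<le> B" using test_function_props(3)[OF assms(1)] by blast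
  moreover have "\<phi> \<in> borel_measurable P"
    using test_function_measurable(1)[OF assms(1)] assms(3) by (simp cong: measurable_cong_sets)
  ultimately show ?thesis
    by (intro finite_measure.integrable_const_bound[OF assms(2), of _ B]) auto
qed

lemma integrable_times_partial:
  assumes "\<phi> \<in> test_functions" "integrable lborel u"
  shows "integrable lborel (\<lambda>x. u x * partial_deriv i \<phi> x)"
proof -
  obtain B where B: "\<forall>x. \<bar>partial_deriv i \<phi> x\<bar> \<le> B"
    using test_function_props(4)[OF assms(1)] by blast
  have [measurable]: "partial_deriv i \<phi> \<in> borel_measurable borel" "u \<in> borel_measurable borel"
    using assms test_function_measurable by auto
  show ?thesis
  proof (rule Bochner_Integration.integrable_bound)
    show "integrable lborel (\<lambda>x. B * u x)" using assms(2) by simp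
    have "0 \<le> B" using B abs_ge_zero order_trans by blast
    then have "\<bar>partial_deriv i \<phi> x\<bar> * \<bar>u x\<bar> \<le> \<bar>B\<bar> * \<bar>u x\<bar>" for x
      using B by (intro mult_right_mono) auto
    then show "AE x in lborel. norm (u x * partial_deriv i \<phi> x) \<le> norm (B * u x)"
      by (intro AE_I2) (simp only: real_norm_def abs_mult mult.commute[of "\<bar>u x\<bar>" for x])
  qed simp
qed

definition flat :: "real poly \<Rightarrow> real \<Rightarrow> real"
  where "flat p t = (if t > 0 then poly p (1/t) * exp (-(1/t)) else 0)"

lemma poly_exp_tendsto_0: "((\<lambda>s::real. poly p s * exp (- s)) \<longlongrightarrow> 0) at_top"
proof -
  have "((\<lambda>s. \<Sum>i\<le>degree p. coeff p i * (s ^ i / exp s)) \<longlongrightarrow> 0) at_top"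
    by (intro tendsto_null_sum tendsto_mult_right_zero tendsto_power_div_exp_0)
  then show ?thesis
    by (simp add: poly_altdef sum_distrib_right exp_minus divide_inverse mult.assoc)
qed

lemma flat_deriv:
  "(flat p has_real_derivative flat (monom 1 2 * (p - pderiv p)) t) (at t)"
proof -
  consider "t > 0" | "t < 0" | "t = 0" by linarith
  then show ?thesis
  proof cases
    case 1
    have "((\<lambda>t. poly p (1/t) * exp (-(1/t))) has_real_derivative
        flat (monom 1 2 * (p - pderiv p)) t) (at t)"
      using 1
      by (auto intro!: derivative_eq_intros DERIV_chain2[OF poly_DERIV]
          simp: flat_def poly_monom power2_eq_square field_simps)
    then show ?thesis
      by (rule has_field_derivative_transform_within_open[where S = "{0<..}"])
         (use 1 in \<open>auto simp: flat_def\<close>)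
  next
    case 2
    have "((\<lambda>t. 0) has_real_derivative flat (monom 1 2 * (p - pderiv p)) t) (at t)"
      using 2 by (simp add: flat_def)
    then show ?thesis
      by (rule has_field_derivative_transform_within_open[where S = "{..<0}"])
         (use 2 in \<open>auto simp: flat_def\<close>)
  next
    case 3
    have "((\<lambda>s. (poly p (1/s) * exp (-(1/s))) / s) \<longlongrightarrow> 0) (at_right 0)"
    proof -
      have "((\<lambda>s. poly (pCons 0 p) (inverse s) * exp (- inverse s)) \<longlongrightarrow> 0) (at_right (0::real))"
        by (rule filterlim_compose[OF poly_exp_tendsto_0 filterlim_inverse_at_top_right])
      then show ?thesis by (simp add: field_simps)
    qed
    then have "((\<lambda>s. (flat p s - flat p 0) / (s - 0)) \<longlongrightarrow> 0) (at_right 0)"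
      by (rule Lim_transform_eventually)
         (auto simp: flat_def eventually_at_filter intro!: always_eventually)
    moreover have "((\<lambda>s. (flat p s - flat p 0) / (s - 0)) \<longlongrightarrow> 0) (at_left 0)"
      by (rule Lim_transform_eventually[OF tendsto_const])
         (auto simp: flat_def eventually_at_filter intro!: always_eventually)
    ultimately have "((\<lambda>s. (flat p s - flat p 0) / (s - 0)) \<longlongrightarrow> 0) (at 0)"
      by (simp add: filterlim_at_split)
    then show ?thesis using 3
      by (simp add: has_field_derivative_iff flat_def)
  qed
qed

inductive_set flat_algebra :: "(real^'n::finite \<Rightarrow> real) set"
  where
    atom: "(\<lambda>x. flat p (c * (x $ j) + d)) \<in> flat_algebra"
  | const: "(\<lambda>_. c) \<in> flat_algebra"
  | add: "f \<in> flat_algebra \<Longrightarrow> g \<in> flat_algebra \<Longrightarrow> (\<lambda>x. f x + g x) \<in> flat_algebra"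
  | mult: "f \<in> flat_algebra \<Longrightarrow> g \<in> flat_algebra \<Longrightarrow> (\<lambda>x. f x * g x) \<in> flat_algebra"

lemma flat_algebra_deriv:
  fixes f :: "real^'n::finite \<Rightarrow> real"
  assumes "f \<in> flat_algebra"
  shows "\<exists>f'. (\<forall>x. (f has_derivative f' x) (at x)) \<and> (\<forall>v. (\<lambda>x. f' x v) \<in> flat_algebra)"
  using assms
proof induction
  case (atom p c j d)
  let ?q = "monom 1 2 * (p - pderiv p)"
  let ?f' = "\<lambda>x v. flat ?q (c * (x $ j) + d) * (c * (v $ j))"
  have "((\<lambda>x. flat p (c * (x $ j) + d)) has_derivative ?f' x) (at x)" for x
  proof -
    have "((\<lambda>x. c * (x $ j) + d) has_derivative (\<lambda>v. c * (v $ j))) (at x)"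
      by (auto intro!: derivative_eq_intros bounded_linear_imp_has_derivative bounded_linear_vec_nth)
    from has_derivative_compose[OF this flat_deriv[unfolded has_field_derivative_def]]
    show ?thesis by (simp add: mult.commute)
  qed
  moreover have "(\<lambda>x. ?f' x v) \<in> flat_algebra" for v
    by (intro flat_algebra.intros)
  ultimately show ?case by (intro exI[of _ ?f']) simp
next
  case (const c)
  show ?case by (intro exI[of _ "\<lambda>_ _. 0"]) (auto intro: flat_algebra.intros)
next
  case (add f g)
  then obtain f' g' where
    "\<And>x. (f has_derivative f' x) (at x)" "\<And>v. (\<lambda>x. f' x v) \<in> flat_algebra"
    "\<And>x. (g has_derivative g' x) (at x)" "\<And>v. (\<lambda>x. g' x v) \<in> flat_algebra" by metis
  then show ?case
    by (intro exI[of _ "\<lambda>x v. f' x v + g' x v"])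
       (auto intro!: has_derivative_add flat_algebra.add)
next
  case (mult f g)
  then obtain f' g' where
    "\<And>x. (f has_derivative f' x) (at x)" "\<And>v. (\<lambda>x. f' x v) \<in> flat_algebra"
    "\<And>x. (g has_derivative g' x) (at x)" "\<And>v. (\<lambda>x. g' x v) \<in> flat_algebra" by metis
  then show ?case using mult
    by (intro exI[of _ "\<lambda>x v. f x * g' x v + f' x v * g x"])
       (auto intro!: has_derivative_mult flat_algebra.add flat_algebra.mult)
qed

lemma flat_algebra_smooth:
  fixes f :: "real^'n::finite \<Rightarrow> real"
  assumes "f \<in> flat_algebra" shows "smooth_fun f"
proof -
  have *: "partial_deriv i g \<in> flat_algebra" if g: "g \<in> flat_algebra" for i and g :: "real^'n \<Rightarrow> real"
  proof -
    obtain g' where g': "\<And>x. (g has_derivative g' x) (at x)" "\<And>v. (\<lambda>x. g' x v) \<in> flat_algebra"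
      using flat_algebra_deriv[OF g] by blast
    have "partial_deriv i g = (\<lambda>x. g' x (axis i 1))"
      unfolding partial_deriv_def using frechet_derivative_at[OF g'(1)] by auto
    then show ?thesis using g'(2) by simp
  qed
  have "foldr partial_deriv js f \<in> flat_algebra" for js
    by (induction js) (auto simp: assms *)
  then show ?thesis
    unfolding smooth_fun_def differentiable_def using flat_algebra_deriv by (meson)
qed

lemma flat_algebra_prod:
  assumes "finite I" "\<And>i. i \<in> I \<Longrightarrow> f i \<in> flat_algebra"
  shows "(\<lambda>x. \<Prod>i\<in>I. f i x) \<in> flat_algebra"
  using assms by (induction I) (auto intro: flat_algebra.intros)

definition bump :: "real^'n::finite \<Rightarrow> real^'n \<Rightarrow> nat \<Rightarrow> real^'n \<Rightarrow> real"
  where "bump a b k x =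
    (\<Prod>j\<in>UNIV. flat 1 (real k * (x $ j) + - (real k * (a $ j))) * flat 1 (- real k * (x $ j) + real k * (b $ j)))"

lemma bump_test: "bump a b k \<in> test_functions"
proof -
  have "bump a b k \<in> flat_algebra"
    unfolding bump_def[abs_def] by (intro flat_algebra_prod flat_algebra.intros finite)
  moreover have "{x. bump a b k x \<noteq> 0} \<subseteq> box a b"
  proof
    fix x assume "x \<in> {x. bump a b k x \<noteq> 0}"
    then have "flat 1 (real k * (x $ j) + - (real k * (a $ j))) \<noteq> 0 \<and> flat 1 (- real k * (x $ j) + real k * (b $ j)) \<noteq> 0" for j
      by (auto simp: bump_def)
    then have pos: "real k * (x $ j) + - (real k * (a $ j)) > 0" "- real k * (x $ j) + real k * (b $ j) > 0" for j
      by (metis flat_def)+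
    have "real k * (a $ j) < real k * (x $ j)" "real k * (x $ j) < real k * (b $ j)" for j
      using pos[of j] by simp_all
    then have "a $ j < x $ j" "x $ j < b $ j" for j
      by (meson mult_less_cancel_left_disj of_nat_0_le_iff linorder_not_less)+
    then show "x \<in> box a b" by (auto simp: mem_box_cart)
  qed
  then have "closure {x. bump a b k x \<noteq> 0} \<subseteq> cbox a b"
    by (meson box_subset_cbox closed_cbox closure_minimal order_trans)
  then have "compact (closure {x. bump a b k x \<noteq> 0})"
    by (meson bounded_cbox bounded_subset closed_closure compact_eq_bounded_closed)
  ultimately show ?thesis by (simp add: test_functions_def flat_algebra_smooth)
qed

lemma flat_1_le: "0 \<le> flat 1 t" "flat 1 t \<le> 1" by (auto simp: flat_def)

lemma bump_le: "\<bar>bump a b k x\<bar> \<le> 1"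
  unfolding bump_def abs_prod
  by (intro prod_le_1) (auto simp: abs_mult flat_1_le intro!: mult_le_one)

lemma bump_tendsto: "(\<lambda>k. bump a b k x) \<longlonglongrightarrow> indicator (box a b) x"
proof -
  have 1: "(\<lambda>k. flat 1 (real k * t)) \<longlonglongrightarrow> (if t > 0 then 1 else 0)" for t
  proof (cases "t > 0")
    case True
    have "(\<lambda>k. exp (-((1/t) * inverse (real k)))) \<longlonglongrightarrow> exp (-((1/t) * 0))"
      by (intro tendsto_intros lim_inverse_n)
    then have "(\<lambda>k. exp (-((1/t) * inverse (real k)))) \<longlonglongrightarrow> 1" by simp
    then have "(\<lambda>k. flat 1 (real k * t)) \<longlonglongrightarrow> 1"
      by (rule Lim_transform_eventually)
         (use True in \<open>auto simp: flat_def field_simps intro!: eventually_sequentiallyI[of 1]\<close>)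
    then show ?thesis using True by simp
  next
    case False
    then have "flat 1 (real k * t) = 0" for k by (auto simp: flat_def zero_less_mult_iff)
    then show ?thesis using False by simp
  qed
  have "(\<lambda>k. \<Prod>j\<in>UNIV. flat 1 (real k * (x $ j - a $ j)) * flat 1 (real k * (b $ j - x $ j)))
      \<longlonglongrightarrow> (\<Prod>j\<in>UNIV. (if x $ j - a $ j > 0 then 1 else 0) * (if b $ j - x $ j > 0 then 1 else 0))"
    by (intro tendsto_prod tendsto_mult 1)
  moreover have "(\<Prod>j\<in>UNIV. (if x $ j - a $ j > 0 then 1 else 0) * (if b $ j - x $ j > 0 then 1 else (0::real)))
      = indicator (box a b) x"
    by (auto simp: indicator_def mem_box_cart intro!: prod.neutral)
  moreover have "bump a b k x = (\<Prod>j\<in>UNIV. flat 1 (real k * (x $ j - a $ j)) * flat 1 (real k * (b $ j - x $ j)))" for k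
    unfolding bump_def by (simp add: algebra_simps)
  ultimately show ?thesis by simp
qed

lemma bump_integral_tendsto:
  assumes "finite_measure P" "sets P = sets borel"
  shows "(\<lambda>k. LINT x|P. bump a b k x) \<longlonglongrightarrow> measure P (box a b)"
proof -
  interpret finite_measure P by fact
  have "(\<lambda>k. LINT x|P. bump a b k x) \<longlonglongrightarrow> (LINT x|P. indicator (box a b) x)"
  proof (rule integral_dominated_convergence[where w = "\<lambda>_. 1"])
    show "bump a b k \<in> borel_measurable P" for k
      using test_function_measurable(1)[OF bump_test] assms(2) by (simp cong: measurable_cong_sets)
    show "indicator (box a b) \<in> borel_measurable P" using assms(2) by auto
  qed (auto simp: bump_tendsto bump_le)
  then show ?thesis using assms(2) sets_eq_imp_space_eq[OF assms(2)] by simp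
qed

definition add_measure :: "'a measure \<Rightarrow> 'a measure \<Rightarrow> 'a measure"
  where "add_measure P Q = measure_of (space P) (sets P) (\<lambda>A. emeasure P A + emeasure Q A)"

lemma sets_add_measure [simp]: "sets (add_measure P Q) = sets P"
  by (simp add: add_measure_def)

lemma space_add_measure [simp]: "space (add_measure P Q) = space P"
  by (simp add: add_measure_def)

lemma emeasure_add_measure:
  assumes "sets Q = sets P"
  shows "emeasure (add_measure P Q) A = emeasure P A + emeasure Q A"
proof (cases "A \<in> sets P")
  case True
  show ?thesis unfolding add_measure_def
  proof (rule emeasure_measure_of_sigma)
    show "countably_additive (sets P) (\<lambda>A. emeasure P A + emeasure Q A)"
    proof (rule countably_additiveI)
      fix A :: "nat \<Rightarrow> _" assume "range A \<subseteq> sets P" "disjoint_family A"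
      then show "(\<Sum>i. emeasure P (A i) + emeasure Q (A i)) = emeasure P (\<Union>i. A i) + emeasure Q (\<Union>i. A i)"
        using suminf_emeasure[of A P] suminf_emeasure[of A Q] assms
        by (simp flip: suminf_add)
    qed
  qed (use True in \<open>auto simp: positive_def sets.sigma_algebra_axioms\<close>)
next
  case False
  then show ?thesis using assms by (simp add: emeasure_notin_sets)
qed

lemma finite_add_measure:
  assumes "finite_measure P" "finite_measure Q" "sets Q = sets P"
  shows "finite_measure (add_measure P Q)"
  using assms finite_measure.emeasure_finite[of P] finite_measure.emeasure_finite[of Q]
  by (intro finite_measureI) (simp add: emeasure_add_measure)

lemma measure_add_measure:
  assumes "finite_measure P" "finite_measure Q" "sets Q = sets P"
  shows "measure (add_measure P Q) A = measure P A + measure Q A"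
  unfolding measure_def emeasure_add_measure[OF assms(3)]
  using finite_measure.emeasure_finite[OF assms(1)] finite_measure.emeasure_finite[OF assms(2)]
  by (simp add: enn2real_plus less_top)

lemma nn_integral_add_measure:
  assumes "sets Q = sets P" "f \<in> borel_measurable P"
  shows "nn_integral (add_measure P Q) f = nn_integral P f + nn_integral Q f"
proof -
  have sp: "space Q = space P" using assms(1) sets_eq_imp_space_eq by blast
  have meas: "g \<in> borel_measurable (add_measure P Q)" "g \<in> borel_measurable Q"
    if "g \<in> borel_measurable P" for g :: "_ \<Rightarrow> ennreal"
    using that assms(1) by (simp_all cong: measurable_cong_sets)
  from assms(2) show ?thesis
  proof induction
    case (cong f g)
    then show ?case using sp by (simp cong: nn_integral_cong_simp)
  next
    case (set A)
    then show ?case using assms(1) by (simp add: emeasure_add_measure)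
  next
    case (mult u c)
    then show ?case by (simp add: nn_integral_cmult meas distrib_left)
  next
    case (add u v)
    then show ?case by (simp add: nn_integral_add meas ac_simps)
  next
    case (seq U)
    have *: "nn_integral M (SUP i. U i) = (SUP i. nn_integral M (U i))"
      if "\<And>i. U i \<in> borel_measurable M" for M
      using nn_integral_monotone_convergence_SUP[OF seq(3) that] by (simp add: SUP_apply[abs_def])
    have inc: "incseq (\<lambda>i. nn_integral M (U i))" for M
      using seq(3) by (auto simp: incseq_def le_fun_def intro!: nn_integral_mono)
    have "nn_integral M (SUP i. U i) = (SUP i. nn_integral M (U i))" if "M \<in> {P, Q, add_measure P Q}" for M
      using that by (intro *) (auto intro: seq meas)
    then show ?case
      by (simp add: seq ennreal_SUP_add inc del: Sup_apply SUP_apply)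
  qed
qed

lemma integral_add_measure:
  fixes f :: "_ \<Rightarrow> real"
  assumes "sets Q = sets P" "integrable P f" "integrable Q f"
  shows "(LINT x|add_measure P Q. f x) = (LINT x|P. f x) + (LINT x|Q. f x)"
proof -
  have m: "f \<in> borel_measurable P" "f \<in> borel_measurable Q" using assms by auto
  have nn: "(\<integral>\<^sup>+x. ennreal (g x) \<partial>add_measure P Q) = (\<integral>\<^sup>+x. ennreal (g x) \<partial>P) + (\<integral>\<^sup>+x. ennreal (g x) \<partial>Q)"
    if "g \<in> borel_measurable P" for g using that assms(1) by (intro nn_integral_add_measure) auto
  have i: "integrable (add_measure P Q) f"
    using assms m by (auto simp: integrable_iff_bounded nn cong: measurable_cong_sets)
  have fin: "(\<integral>\<^sup>+x. ennreal (f x) \<partial>M) < \<infinity>" "(\<integral>\<^sup>+x. ennreal (- f x) \<partial>M) < \<infinity>" if "integrable M f" for M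
    using that unfolding real_integrable_def by (auto simp: less_top)
  show ?thesis
    unfolding real_lebesgue_integral_def[OF i] real_lebesgue_integral_def[OF assms(2)]
      real_lebesgue_integral_def[OF assms(3)]
    using m fin[OF assms(2)] fin[OF assms(3)] by (simp add: nn enn2real_plus)
qed

lemma measure_eq_on_boxes:
  fixes P Q :: "(real^'n::finite) measure"
  assumes "finite_measure P" "sets P = sets borel" "sets Q = sets borel"
    and "\<And>a b. emeasure P (box a b) = emeasure Q (box a b)"
  shows "P = Q"
proof (rule measure_eqI_generator_eq[where E = "range (\<lambda>(a,b). box a b)" and \<Omega> = UNIV
      and A = "\<lambda>k. box (- (real k *\<^sub>R 1)) (real k *\<^sub>R 1)"])
  show "Int_stable (range (\<lambda>(a,b). box a b :: (real^'n) set))"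
    by (auto simp: Int_stable_def box_Int_box)
  show "sets P = sigma_sets UNIV (range (\<lambda>(a,b). box a b))"
    "sets Q = sigma_sets UNIV (range (\<lambda>(a,b). box a b))"
    using assms(2,3) unfolding borel_eq_box by simp_all
  show "(\<Union>k. box (- (real k *\<^sub>R 1)) (real k *\<^sub>R 1)) = (UNIV :: (real^'n) set)"
  proof (safe, simp_all)
    fix x :: "real^'n"
    obtain k where k: "norm x < real k" using reals_Archimedean2 by blast
    have "\<bar>x $ i\<bar> < real k" for i using k component_le_norm_cart[of x i] by linarith
    then show "\<exists>k. x \<in> box (- (real k *\<^sub>R 1)) (real k *\<^sub>R 1)"
      by (intro exI[of _ k]) (auto simp: mem_box_cart abs_less_iff minus_less_iff)
  qed
qed (auto simp: finite_measure.emeasure_finite[OF assms(1)] assms(4)[symmetric])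

lemma is_gradient_measureE:
  assumes "is_gradient_measure u \<mu>"
  obtains P N where "finite_measure P" "finite_measure N" "sets P = sets borel" "sets N = sets borel"
      "\<And>E. \<mu> E $ i = measure P E - measure N E"
      "\<And>\<phi>. \<phi> \<in> test_functions \<Longrightarrow> (LINT x|lborel. u x * partial_deriv i \<phi> x)
                           = - ((LINT x|P. \<phi> x) - (LINT x|N. \<phi> x))"
  using assms unfolding is_gradient_measure_def by (elim allE[of _ i]) (elim exE conjE, blast)

lemma gradient_measure_unique:
  assumes "is_gradient_measure u \<mu>" "is_gradient_measure u \<nu>"
  shows "\<mu> = \<nu>"
proof (intro ext, simp only: vec_eq_iff, intro allI)
  fix E i
  from assms(1) obtain P N where PN: "finite_measure P" "finite_measure N" "sets P = sets borel" "sets N = sets borel"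
      "\<And>E. \<mu> E $ i = measure P E - measure N E"
      "\<And>\<phi>. \<phi> \<in> test_functions \<Longrightarrow> (LINT x|lborel. u x * partial_deriv i \<phi> x)
                           = - ((LINT x|P. \<phi> x) - (LINT x|N. \<phi> x))"
    by (rule is_gradient_measureE[of _ _ i]) (rule that)
  from assms(2) obtain P' N' where PN': "finite_measure P'" "finite_measure N'" "sets P' = sets borel" "sets N' = sets borel"
      "\<And>E. \<nu> E $ i = measure P' E - measure N' E"
      "\<And>\<phi>. \<phi> \<in> test_functions \<Longrightarrow> (LINT x|lborel. u x * partial_deriv i \<phi> x)
                           = - ((LINT x|P'. \<phi> x) - (LINT x|N'. \<phi> x))"
    by (rule is_gradient_measureE[of _ _ i]) (rule that)
  let ?M = "add_measure P N'" and ?M' = "add_measure P' N"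
  have fin: "finite_measure ?M" "finite_measure ?M'"
    by (simp_all add: finite_add_measure PN PN')
  have box: "measure ?M (box a b) = measure ?M' (box a b)" for a b
  proof (rule LIMSEQ_unique)
    show "(\<lambda>k. (LINT x|P. bump a b k x) + (LINT x|N'. bump a b k x)) \<longlonglongrightarrow> measure ?M (box a b)"
      unfolding measure_add_measure[OF PN(1) PN'(2) PN'(4)[folded PN(3)]]
      by (intro tendsto_add bump_integral_tendsto PN PN')
    have "(\<lambda>k. (LINT x|P'. bump a b k x) + (LINT x|N. bump a b k x)) \<longlonglongrightarrow> measure ?M' (box a b)"
      unfolding measure_add_measure[OF PN'(1) PN(2) PN(4)[folded PN'(3)]]
      by (intro tendsto_add bump_integral_tendsto PN PN')
    moreover have "(LINT x|P'. bump a b k x) + (LINT x|N. bump a b k x)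
        = (LINT x|P. bump a b k x) + (LINT x|N'. bump a b k x)" for k
      using PN(6)[OF bump_test] PN'(6)[OF bump_test] by (smt (verit))
    ultimately show "(\<lambda>k. (LINT x|P. bump a b k x) + (LINT x|N'. bump a b k x)) \<longlonglongrightarrow> measure ?M' (box a b)"
      by simp
  qed
  have "?M = ?M'"
    by (rule measure_eq_on_boxes)
       (use fin box PN PN' in \<open>auto simp: finite_measure.emeasure_eq_measure\<close>)
  then have "measure P E + measure N' E = measure P' E + measure N E"
    using measure_add_measure[of P N' E] measure_add_measure[of P' N E] PN PN' by simp
  then show "\<mu> E $ i = \<nu> E $ i" using PN(5) PN'(5) by simp
qed

lemma gradient_measure_eqI: "is_gradient_measure u \<mu> \<Longrightarrow> gradient_measure u = \<mu>"
  unfolding gradient_measure_def using gradient_measure_unique by blast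


lemma is_gradient_measure_zero: "is_gradient_measure (\<lambda>_. 0) (\<lambda>_. 0)"
  unfolding is_gradient_measure_def
  by (intro allI exI[of _ "null_measure borel"]) (auto intro!: finite_measureI)

lemma is_gradient_measure_cong:
  assumes "is_gradient_measure u \<mu>" "AE x in lborel. u x = v x"
    and [measurable]: "u \<in> borel_measurable borel" "v \<in> borel_measurable borel"
  shows "is_gradient_measure v \<mu>"
proof -
  have "(LINT x|lborel. u x * partial_deriv i \<phi> x) = (LINT x|lborel. v x * partial_deriv i \<phi> x)"
    if "\<phi> \<in> test_functions" for i \<phi>
  proof (rule integral_cong_AE)
    have [measurable]: "partial_deriv i \<phi> \<in> borel_measurable borel"
      by (rule test_function_measurable[OF that])
    show "(\<lambda>x. u x * partial_deriv i \<phi> x) \<in> borel_measurable lborel"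
      "(\<lambda>x. v x * partial_deriv i \<phi> x) \<in> borel_measurable lborel" by measurable
  qed (use assms(2) in \<open>auto elim: eventually_mono\<close>)
  then show ?thesis using assms(1) by (simp add: is_gradient_measure_def)
qed

lemma is_gradient_measure_add:
  assumes u: "is_gradient_measure u \<mu>" "integrable lborel u"
    and v: "is_gradient_measure v \<nu>" "integrable lborel v"
  shows "is_gradient_measure (\<lambda>x. u x + v x) (\<lambda>E. \<mu> E + \<nu> E)"
  unfolding is_gradient_measure_def
proof
  fix i
  from u(1) obtain P N where PN: "finite_measure P" "finite_measure N" "sets P = sets borel" "sets N = sets borel"
      "\<And>E. \<mu> E $ i = measure P E - measure N E"
      "\<And>\<phi>. \<phi> \<in> test_functions \<Longrightarrow> (LINT x|lborel. u x * partial_deriv i \<phi> x)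
                           = - ((LINT x|P. \<phi> x) - (LINT x|N. \<phi> x))"
    by (rule is_gradient_measureE[of _ _ i]) (rule that)
  from v(1) obtain P' N' where PN': "finite_measure P'" "finite_measure N'" "sets P' = sets borel" "sets N' = sets borel"
      "\<And>E. \<nu> E $ i = measure P' E - measure N' E"
      "\<And>\<phi>. \<phi> \<in> test_functions \<Longrightarrow> (LINT x|lborel. v x * partial_deriv i \<phi> x)
                           = - ((LINT x|P'. \<phi> x) - (LINT x|N'. \<phi> x))"
    by (rule is_gradient_measureE[of _ _ i]) (rule that)
  show "\<exists>P N. finite_measure P \<and> finite_measure N \<and> sets P = sets borel \<and> sets N = sets borel \<and>
      (\<forall>E. (\<mu> E + \<nu> E) $ i = measure P E - measure N E) \<and>
      (\<forall>\<phi>\<in>test_functions. (LINT x|lborel. (u x + v x) * partial_deriv i \<phi> x)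
                           = - ((LINT x|P. \<phi> x) - (LINT x|N. \<phi> x)))"
  proof (intro exI conjI allI ballI)
    show "finite_measure (add_measure P P')" "finite_measure (add_measure N N')"
      by (simp_all add: finite_add_measure PN PN')
    show "sets (add_measure P P') = sets borel" "sets (add_measure N N') = sets borel"
      by (simp_all add: PN PN')
    show "(\<mu> E + \<nu> E) $ i = measure (add_measure P P') E - measure (add_measure N N') E" for E
      by (simp add: measure_add_measure PN PN')
    fix \<phi> :: "real^'a \<Rightarrow> real" assume \<phi>: "\<phi> \<in> test_functions"
    have "(LINT x|lborel. (u x + v x) * partial_deriv i \<phi> x)
        = (LINT x|lborel. u x * partial_deriv i \<phi> x) + (LINT x|lborel. v x * partial_deriv i \<phi> x)"
      by (simp add: distrib_right integrable_times_partial \<phi> u v)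
    then show "(LINT x|lborel. (u x + v x) * partial_deriv i \<phi> x)
        = - ((LINT x|add_measure P P'. \<phi> x) - (LINT x|add_measure N N'. \<phi> x))"
      using \<phi> by (simp add: integral_add_measure test_function_integrable PN PN')
  qed
qed

lemma is_gradient_measure_scale_nonneg:
  assumes u: "is_gradient_measure u \<mu>" and c: "c \<ge> 0"
  shows "is_gradient_measure (\<lambda>x. c * u x) (\<lambda>E. c *\<^sub>R \<mu> E)"
  unfolding is_gradient_measure_def
proof
  fix i
  from u(1) obtain P N where PN: "finite_measure P" "finite_measure N" "sets P = sets borel" "sets N = sets borel"
      "\<And>E. \<mu> E $ i = measure P E - measure N E"
      "\<And>\<phi>. \<phi> \<in> test_functions \<Longrightarrow> (LINT x|lborel. u x * partial_deriv i \<phi> x)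
                           = - ((LINT x|P. \<phi> x) - (LINT x|N. \<phi> x))"
    by (rule is_gradient_measureE[of _ _ i]) (rule that)
  have fin: "finite_measure (scale_measure (ennreal c) M)" if "finite_measure M" for M :: "(real^'a) measure"
    using finite_measure.emeasure_finite[OF that]
    by (intro finite_measureI) (simp add: ennreal_mult_eq_top_iff)
  have int: "(LINT x|scale_measure (ennreal c) M. \<phi> x) = c * (LINT x|M. \<phi> x)"
    if "\<phi> \<in> test_functions" "sets M = sets borel" for M \<phi>
  proof -
    have \<phi>: "\<phi> \<in> borel_measurable M"
      using test_function_measurable(1)[OF that(1)] that(2) by (simp cong: measurable_cong_sets)
    have "scale_measure (ennreal c) M = density M (\<lambda>_. ennreal c)"
      by (rule measure_eqI) (auto simp: emeasure_density_const)
    then show ?thesis using \<phi> c by (simp add: integral_real_density)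
  qed
  show "\<exists>P N. finite_measure P \<and> finite_measure N \<and> sets P = sets borel \<and> sets N = sets borel \<and>
      (\<forall>E. (c *\<^sub>R \<mu> E) $ i = measure P E - measure N E) \<and>
      (\<forall>\<phi>\<in>test_functions. (LINT x|lborel. (c * u x) * partial_deriv i \<phi> x)
                           = - ((LINT x|P. \<phi> x) - (LINT x|N. \<phi> x)))"
    using c PN
    by (intro exI[of _ "scale_measure (ennreal c) P"] exI[of _ "scale_measure (ennreal c) N"])
       (auto simp: fin int mult.assoc right_diff_distrib)
qed

lemma is_gradient_measure_uminus:
  assumes "is_gradient_measure u \<mu>"
  shows "is_gradient_measure (\<lambda>x. - u x) (\<lambda>E. - \<mu> E)"
  unfolding is_gradient_measure_def
proof
  fix i
  from assms obtain P N where PN: "finite_measure P" "finite_measure N" "sets P = sets borel" "sets N = sets borel"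
      "\<And>E. \<mu> E $ i = measure P E - measure N E"
      "\<And>\<phi>. \<phi> \<in> test_functions \<Longrightarrow> (LINT x|lborel. u x * partial_deriv i \<phi> x)
                           = - ((LINT x|P. \<phi> x) - (LINT x|N. \<phi> x))"
    by (rule is_gradient_measureE[of _ _ i]) (rule that)
  show "\<exists>P N. finite_measure P \<and> finite_measure N \<and> sets P = sets borel \<and> sets N = sets borel \<and>
      (\<forall>E. (- \<mu> E) $ i = measure P E - measure N E) \<and>
      (\<forall>\<phi>\<in>test_functions. (LINT x|lborel. (- u x) * partial_deriv i \<phi> x)
                           = - ((LINT x|P. \<phi> x) - (LINT x|N. \<phi> x)))"
    using PN by (intro exI[of _ N] exI[of _ P]) auto
qed

lemma is_gradient_measure_scale:
  assumes "is_gradient_measure u \<mu>"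
  shows "is_gradient_measure (\<lambda>x. c * u x) (\<lambda>E. c *\<^sub>R \<mu> E)"
proof (cases "c \<ge> 0")
  case False
  then show ?thesis
    using is_gradient_measure_uminus[OF is_gradient_measure_scale_nonneg[OF assms, of "- c"]] by simp
qed (use assms is_gradient_measure_scale_nonneg in blast)

lemma variation_measure_finite:
  assumes "is_gradient_measure u \<mu>"
  shows "variation_measure \<mu> E < top"
proof -
  have "\<forall>i. \<exists>P N. finite_measure P \<and> finite_measure N \<and> sets P = sets borel \<and> sets N = sets borel \<and>
      (\<forall>E. \<mu> E $ i = measure P E - measure N E)"
    using assms unfolding is_gradient_measure_def by meson
  then obtain P N where PN: "\<And>i. finite_measure (P i)" "\<And>i. finite_measure (N i)"
      "\<And>i. sets (P i) = sets borel" "\<And>i. sets (N i) = sets borel"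
      "\<And>i E. \<mu> E $ i = measure (P i) E - measure (N i) E" by metis
  have le: "ennreal (norm (\<mu> E)) \<le> (\<Sum>i\<in>UNIV. emeasure (P i) E + emeasure (N i) E)" for E
  proof -
    have "norm (\<mu> E) \<le> (\<Sum>i\<in>UNIV. \<bar>\<mu> E $ i\<bar>)" by (rule norm_le_l1_cart)
    also have "\<dots> \<le> (\<Sum>i\<in>UNIV. measure (P i) E + measure (N i) E)"
      by (intro sum_mono) (auto simp: PN(5) abs_if)
    finally show ?thesis
      using PN(1,2) by (simp add: finite_measure.emeasure_eq_measure ennreal_leI flip: ennreal_plus)
  qed
  have "variation_measure \<mu> E \<le> (\<Sum>i\<in>UNIV. emeasure (P i) E + emeasure (N i) E)"
    unfolding variation_measure_def
  proof (rule SUP_least, clarify)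
    fix A :: "nat \<Rightarrow> (real^'a) set" assume A: "range A \<subseteq> sets borel" "disjoint_family A"
    have "(\<Sum>k. ennreal (norm (\<mu> (A k)))) \<le> (\<Sum>k. \<Sum>i\<in>UNIV. emeasure (P i) (A k) + emeasure (N i) (A k))"
      by (intro suminf_le le) auto
    also have "\<dots> = (\<Sum>i\<in>UNIV. \<Sum>k. emeasure (P i) (A k) + emeasure (N i) (A k))"
      by (rule suminf_sum) auto
    also have "\<dots> = (\<Sum>i\<in>UNIV. emeasure (P i) (\<Union>k. A k) + emeasure (N i) (\<Union>k. A k))"
      using A PN by (simp add: suminf_emeasure flip: suminf_add)
    finally show "(\<Sum>k. ennreal (norm (\<mu> (A k)))) \<le> (\<Sum>i\<in>UNIV. emeasure (P i) (\<Union>k. A k) + emeasure (N i) (\<Union>k. A k))" .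
  qed
  also have "\<dots> < top"
    using PN(1,2) by (simp add: finite_measure.emeasure_eq_measure)
  finally show ?thesis .
qed

lemma variation_measure_add_le:
  "variation_measure (\<lambda>E. \<mu> E + \<nu> E) E \<le> variation_measure \<mu> E + variation_measure \<nu> E"
  unfolding variation_measure_def[of "\<lambda>E. \<mu> E + \<nu> E"]
proof (rule SUP_least)
  fix A :: "nat \<Rightarrow> (real^'a) set" assume A: "A \<in> {A. range A \<subseteq> sets borel \<and> disjoint_family A \<and> (\<Union>k. A k) = E}"
  have "(\<Sum>k. ennreal (norm (\<mu> (A k) + \<nu> (A k)))) \<le> (\<Sum>k. ennreal (norm (\<mu> (A k))) + ennreal (norm (\<nu> (A k))))"
    by (intro suminf_le) (auto simp: norm_triangle_ineq ennreal_leI simp flip: ennreal_plus)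
  also have "\<dots> = (\<Sum>k. ennreal (norm (\<mu> (A k)))) + (\<Sum>k. ennreal (norm (\<nu> (A k))))"
    by (simp add: suminf_add)
  also have "\<dots> \<le> variation_measure \<mu> E + variation_measure \<nu> E"
    unfolding variation_measure_def by (intro add_mono SUP_upper A)
  finally show "(\<Sum>k. ennreal (norm (\<mu> (A k) + \<nu> (A k)))) \<le> variation_measure \<mu> E + variation_measure \<nu> E" .
qed

lemma variation_measure_scale:
  "variation_measure (\<lambda>E. c *\<^sub>R \<mu> E) E = ennreal \<bar>c\<bar> * variation_measure \<mu> E"
  unfolding variation_measure_def
  by (simp add: SUP_mult_left_ennreal ennreal_mult)

lemma BV_cubeD:
  assumes "u \<in> BV_cube"
  shows "integrable lborel u" "u \<in> borel_measurable borel"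
    "is_gradient_measure u (gradient_measure u)" "AE x in lborel. x \<notin> cbox 0 1 \<longrightarrow> u x = 0"
proof -
  obtain \<mu> where "is_gradient_measure u \<mu>" "integrable lborel u" "AE x in lborel. x \<notin> cbox 0 1 \<longrightarrow> u x = 0"
    using assms by (auto simp: BV_cube_def BV_def)
  then show "integrable lborel u" "u \<in> borel_measurable borel"
    "is_gradient_measure u (gradient_measure u)" "AE x in lborel. x \<notin> cbox 0 1 \<longrightarrow> u x = 0"
    using gradient_measure_eqI by auto
qed

lemma BV_cubeI:
  assumes "integrable lborel u" "is_gradient_measure u \<mu>" "AE x in lborel. x \<notin> cbox 0 1 \<longrightarrow> u x = 0"
  shows "u \<in> BV_cube"
  using assms by (auto simp: BV_cube_def BV_def)

lemma BV_cube_zero: "(\<lambda>_. 0) \<in> BV_cube"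
  by (rule BV_cubeI[OF _ is_gradient_measure_zero]) auto

lemma BV_cube_add:
  assumes "u \<in> BV_cube" "v \<in> BV_cube"
  shows "(\<lambda>x. u x + v x) \<in> BV_cube"
proof (rule BV_cubeI[OF _ is_gradient_measure_add])
  show "AE x in lborel. x \<notin> cbox 0 1 \<longrightarrow> u x + v x = 0"
    using BV_cubeD(4)[OF assms(1)] BV_cubeD(4)[OF assms(2)] by eventually_elim auto
  show "is_gradient_measure u (gradient_measure u)" "is_gradient_measure v (gradient_measure v)"
    by (intro BV_cubeD assms)+
qed (simp_all add: BV_cubeD assms)

lemma BV_cube_scale:
  assumes "u \<in> BV_cube"
  shows "(\<lambda>x. c * u x) \<in> BV_cube"
proof (rule BV_cubeI[OF _ is_gradient_measure_scale[OF BV_cubeD(3)[OF assms]]])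
  show "AE x in lborel. x \<notin> cbox 0 1 \<longrightarrow> c * u x = 0"
    using BV_cubeD(4)[OF assms] by eventually_elim auto
qed (simp add: BV_cubeD assms)

lemma BV_norm_cong:
  assumes "u \<in> BV_cube" "v \<in> BV_cube" "AE x in lborel. u x = v x"
  shows "BV_norm u = BV_norm v"
proof -
  have [measurable]: "u \<in> borel_measurable borel" "v \<in> borel_measurable borel"
    using assms BV_cubeD by auto
  have "gradient_measure v = gradient_measure u"
    by (intro gradient_measure_eqI is_gradient_measure_cong[OF BV_cubeD(3)]) (use assms in auto)
  moreover have "(LINT x|lborel. \<bar>u x\<bar>) = (LINT x|lborel. \<bar>v x\<bar>)"
    by (rule integral_cong_AE) (use assms(3) in \<open>auto elim: eventually_mono\<close>)
  ultimately show ?thesis by (simp add: BV_norm_def)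
qed

lemma BV_norm_eq_0_iff:
  fixes u :: "real^'n::finite \<Rightarrow> real"
  assumes "u \<in> BV_cube"
  shows "BV_norm u = 0 \<longleftrightarrow> (AE x in lborel. u x = 0)"
proof
  assume "BV_norm u = 0"
  moreover have "0 \<le> (LINT x|lborel. \<bar>u x\<bar>)" by simp
  moreover have "0 \<le> enn2real (variation_measure (gradient_measure u) UNIV)" by simp
  ultimately have "(LINT x|lborel. \<bar>u x\<bar>) = 0" unfolding BV_norm_def by linarith
  then show "AE x in lborel. u x = 0"
    using BV_cubeD(1)[OF assms] by (simp add: integral_nonneg_eq_0_iff_AE)
next
  assume *: "AE x in lborel. u x = 0"
  have "BV_norm u = BV_norm (\<lambda>_ :: real^'n. 0)"
    by (rule BV_norm_cong) (use assms * BV_cube_zero in auto)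
  moreover have "gradient_measure (\<lambda>_ :: real^'n. 0) = (\<lambda>_. 0)"
    by (rule gradient_measure_eqI[OF is_gradient_measure_zero])
  moreover have "variation_measure (\<lambda>_ :: (real^'n) set. 0) UNIV = 0"
    using variation_measure_scale[of 0 "\<lambda>_. 0" UNIV] by simp
  ultimately show "BV_norm u = 0" by (simp add: BV_norm_def)
qed

lemma BV_norm_add_le:
  assumes u: "u \<in> BV_cube" and v: "v \<in> BV_cube"
  shows "BV_norm (\<lambda>x. u x + v x) \<le> BV_norm u + BV_norm v"
proof -
  have "gradient_measure (\<lambda>x. u x + v x) = (\<lambda>E. gradient_measure u E + gradient_measure v E)"
    by (intro gradient_measure_eqI is_gradient_measure_add BV_cubeD u v)
  moreover have "enn2real (variation_measure (\<lambda>E. gradient_measure u E + gradient_measure v E) UNIV)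
      \<le> enn2real (variation_measure (gradient_measure u) UNIV + variation_measure (gradient_measure v) UNIV)"
    using variation_measure_finite[OF BV_cubeD(3)[OF u]] variation_measure_finite[OF BV_cubeD(3)[OF v]]
    by (intro enn2real_mono variation_measure_add_le) simp
  moreover have "\<dots> = enn2real (variation_measure (gradient_measure u) UNIV)
      + enn2real (variation_measure (gradient_measure v) UNIV)"
    by (intro enn2real_plus variation_measure_finite[OF BV_cubeD(3)] u v)
  moreover have "(LINT x|lborel. \<bar>u x + v x\<bar>) \<le> (LINT x|lborel. \<bar>u x\<bar> + \<bar>v x\<bar>)"
    using u v by (intro integral_mono) (auto simp: BV_cubeD)
  moreover have "\<dots> = (LINT x|lborel. \<bar>u x\<bar>) + (LINT x|lborel. \<bar>v x\<bar>)"
    using u v by (simp add: BV_cubeD)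
  ultimately show ?thesis by (simp add: BV_norm_def)
qed

lemma BV_norm_scale:
  assumes u: "u \<in> BV_cube"
  shows "BV_norm (\<lambda>x. c * u x) = \<bar>c\<bar> * BV_norm u"
proof -
  have "gradient_measure (\<lambda>x. c * u x) = (\<lambda>E. c *\<^sub>R gradient_measure u E)"
    by (intro gradient_measure_eqI is_gradient_measure_scale BV_cubeD u)
  then show ?thesis
    by (simp add: BV_norm_def variation_measure_scale abs_mult enn2real_mult distrib_left)
qed

text \<open>The normed space consists of a.e. classes.  Integrability with respect to \<^const>\<open>lborel\<close> entails
  Borel measurability, so a class contains only Borel representatives; every Lebesgue class has one.\<close>

definition BV_rel :: "(real^'n::finite \<Rightarrow> real) \<Rightarrow> (real^'n \<Rightarrow> real) \<Rightarrow> bool"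
  where "BV_rel u v \<longleftrightarrow> u \<in> BV_cube \<and> v \<in> BV_cube \<and> (AE x in lborel. u x = v x)"

quotient_type (overloaded) 'n bv = "real^'n::finite \<Rightarrow> real" / partial: BV_rel
proof (rule part_equivpI)
  show "\<exists>u. BV_rel u (u :: real^'n::finite \<Rightarrow> real)" using BV_cube_zero by (auto simp: BV_rel_def)
  show "symp (BV_rel :: (real^'n::finite \<Rightarrow> real) \<Rightarrow> _)"
    by (auto simp: symp_def BV_rel_def elim: eventually_mono)
  show "transp (BV_rel :: (real^'n::finite \<Rightarrow> real) \<Rightarrow> _)"
    by (auto simp: transp_def BV_rel_def elim: eventually_elim2)
qed

instantiation bv :: (finite) real_normed_vector
begin

lift_definition zero_bv :: "'a bv" is "\<lambda>_. 0"
  by (simp add: BV_rel_def BV_cube_zero)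

lift_definition plus_bv :: "'a bv \<Rightarrow> 'a bv \<Rightarrow> 'a bv" is "\<lambda>u v x. u x + v x"
  by (auto simp: BV_rel_def BV_cube_add elim: eventually_elim2)

lift_definition scaleR_bv :: "real \<Rightarrow> 'a bv \<Rightarrow> 'a bv" is "\<lambda>c u x. c * u x"
  by (auto simp: BV_rel_def BV_cube_scale elim: eventually_mono)

definition uminus_bv :: "'a bv \<Rightarrow> 'a bv" where "uminus_bv u = (-1) *\<^sub>R u"

definition minus_bv :: "'a bv \<Rightarrow> 'a bv \<Rightarrow> 'a bv" where "minus_bv u v = u + (-1) *\<^sub>R v"

lift_definition norm_bv :: "'a bv \<Rightarrow> real" is BV_norm
  by (auto simp: BV_rel_def BV_norm_cong)

definition dist_bv :: "'a bv \<Rightarrow> 'a bv \<Rightarrow> real" where "dist_bv u v = norm (u - v)"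

definition sgn_bv :: "'a bv \<Rightarrow> 'a bv" where "sgn_bv u = inverse (norm u) *\<^sub>R u"

definition "(uniformity :: ('a bv \<times> 'a bv) filter) = (INF e\<in>{0 <..}. principal {(x, y). dist x y < e})"

definition open_bv :: "'a bv set \<Rightarrow> bool"
  where "open_bv S = (\<forall>x\<in>S. \<forall>\<^sub>F (x', y) in uniformity. x' = x \<longrightarrow> y \<in> S)"

instance
proof
  fix u v w :: "'a bv" and a b :: real
  show "u + v + w = u + (v + w)" "u + v = v + u" "0 + u = u"
    "a *\<^sub>R (u + v) = a *\<^sub>R u + a *\<^sub>R v" "(a + b) *\<^sub>R u = a *\<^sub>R u + b *\<^sub>R u"
    "a *\<^sub>R b *\<^sub>R u = (a * b) *\<^sub>R u" "1 *\<^sub>R u = u"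
    by (transfer, auto simp: BV_rel_def algebra_simps intro!: BV_cube_add BV_cube_scale BV_cube_zero)+
  show "- u + u = 0" unfolding uminus_bv_def
    by transfer (auto simp: BV_rel_def BV_cube_zero)
  show "u - v = u + - v" by (simp add: minus_bv_def uminus_bv_def)
  show "dist u v = norm (u - v)" by (rule dist_bv_def)
  show "sgn u = inverse (norm u) *\<^sub>R u" by (rule sgn_bv_def)
  show "norm u = 0 \<longleftrightarrow> u = 0"
    by transfer (auto simp: BV_rel_def BV_norm_eq_0_iff BV_cube_zero)
  show "norm (u + v) \<le> norm u + norm v"
    by transfer (auto simp: BV_rel_def BV_norm_add_le)
  show "norm (a *\<^sub>R u) = \<bar>a\<bar> * norm u"
    by transfer (auto simp: BV_rel_def BV_norm_scale)
qed (rule uniformity_bv_def open_bv_def)+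

end

section \<open>Strong charge functionals\<close>

definition Ld_cube :: "(real^'n::finite \<Rightarrow> real) set"
  where "Ld_cube = {f \<in> borel_measurable borel.
    set_integrable lborel (cbox 0 1) (\<lambda>x. \<bar>f x\<bar> ^ CARD('n))}"

text \<open>\<open>is_T_functional f \<alpha>\<close> says that \<open>\<alpha>\<close> is the functional \<open>T\<^sub>f\<close>; \<open>abs_bv u\<close> is the a.e. class of \<open>u\<close>.
  For \<open>f\<close> in \<^const>\<open>Ld_cube\<close> integrability of \<open>f u\<close> is no restriction, and \<open>T\<^sub>f\<close> exists as a bounded
  linear functional, by the Sobolev embedding of \<open>BV\<close> into \<open>L\<^bsup>d/(d-1)\<^esup>\<close> and Hoelder's inequality;
  stating it makes the set of all \<open>T\<^sub>f\<close> visibly a linear subspace.\<close>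

definition is_T_functional :: "(real^'n::finite \<Rightarrow> real) \<Rightarrow> ('n bv \<Rightarrow>\<^sub>L real) \<Rightarrow> bool"
  where "is_T_functional f \<alpha> \<longleftrightarrow>
    (\<forall>u\<in>BV_cube. set_integrable lborel (cbox 0 1) (\<lambda>x. f x * u x) \<and>
                  blinfun_apply \<alpha> (abs_bv u) = (LINT x:cbox 0 1|lborel. f x * u x))"

definition SCH :: "('n::finite bv \<Rightarrow>\<^sub>L real) set"
  where "SCH = closure {\<alpha>. \<exists>f\<in>Ld_cube. is_T_functional f \<alpha>}"

lemma Ld_cube_scale: "f \<in> Ld_cube \<Longrightarrow> (\<lambda>x. c * f x) \<in> Ld_cube"
  by (auto simp: Ld_cube_def abs_mult power_mult_distrib)

lemma Ld_cube_add:
  fixes f g :: "real^'n::finite \<Rightarrow> real"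
  assumes "f \<in> Ld_cube" "g \<in> Ld_cube"
  shows "(\<lambda>x. f x + g x) \<in> Ld_cube"
proof -
  let ?d = "CARD('n)"
  have [measurable]: "f \<in> borel_measurable borel" "g \<in> borel_measurable borel"
    using assms by (auto simp: Ld_cube_def)
  have le: "\<bar>a + b\<bar> ^ ?d \<le> 2 ^ ?d * (\<bar>a\<bar> ^ ?d + \<bar>b\<bar> ^ ?d)" for a b :: real
  proof -
    have "\<bar>a + b\<bar> ^ ?d \<le> (2 * max \<bar>a\<bar> \<bar>b\<bar>) ^ ?d" by (intro power_mono) auto
    also have "\<dots> \<le> 2 ^ ?d * (\<bar>a\<bar> ^ ?d + \<bar>b\<bar> ^ ?d)"
      by (auto simp: power_mult_distrib max_def)
    finally show ?thesis .
  qed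
  have "set_integrable lborel (cbox 0 1) (\<lambda>x. \<bar>f x + g x\<bar> ^ ?d)"
  proof (rule set_integrable_bound)
    show "set_integrable lborel (cbox 0 1) (\<lambda>x. 2 ^ ?d * (\<bar>f x\<bar> ^ ?d + \<bar>g x\<bar> ^ ?d))"
      using assms by (auto simp: Ld_cube_def intro!: set_integral_add)
    show "set_borel_measurable lborel (cbox 0 1) (\<lambda>x. \<bar>f x + g x\<bar> ^ ?d)"
      unfolding set_borel_measurable_def by measurable
  qed (use le in \<open>auto intro!: AE_I2 simp: abs_mult\<close>)
  then show ?thesis by (simp add: Ld_cube_def)
qed

lemma is_T_functional_add:
  assumes "is_T_functional f \<alpha>" "is_T_functional g \<beta>"
  shows "is_T_functional (\<lambda>x. f x + g x) (\<alpha> + \<beta>)"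
  using assms by (auto simp: is_T_functional_def distrib_right blinfun.add_left set_integral_add)

lemma is_T_functional_scale:
  assumes "is_T_functional f \<alpha>"
  shows "is_T_functional (\<lambda>x. c * f x) (c *\<^sub>R \<alpha>)"
  using assms by (auto simp: is_T_functional_def mult.assoc blinfun.scaleR_left)

lemma SCH_zero: "0 \<in> SCH"
proof -
  have "is_T_functional (\<lambda>_. 0) 0" "(\<lambda>_. 0) \<in> Ld_cube"
    by (simp_all add: is_T_functional_def Ld_cube_def set_lebesgue_integral_def set_integrable_def)
  then have "0 \<in> {\<alpha>. \<exists>f\<in>Ld_cube. is_T_functional f \<alpha>}" by blast
  then show ?thesis unfolding SCH_def by (rule subsetD[OF closure_subset])
qed

lemma SCH_add:
  assumes "\<alpha> \<in> SCH" "\<beta> \<in> SCH"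
  shows "\<alpha> + \<beta> \<in> SCH"
proof -
  obtain X Y where
    X: "\<forall>k. \<exists>f\<in>Ld_cube. is_T_functional f (X k)" "X \<longlonglongrightarrow> \<alpha>" and
    Y: "\<forall>k. \<exists>f\<in>Ld_cube. is_T_functional f (Y k)" "Y \<longlonglongrightarrow> \<beta>"
    using assms unfolding SCH_def closure_sequential mem_Collect_eq by (elim exE conjE) (rule that)
  have "\<exists>f\<in>Ld_cube. is_T_functional f (X k + Y k)" for k
  proof -
    from X(1) Y(1) obtain f g where "f \<in> Ld_cube" "is_T_functional f (X k)"
        "g \<in> Ld_cube" "is_T_functional g (Y k)" by meson
    then show ?thesis by (intro bexI[of _ "\<lambda>x. f x + g x"] is_T_functional_add Ld_cube_add)
  qed
  then show ?thesis unfolding SCH_def closure_sequential mem_Collect_eq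
    by (intro exI[of _ "\<lambda>k. X k + Y k"] conjI allI tendsto_add X(2) Y(2))
qed

lemma SCH_scale:
  assumes "\<alpha> \<in> SCH"
  shows "c *\<^sub>R \<alpha> \<in> SCH"
proof -
  obtain X where X: "\<forall>k. \<exists>f\<in>Ld_cube. is_T_functional f (X k)" "X \<longlonglongrightarrow> \<alpha>"
    using assms unfolding SCH_def closure_sequential mem_Collect_eq by (elim exE conjE) (rule that)
  have "\<exists>f\<in>Ld_cube. is_T_functional f (c *\<^sub>R X k)" for k
  proof -
    from X(1) obtain f where "f \<in> Ld_cube" "is_T_functional f (X k)" by meson
    then show ?thesis by (intro bexI[of _ "\<lambda>x. c * f x"] is_T_functional_scale Ld_cube_scale)
  qed
  then show ?thesis unfolding SCH_def closure_sequential mem_Collect_eq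
    by (intro exI[of _ "\<lambda>k. c *\<^sub>R X k"] conjI allI tendsto_scaleR tendsto_const X(2))
qed

typedef (overloaded) 'n sch = "SCH :: ('n::finite bv \<Rightarrow>\<^sub>L real) set"
  using SCH_zero by blast

setup_lifting type_definition_sch

instantiation sch :: (finite) real_normed_vector
begin

lift_definition zero_sch :: "'a sch" is 0 by (rule SCH_zero)

lift_definition plus_sch :: "'a sch \<Rightarrow> 'a sch \<Rightarrow> 'a sch" is "(+)" by (rule SCH_add)

lift_definition scaleR_sch :: "real \<Rightarrow> 'a sch \<Rightarrow> 'a sch" is "scaleR" by (rule SCH_scale)

definition uminus_sch :: "'a sch \<Rightarrow> 'a sch" where "uminus_sch \<alpha> = (-1) *\<^sub>R \<alpha>"

definition minus_sch :: "'a sch \<Rightarrow> 'a sch \<Rightarrow> 'a sch" where "minus_sch \<alpha> \<beta> = \<alpha> + (-1) *\<^sub>R \<beta>"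

lift_definition norm_sch :: "'a sch \<Rightarrow> real" is norm .

definition dist_sch :: "'a sch \<Rightarrow> 'a sch \<Rightarrow> real" where "dist_sch \<alpha> \<beta> = norm (\<alpha> - \<beta>)"

definition sgn_sch :: "'a sch \<Rightarrow> 'a sch" where "sgn_sch \<alpha> = inverse (norm \<alpha>) *\<^sub>R \<alpha>"

definition "(uniformity :: ('a sch \<times> 'a sch) filter) = (INF e\<in>{0 <..}. principal {(x, y). dist x y < e})"

definition open_sch :: "'a sch set \<Rightarrow> bool"
  where "open_sch S = (\<forall>x\<in>S. \<forall>\<^sub>F (x', y) in uniformity. x' = x \<longrightarrow> y \<in> S)"

instance
proof
  fix \<alpha> \<beta> \<gamma> :: "'a sch" and a b :: real
  show "\<alpha> + \<beta> + \<gamma> = \<alpha> + (\<beta> + \<gamma>)" "\<alpha> + \<beta> = \<beta> + \<alpha>" "0 + \<alpha> = \<alpha>"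
    "a *\<^sub>R (\<alpha> + \<beta>) = a *\<^sub>R \<alpha> + a *\<^sub>R \<beta>" "(a + b) *\<^sub>R \<alpha> = a *\<^sub>R \<alpha> + b *\<^sub>R \<alpha>"
    "a *\<^sub>R b *\<^sub>R \<alpha> = (a * b) *\<^sub>R \<alpha>" "1 *\<^sub>R \<alpha> = \<alpha>"
    by (transfer, simp add: algebra_simps)+
  show "- \<alpha> + \<alpha> = 0" unfolding uminus_sch_def by transfer simp
  show "\<alpha> - \<beta> = \<alpha> + - \<beta>" by (simp add: minus_sch_def uminus_sch_def)
  show "dist \<alpha> \<beta> = norm (\<alpha> - \<beta>)" by (rule dist_sch_def)
  show "sgn \<alpha> = inverse (norm \<alpha>) *\<^sub>R \<alpha>" by (rule sgn_sch_def)
  show "norm \<alpha> = 0 \<longleftrightarrow> \<alpha> = 0" by transfer simp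
  show "norm (\<alpha> + \<beta>) \<le> norm \<alpha> + norm \<beta>" by transfer (rule norm_triangle_ineq)
  show "norm (a *\<^sub>R \<alpha>) = \<bar>a\<bar> * norm \<alpha>" by transfer simp
qed (rule uniformity_sch_def open_sch_def)+

end

lemma Rep_sch_diff: "Rep_sch (\<alpha> - \<beta>) = Rep_sch \<alpha> - Rep_sch \<beta>"
  unfolding minus_sch_def plus_sch.rep_eq scaleR_sch.rep_eq by simp

instance sch :: (finite) banach
proof
  fix X :: "nat \<Rightarrow> 'a sch" assume "Cauchy X"
  have dist: "dist (Rep_sch \<alpha>) (Rep_sch \<beta>) = dist \<alpha> \<beta>" for \<alpha> \<beta> :: "'a sch"
    by (simp only: dist_norm norm_sch.rep_eq Rep_sch_diff)
  have "Cauchy (\<lambda>n. Rep_sch (X n))"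
    using \<open>Cauchy X\<close> by (simp only: Cauchy_def dist)
  then obtain \<alpha> where \<alpha>: "(\<lambda>n. Rep_sch (X n)) \<longlonglongrightarrow> \<alpha>"
    unfolding Cauchy_convergent_iff convergent_def by (rule exE)
  have "closed (SCH :: ('a bv \<Rightarrow>\<^sub>L real) set)" unfolding SCH_def by (rule closed_closure)
  then have "\<alpha> \<in> SCH" by (rule closed_sequentially[OF _ Rep_sch \<alpha>])
  then have "Rep_sch (Abs_sch \<alpha>) = \<alpha>" by (rule Abs_sch_inverse)
  then have "(\<lambda>n. dist (Rep_sch (X n)) (Rep_sch (Abs_sch \<alpha>))) \<longlonglongrightarrow> 0"
    using \<alpha> by (simp only: tendsto_dist_iff[symmetric])
  then have "X \<longlonglongrightarrow> Abs_sch \<alpha>" by (simp only: dist tendsto_dist_iff[symmetric])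
  then show "convergent X" by (rule convergentI)
qed

definition Upsilon :: "'n::finite bv \<Rightarrow> ('n sch \<Rightarrow>\<^sub>L real)"
  where "Upsilon u = Blinfun (\<lambda>\<alpha>. blinfun_apply (Rep_sch \<alpha>) u)"

lemma Upsilon_apply: "blinfun_apply (Upsilon u) \<alpha> = blinfun_apply (Rep_sch \<alpha>) u"
proof -
  have "bounded_linear (\<lambda>\<alpha>. blinfun_apply (Rep_sch \<alpha>) u)"
  proof (rule bounded_linear_intro[where K = "norm u"])
    show "norm (blinfun_apply (Rep_sch \<alpha>) u) \<le> norm \<alpha> * norm u" for \<alpha>
      unfolding norm_sch.rep_eq by (rule norm_blinfun)
  qed (simp_all add: plus_sch.rep_eq scaleR_sch.rep_eq blinfun.add_left blinfun.scaleR_left)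
  then show ?thesis by (simp add: Upsilon_def bounded_linear_Blinfun_apply)
qed

end

theory Submission
  imports Defs "HOL-Probability.Helly_Selection"
begin

text \<open>The map \<open>\<Upsilon>\<close> has norm at most \<open>1\<close>, and it is injective because the charge \<open>T\<^sub>f\<close> with \<open>f\<close> the sign of \<open>u\<close> takes the value
\<open>\<integral>\<bar>u\<bar>\<close> at \<open>u\<close>.  The content of the theorem is that every continuous functional \<open>\<Lambda>\<close> on \<open>SCH\<close> is evaluation at some \<open>u\<close>
of bounded variation whose norm is at most a constant times that of \<open>\<Lambda>\<close>.  That estimate also gives the continuity
of the inverse.  The function \<open>u\<close> is found as follows.

Restrict \<open>\<Lambda>\<close> to charges \<open>T\<^sub>f\<close> with \<open>f\<close> bounded.  By the Sobolev inequality (\<open>sobolev_bounded\<close>) the norm of \<open>T\<^sub>f\<close> is at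
most the norm of \<open>f\<close> in \<open>L\<^sup>d\<close>.  Hence \<open>A \<mapsto> \<Lambda> T\<^sub>A\<close>, where \<open>T\<^sub>A\<close> is the charge of the indicator function of \<open>A\<close>, is a
countably additive set function that vanishes on null sets, and the Radon-Nikodym theorem
(\<open>signed_Radon_Nikodym\<close>) gives an integrable \<open>u\<close> on the cube with \<open>\<Lambda> T\<^sub>f = \<integral>f u\<close> for all bounded \<open>f\<close>.

To see that \<open>u\<close> has bounded variation, mollify it.  For a function \<open>s\<close> with values in \<open>[-1, 1]\<close>, Fubini's theorem
writes the integral of \<open>s\<close> against the \<open>i\<close>-th derivative of the mollified \<open>u\<close> as \<open>\<integral>g u = \<Lambda> T\<^sub>g\<close> with a bounded function \<open>g\<close> that
depends on \<open>s\<close> and the mollifier only.  The same identity for functions \<open>v\<close> of bounded variation shows that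
\<open>T\<^sub>g v\<close> is at most the total variation of \<open>v\<close>, so \<open>T\<^sub>g\<close> has norm at most \<open>1\<close> (\<open>norm_cube_charge_adj_deriv_le\<close>).  Therefore
the derivatives of all mollifications of \<open>u\<close> are bounded in \<open>L\<^sup>1\<close> by the norm of \<open>\<Lambda>\<close>.  Weak compactness of measures on
a compact set (\<open>prob_measures_weakly_compact\<close>) turns them into a gradient measure of \<open>u\<close> with a bound on its variation
(\<open>gradient_measure_of_bounded_mollifications\<close>).

Finally, the charges of bounded functions are dense in \<open>SCH\<close>: a function in \<open>L\<^sup>d\<close> is approximated by its truncations, and
the Sobolev inequality turns this into convergence of charges (\<open>truncations_tendsto_charge\<close>).  So \<open>\<Lambda>\<close> and
evaluation at \<open>u\<close>, which agree on these charges, are equal.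

The Sobolev inequality is proved in the dual form \<open>\<integral>f u \<le> \<parallel>f\<parallel>\<^sub>d \<parallel>Du\<parallel>\<close> by Gagliardo's method of integrating one
coordinate after the other (\<open>gagliardo_product_inequality\<close>).  Weak compactness is reduced to Helly's theorem
on the line by a continuous parametrisation of the compact set with a Borel right inverse
(\<open>compact_borel_coding\<close>).\<close>

section \<open>Hoelder's inequality and Gagliardo's product inequality\<close>

text \<open>With the value \<open>top\<close> at \<open>top\<close> this inverts the power map on all of \<open>ennreal\<close>, so the proof by slicing below
can turn an integral of an \<open>n\<close>-th power back into a function and continue.\<close>
definition ennroot :: "nat \<Rightarrow> ennreal \<Rightarrow> ennreal"
  where "ennroot n x = (if x = top then top else ennreal (root n (enn2real x)))"

lemma ennroot_power: "0 < n \<Longrightarrow> ennroot n x ^ n = x"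
  by (cases x) (auto simp: ennroot_def ennreal_power real_root_pow_pos2)

lemma measurable_ennroot [measurable]: "ennroot n \<in> borel_measurable borel"
  unfolding ennroot_def by measurable

lemma ennroot_eq_0D: "0 < n \<Longrightarrow> ennroot n x = 0 \<Longrightarrow> x = 0"
  using ennroot_power[of n x] by (auto simp: power_0_left)

lemma ennroot_eq_top_iff: "ennroot n x = top \<longleftrightarrow> x = top"
  by (auto simp: ennroot_def)

lemma power_le_imp_le_ennreal:
  fixes x y :: ennreal
  assumes "x ^ n \<le> y ^ n" "0 < n"
  shows "x \<le> y"
proof (cases x; cases y)
  fix a b assume ab: "0 \<le> a" "x = ennreal a" "0 \<le> b" "y = ennreal b"
  then have "a ^ n \<le> b ^ n" using assms by (simp add: ennreal_power)
  then show ?thesis using ab assms(2) by (simp add: ennreal_leI power_le_imp_le_base[of a "n - 1" b])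
qed (use assms in \<open>auto simp: power_eq_top_ennreal top_unique ennreal_power\<close>)

text \<open>The inequality of arithmetic and geometric means for the numbers \<open>x i ^ n\<close>, arranged so that only powers
occur and infinite values are harmless.\<close>
lemma prod_le_sum_powers:
  fixes x :: "'i \<Rightarrow> ennreal"
  assumes J: "finite J" "J \<noteq> {}"
  shows "of_nat (card J) * (\<Prod>i\<in>J. x i) \<le> (\<Sum>i\<in>J. x i ^ card J)"
proof (cases "\<exists>i\<in>J. x i = top")
  case True
  then obtain i where i: "i \<in> J" "x i = top" by blast
  have "x i ^ card J \<le> (\<Sum>i\<in>J. x i ^ card J)"
    using J i by (intro member_le_sum) auto
  moreover have "x i ^ card J = top" using i J by (simp add: power_eq_top_ennreal)
  ultimately show ?thesis by (simp add: top_unique)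
next
  case False
  define y where "y i = enn2real (x i)" for i
  let ?n = "card J"
  have n: "0 < ?n" using J by (simp add: card_gt_0_iff)
  have x: "x i = ennreal (y i)" if "i \<in> J" for i
    using False that by (auto simp: y_def less_top)
  have y: "0 \<le> y i" for i by (simp add: y_def)
  have "(\<Prod>i\<in>J. y i ^ ?n) powr (1 / ?n) \<le> (\<Sum>i\<in>J. y i ^ ?n / ?n)"
    by (rule arith_geom_mean) (use J y in auto)
  moreover have "(\<Prod>i\<in>J. y i ^ ?n) powr (1 / ?n) = (\<Prod>i\<in>J. y i)"
  proof -
    have "(\<Prod>i\<in>J. y i ^ ?n) powr (1 / ?n) = root ?n ((\<Prod>i\<in>J. y i) ^ ?n)"
      using n y by (simp add: prod_power_distrib root_powr_inverse prod_nonneg)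
    then show ?thesis using n y by (simp add: real_root_power_cancel prod_nonneg)
  qed
  ultimately have "real ?n * (\<Prod>i\<in>J. y i) \<le> (\<Sum>i\<in>J. y i ^ ?n)"
    using n by (simp add: sum_divide_distrib[symmetric] field_simps)
  then show ?thesis
    using y by (simp add: x prod_ennreal ennreal_power sum_ennreal prod_nonneg
        ennreal_of_nat_eq_real_of_nat flip: ennreal_mult) (auto intro: ennreal_leI)
qed

text \<open>Hoelder's inequality for \<open>n\<close> functions with all exponents equal to \<open>n\<close>.  Once every factor is divided by its
\<open>L\<^sup>n\<close> norm, the integrated inequality of arithmetic and geometric means gives the bound \<open>1\<close>.  A factor with
norm \<open>0\<close> vanishes almost everywhere, and a factor with infinite norm makes the right-hand side infinite.\<close>
lemma nn_integral_prod_le: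
  fixes h :: "'i \<Rightarrow> 'a \<Rightarrow> ennreal"
  assumes J: "finite J" "J \<noteq> {}" and [measurable]: "\<And>i. i \<in> J \<Longrightarrow> h i \<in> borel_measurable M"
  shows "(\<integral>\<^sup>+x. (\<Prod>i\<in>J. h i x) \<partial>M) ^ card J \<le> (\<Prod>i\<in>J. \<integral>\<^sup>+x. h i x ^ card J \<partial>M)"
proof -
  let ?n = "card J"
  define A where "A i = (\<integral>\<^sup>+x. h i x ^ ?n \<partial>M)" for i
  have n: "0 < ?n" using J by (simp add: card_gt_0_iff)
  consider i where "i \<in> J" "A i = 0" | i where "i \<in> J" "A i = top" "\<forall>i\<in>J. A i \<noteq> 0"
    | "\<forall>i\<in>J. A i \<noteq> 0 \<and> A i \<noteq> top" by blast
  then show ?thesis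
  proof cases
    case 1
    have "AE x in M. h i x ^ ?n = 0"
      using 1 by (subst (asm) A_def, subst (asm) nn_integral_0_iff_AE) auto
    then have "AE x in M. (\<Prod>i\<in>J. h i x) = 0"
      by eventually_elim (use 1 J in auto)
    then have "(\<integral>\<^sup>+x. (\<Prod>i\<in>J. h i x) \<partial>M) = 0"
      by (subst nn_integral_0_iff_AE) (auto intro!: borel_measurable_prod_ennreal)
    then show ?thesis using n by (simp add: power_0_left)
  next
    case 2
    have "(\<Prod>i\<in>J. A i) = A i * (\<Prod>i\<in>J - {i}. A i)" using 2 J by (simp add: prod.remove)
    also have "\<dots> = top" using 2 J by (simp add: ennreal_top_mult)
    finally show ?thesis by (simp add: A_def)
  next
    case 3
    define a where "a i = ennroot ?n (A i)" for i
    have a: "a i \<noteq> 0" "a i \<noteq> top" "a i ^ ?n = A i" if "i \<in> J" for i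
      using 3 that n ennroot_eq_0D[of ?n "A i"]
      by (auto simp: a_def ennroot_eq_top_iff ennroot_power)
    have "of_nat ?n * (\<integral>\<^sup>+x. (\<Prod>i\<in>J. h i x / a i) \<partial>M) = (\<integral>\<^sup>+x. of_nat ?n * (\<Prod>i\<in>J. h i x / a i) \<partial>M)"
      by (rule nn_integral_cmult[symmetric]) (auto intro!: borel_measurable_prod_ennreal)
    also have "\<dots> \<le> (\<integral>\<^sup>+x. (\<Sum>i\<in>J. (h i x / a i) ^ ?n) \<partial>M)"
      by (intro nn_integral_mono prod_le_sum_powers J)
    also have "\<dots> = (\<Sum>i\<in>J. \<integral>\<^sup>+x. (h i x / a i) ^ ?n \<partial>M)"
      by (rule nn_integral_sum) auto
    also have "\<dots> = (\<Sum>i\<in>J. 1)"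
    proof (rule sum.cong[OF refl])
      fix i assume i: "i \<in> J"
      have "(\<integral>\<^sup>+x. (h i x / a i) ^ ?n \<partial>M) = (\<integral>\<^sup>+x. h i x ^ ?n / A i \<partial>M)"
        using a[OF i] by (intro nn_integral_cong)
          (simp add: divide_ennreal_def power_mult_distrib ennreal_inverse_power flip: a(3)[OF i])
      also have "\<dots> = A i / A i"
        unfolding A_def using i by (intro nn_integral_divide) auto
      also have "\<dots> = 1" using 3 i by (simp add: ennreal_divide_self less_top)
      finally show "(\<integral>\<^sup>+x. (h i x / a i) ^ ?n \<partial>M) = 1" .
    qed
    also have "\<dots> = of_nat ?n * 1" by simp
    finally have *: "(\<integral>\<^sup>+x. (\<Prod>i\<in>J. h i x / a i) \<partial>M) \<le> 1"
      using n ennreal_mult_le_mult_iff[of "of_nat ?n" _ 1] by (auto simp: less_top)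
    have "(\<integral>\<^sup>+x. (\<Prod>i\<in>J. h i x) \<partial>M) = (\<integral>\<^sup>+x. (\<Prod>i\<in>J. a i) * (\<Prod>i\<in>J. h i x / a i) \<partial>M)"
      unfolding prod.distrib[symmetric]
      by (intro nn_integral_cong prod.cong refl)
         (use a in \<open>simp add: ennreal_times_divide mult.commute[of "a _"] ennreal_mult_divide_eq\<close>)
    also have "\<dots> = (\<Prod>i\<in>J. a i) * (\<integral>\<^sup>+x. (\<Prod>i\<in>J. h i x / a i) \<partial>M)"
      by (rule nn_integral_cmult) (auto intro!: borel_measurable_prod_ennreal)
    also have "\<dots> \<le> (\<Prod>i\<in>J. a i) * 1" by (intro mult_left_mono *) auto
    finally have "(\<integral>\<^sup>+x. (\<Prod>i\<in>J. h i x) \<partial>M) ^ ?n \<le> (\<Prod>i\<in>J. a i) ^ ?n"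
      by (intro power_mono) auto
    also have "\<dots> = (\<Prod>i\<in>J. A i)" by (simp add: prod_power_distrib a(3))
    finally show ?thesis by (simp add: A_def)
  qed
qed

text \<open>Gagliardo's argument, in the form that includes the extra factor \<open>f\<close>.  The coordinates are integrated out one
at a time.  In the step for coordinate \<open>k\<close> the function \<open>c k\<close> is constant along the line and leaves the
integral; what remains under it are \<open>f\<close> and the \<open>card K - 1\<close> other functions \<open>c i\<close>, exactly the number
for which Hoelder's inequality applies with exponent \<open>card K\<close>.  Keeping \<open>K\<close> fixed while the induction
runs over \<open>I\<close> keeps this count the same in every step.\<close>
lemma (in product_sigma_finite) gagliardo_product_inequality:
  fixes f :: "('i \<Rightarrow> 'a) \<Rightarrow> ennreal" and c :: "'i \<Rightarrow> ('i \<Rightarrow> 'a) \<Rightarrow> ennreal"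
  assumes K: "finite K" "K \<noteq> {}" and I: "I \<subseteq> K"
    and f: "f \<in> borel_measurable (PiM I M)"
    and c: "\<And>i. i \<in> K \<Longrightarrow> c i \<in> borel_measurable (PiM (I - {i}) M)"
  shows "(\<integral>\<^sup>+x. f x * (\<Prod>i\<in>K. c i (restrict x (I - {i}))) \<partial>PiM I M) ^ card K
    \<le> (\<integral>\<^sup>+x. f x ^ card K \<partial>PiM I M) * (\<Prod>i\<in>K. \<integral>\<^sup>+x. c i x ^ card K \<partial>PiM (I - {i}) M)"
proof -
  have "finite I" using K I finite_subset by blast
  then show ?thesis using I f c
  proof (induction I arbitrary: f c)
    case empty
    then show ?case
      by (simp add: PiM_empty nn_integral_count_space_finite power_mult_distrib prod_power_distrib)
  next
    case (insert k I)
    let ?n = "card K"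
    have n: "0 < ?n" using K by (simp add: card_gt_0_iff)
    have k: "k \<in> K" and IK: "I \<subseteq> K" using insert.prems by auto
    interpret k: sigma_finite_measure "M k" by (rule sigma_finite_measures)
    note [measurable] = insert.prems(2)
    have del_k: "insert k I - {k} = I" using insert.hyps by auto
    have del_i: "insert k I - {i} = insert k (I - {i})" if "i \<noteq> k" for i using that by auto
    have ck [measurable]: "c k \<in> borel_measurable (PiM I M)"
      using insert.prems(3)[OF k] by (simp add: del_k)
    have ci [measurable]: "c i \<in> borel_measurable (PiM (insert k (I - {i})) M)" if "i \<in> K - {k}" for i
      using insert.prems(3)[of i] that by (simp add: del_i)
    \<comment> \<open>The functions of the remaining coordinates to which the induction hypothesis is applied: \<open>L\<^sup>n\<close> norms
      along the line for every factor but \<open>c k\<close>.\<close>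
    define f' where "f' x = ennroot ?n (\<integral>\<^sup>+y. f (x(k := y)) ^ ?n \<partial>M k)" for x
    define c' where "c' i = (if i = k then c k else (\<lambda>x. ennroot ?n (\<integral>\<^sup>+y. c i (x(k := y)) ^ ?n \<partial>M k)))" for i
    have f' [measurable]: "f' \<in> borel_measurable (PiM I M)"
      unfolding f'_def by measurable
    have c' [measurable]: "c' i \<in> borel_measurable (PiM (I - {i}) M)" if "i \<in> K" for i
    proof (cases "i = k")
      case True
      then show ?thesis using ck insert.hyps by (simp add: c'_def)
    next
      case False
      then have [measurable]: "c i \<in> borel_measurable (PiM (insert k (I - {i})) M)"
        using ci that by auto
      show ?thesis using False unfolding c'_def by simp
    qed
    have slice: "(\<integral>\<^sup>+y. f (x(k := y)) * (\<Prod>i\<in>K. c i (restrict (x(k := y)) (insert k I - {i}))) \<partial>M k)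
        \<le> f' x * (\<Prod>i\<in>K. c' i (restrict x (I - {i})))" (is "?L \<le> ?R") if x: "x \<in> space (PiM I M)" for x
    proof -
      \<comment> \<open>\<open>f\<close> takes the place that \<open>c k\<close> leaves free among the factors.\<close>
      define h where "h i y = (if i = k then f (x(k := y)) else c i ((restrict x (I - {i}))(k := y)))" for i y
      have hm [measurable]: "h i \<in> borel_measurable (M k)" if "i \<in> K" for i
      proof (cases "i = k")
        case True
        have "(\<lambda>y. f (x(k := y))) \<in> borel_measurable (M k)"
          using x insert.hyps by measurable
        then show ?thesis using True by (simp add: h_def[abs_def])
      next
        case False
        then have [measurable]: "c i \<in> borel_measurable (PiM (insert k (I - {i})) M)"
          using ci that by auto
        have "restrict x (I - {i}) \<in> space (PiM (I - {i}) M)"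
          using x by (auto simp: space_PiM)
        then have "(\<lambda>y. c i ((restrict x (I - {i}))(k := y))) \<in> borel_measurable (M k)"
          by measurable
        then show ?thesis using False by (simp add: h_def[abs_def])
      qed
      have xI: "restrict x I = x" using x by (auto simp: space_PiM PiE_restrict)
      have eq: "f (x(k := y)) * (\<Prod>i\<in>K. c i (restrict (x(k := y)) (insert k I - {i})))
          = c k x * (\<Prod>i\<in>K. h i y)" for y
      proof -
        have "restrict (x(k := y)) I = x"
          using insert.hyps xI by (auto simp: restrict_upd)
        moreover have "restrict (x(k := y)) (insert k I - {i}) = (restrict x (I - {i}))(k := y)" if "i \<noteq> k" for i
          using that by (auto simp: del_i restrict_def fun_eq_iff)
        ultimately show ?thesis
          using K k by (simp add: prod.remove[of K k] h_def del_k mult_ac)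
      qed
      have "?L = c k x * (\<integral>\<^sup>+y. (\<Prod>i\<in>K. h i y) \<partial>M k)"
        unfolding eq by (intro nn_integral_cmult borel_measurable_prod_ennreal hm)
      also have "(\<integral>\<^sup>+y. (\<Prod>i\<in>K. h i y) \<partial>M k) \<le> (\<Prod>i\<in>K. ennroot ?n (\<integral>\<^sup>+y. h i y ^ ?n \<partial>M k))"
      proof (rule power_le_imp_le_ennreal[OF _ n])
        show "(\<integral>\<^sup>+y. (\<Prod>i\<in>K. h i y) \<partial>M k) ^ ?n \<le> (\<Prod>i\<in>K. ennroot ?n (\<integral>\<^sup>+y. h i y ^ ?n \<partial>M k)) ^ ?n"
          using nn_integral_prod_le[OF K hm] n by (simp add: prod_power_distrib ennroot_power)
      qed
      also have "c k x * (\<Prod>i\<in>K. ennroot ?n (\<integral>\<^sup>+y. h i y ^ ?n \<partial>M k)) = ?R"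
        using K k insert.hyps by (simp add: prod.remove[of K k] h_def f'_def c'_def xI mult_ac)
      finally show ?thesis by (simp add: mult_left_mono)
    qed
    have "(\<integral>\<^sup>+x. f x * (\<Prod>i\<in>K. c i (restrict x (insert k I - {i}))) \<partial>PiM (insert k I) M)
        = (\<integral>\<^sup>+x. \<integral>\<^sup>+y. f (x(k := y)) * (\<Prod>i\<in>K. c i (restrict (x(k := y)) (insert k I - {i}))) \<partial>M k \<partial>PiM I M)"
    proof (rule product_nn_integral_insert[OF insert.hyps])
      have "(\<lambda>x. c i (restrict x (insert k I - {i}))) \<in> borel_measurable (PiM (insert k I) M)" if "i \<in> K" for i
        by (rule measurable_compose[OF measurable_restrict_subset insert.prems(3)[OF that]]) auto
      then show "(\<lambda>x. f x * (\<Prod>i\<in>K. c i (restrict x (insert k I - {i})))) \<in> borel_measurable (PiM (insert k I) M)"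
        by (intro borel_measurable_times_ennreal borel_measurable_prod_ennreal insert.prems(2))
    qed
    also have "\<dots> \<le> (\<integral>\<^sup>+x. f' x * (\<Prod>i\<in>K. c' i (restrict x (I - {i}))) \<partial>PiM I M)"
      by (intro nn_integral_mono slice)
    finally have "(\<integral>\<^sup>+x. f x * (\<Prod>i\<in>K. c i (restrict x (insert k I - {i}))) \<partial>PiM (insert k I) M) ^ ?n
        \<le> (\<integral>\<^sup>+x. f' x * (\<Prod>i\<in>K. c' i (restrict x (I - {i}))) \<partial>PiM I M) ^ ?n"
      by (intro power_mono) auto
    also have "\<dots> \<le> (\<integral>\<^sup>+x. f' x ^ ?n \<partial>PiM I M) * (\<Prod>i\<in>K. \<integral>\<^sup>+x. c' i x ^ ?n \<partial>PiM (I - {i}) M)"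
      by (rule insert.IH[OF IK f' c'])
    also have "(\<integral>\<^sup>+x. f' x ^ ?n \<partial>PiM I M) = (\<integral>\<^sup>+x. f x ^ ?n \<partial>PiM (insert k I) M)"
      using n insert.hyps by (simp add: f'_def ennroot_power product_nn_integral_insert)
    also have "(\<Prod>i\<in>K. \<integral>\<^sup>+x. c' i x ^ ?n \<partial>PiM (I - {i}) M)
        = (\<Prod>i\<in>K. \<integral>\<^sup>+x. c i x ^ ?n \<partial>PiM (insert k I - {i}) M)"
    proof (rule prod.cong[OF refl])
      fix i assume i: "i \<in> K"
      show "(\<integral>\<^sup>+x. c' i x ^ ?n \<partial>PiM (I - {i}) M) = (\<integral>\<^sup>+x. c i x ^ ?n \<partial>PiM (insert k I - {i}) M)"
      proof (cases "i = k")
        case True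
        then show ?thesis using insert.hyps by (simp add: c'_def del_k)
      next
        case False
        then have [measurable]: "c i \<in> borel_measurable (PiM (insert k (I - {i})) M)"
          using ci i by auto
        show ?thesis using False n insert.hyps
          by (simp add: c'_def ennroot_power del_i product_nn_integral_insert)
      qed
    qed
    finally show ?case .
  qed
qed

section \<open>Smooth mollifiers\<close>

lemma integrable_compact_support:
  fixes f :: "'a::euclidean_space \<Rightarrow> real"
  assumes "compact S" "continuous_on UNIV f" "\<And>x. x \<notin> S \<Longrightarrow> f x = 0"
  shows "integrable lborel f"
proof -
  have "integrable lborel (\<lambda>x. indicator S x *\<^sub>R f x)"
    using assms by (intro borel_integrable_compact) (auto intro: continuous_on_subset)
  moreover have "(\<lambda>x. indicator S x *\<^sub>R f x) = f"
    using assms(3) by (auto simp: indicator_def fun_eq_iff)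
  ultimately show ?thesis by simp
qed

lemma partial_deriv_eq_0_outside:
  fixes f :: "real^'n::finite \<Rightarrow> real"
  assumes "closed S" "\<And>x. x \<notin> S \<Longrightarrow> f x = 0" "x \<notin> S"
  shows "partial_deriv i f x = 0"
proof -
  have "((\<lambda>_. 0) has_derivative (\<lambda>_. 0)) (at x)" by simp
  then have "(f has_derivative (\<lambda>_. 0)) (at x)"
    by (rule has_derivative_transform_within_open[where s = "- S"]) (use assms in auto)
  then show ?thesis unfolding partial_deriv_def using frechet_derivative_at by metis
qed

lemma test_function_differentiable:
  "\<phi> \<in> test_functions \<Longrightarrow> \<phi> differentiable (at x)"
  unfolding test_functions_def smooth_fun_def by (auto dest: spec[of _ "[]"])

lemma test_function_support:
  assumes "\<phi> \<in> test_functions"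
  obtains S where "compact S" "\<And>x. x \<notin> S \<Longrightarrow> \<phi> x = 0"
  using assms closure_subset[of "{x. \<phi> x \<noteq> 0}"] unfolding test_functions_def by blast

lemma test_function_integrable_lborel:
  assumes "\<phi> \<in> test_functions"
  shows "integrable lborel \<phi>" "integrable lborel (partial_deriv i \<phi>)"
proof -
  obtain S where S: "compact S" "\<And>x. x \<notin> S \<Longrightarrow> \<phi> x = 0"
    using test_function_support[OF assms] by blast
  show "integrable lborel \<phi>"
    by (rule integrable_compact_support[OF S(1) test_function_props(1)[OF assms] S(2)])
  show "integrable lborel (partial_deriv i \<phi>)"
    by (rule integrable_compact_support[OF S(1) test_function_props(2)[OF assms]])
       (rule partial_deriv_eq_0_outside[OF compact_imp_closed[OF S(1)] S(2)])
qed

lemma test_function_cmult: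
  assumes "\<phi> \<in> flat_algebra" "\<phi> \<in> test_functions"
  shows "(\<lambda>x. c * \<phi> x) \<in> test_functions"
proof -
  obtain S where S: "compact S" "\<And>x. x \<notin> S \<Longrightarrow> \<phi> x = 0"
    using test_function_support[OF assms(2)] by blast
  have "closure {x. c * \<phi> x \<noteq> 0} \<subseteq> S"
    using S by (intro closure_minimal compact_imp_closed) auto
  then have "compact (closure {x. c * \<phi> x \<noteq> 0})"
    using S(1) by (metis closed_closure compact_imp_bounded bounded_subset compact_eq_bounded_closed)
  moreover have "(\<lambda>x. c * \<phi> x) \<in> flat_algebra"
    by (intro flat_algebra.mult flat_algebra.const assms)
  ultimately show ?thesis by (simp add: test_functions_def flat_algebra_smooth)
qed

lemma bump_flat_algebra: "bump a b k \<in> flat_algebra"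
  unfolding bump_def[abs_def] by (intro flat_algebra_prod flat_algebra.intros finite)

lemma bump_nonneg: "0 \<le> bump a b k x"
  unfolding bump_def by (intro prod_nonneg) (auto simp: flat_1_le)

lemma bump_pos_iff: "bump a b 1 x > 0 \<longleftrightarrow> x \<in> box a b"
proof -
  have "0 < flat 1 t \<longleftrightarrow> 0 < t" for t :: real by (simp add: flat_def)
  moreover have "0 < flat 1 s * flat 1 t \<longleftrightarrow> 0 < flat 1 s \<and> 0 < flat 1 t" for s t
    using flat_1_le(1)[of s] flat_1_le(1)[of t] by (auto simp: zero_less_mult_iff less_le)
  ultimately have *: "0 < flat 1 (x $ j - a $ j) * flat 1 (b $ j - x $ j) \<longleftrightarrow> a $ j < x $ j \<and> x $ j < b $ j" for j
    by simp
  have eq: "bump a b 1 x = (\<Prod>j\<in>UNIV. flat 1 (x $ j - a $ j) * flat 1 (b $ j - x $ j))"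
    by (simp add: bump_def)
  show ?thesis
  proof
    assume pos: "bump a b 1 x > 0"
    have "flat 1 (x $ j - a $ j) * flat 1 (b $ j - x $ j) \<noteq> 0" for j
    proof
      assume "flat 1 (x $ j - a $ j) * flat 1 (b $ j - x $ j) = 0"
      then have "bump a b 1 x = 0" unfolding eq by (intro prod_zero) auto
      then show False using pos by simp
    qed
    moreover have "0 \<le> flat 1 (x $ j - a $ j) * flat 1 (b $ j - x $ j)" for j
      by (intro mult_nonneg_nonneg flat_1_le)
    ultimately have "0 < flat 1 (x $ j - a $ j) * flat 1 (b $ j - x $ j)" for j
      by (simp add: less_le)
    then show "x \<in> box a b" unfolding * by (auto simp: mem_box_cart)
  next
    assume "x \<in> box a b"
    then show "bump a b 1 x > 0"
      unfolding eq by (intro prod_pos) (simp add: * mem_box_cart)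
  qed
qed

text \<open>The support of the mollifiers is a cube and not a ball, because products of one-dimensional functions
are supported in boxes.\<close>
definition cube_radius :: "nat \<Rightarrow> real^'n::finite"
  where "cube_radius k = (\<chi> j. 1 / (real k + 1))"

definition mollifier :: "nat \<Rightarrow> real^'n::finite \<Rightarrow> real"
  where "mollifier k x = bump (- cube_radius k) (cube_radius k) 1 x
           / (LINT z|lborel. bump (- cube_radius k) (cube_radius k :: real^'n) 1 z)"

lemma bump_integral_pos:
  "0 < (LINT z|lborel. bump (- cube_radius k) (cube_radius k :: real^'n::finite) 1 z)"
proof -
  let ?b = "bump (- cube_radius k) (cube_radius k :: real^'n) 1"
  have int: "integrable lborel ?b" by (rule test_function_integrable_lborel[OF bump_test])
  have "0 \<le> (LINT z|lborel. ?b z)" by (simp add: bump_nonneg)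
  moreover have "(LINT z|lborel. ?b z) \<noteq> 0"
  proof
    assume "(LINT z|lborel. ?b z) = 0"
    then have "AE z in lborel. ?b z = 0"
      using int by (simp add: integral_nonneg_eq_0_iff_AE bump_nonneg)
    then have "AE z in lborel. z \<notin> box (- cube_radius k) (cube_radius k :: real^'n)"
      by eventually_elim (use bump_pos_iff in force)
    then have "box (- cube_radius k) (cube_radius k :: real^'n) \<in> null_sets lborel"
      by (simp add: AE_iff_null_sets)
    then have "negligible (box (- cube_radius k) (cube_radius k :: real^'n))"
      by (simp add: negligible_iff_null_sets null_sets_completionI)
    moreover have "0 \<in> box (- cube_radius k) (cube_radius k :: real^'n)"
      by (auto simp: mem_box_cart cube_radius_def)
    ultimately show False using open_not_negligible[OF open_box] by blast
  qed
  ultimately show ?thesis by simp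
qed

lemma mollifier_nonneg: "0 \<le> mollifier k x"
  unfolding mollifier_def by (intro divide_nonneg_pos bump_nonneg bump_integral_pos)

lemma mollifier_eq_0:
  assumes "x \<notin> box (- cube_radius k) (cube_radius k)"
  shows "mollifier k x = 0"
proof -
  have "\<not> 0 < bump (- cube_radius k) (cube_radius k) 1 x"
    unfolding bump_pos_iff by (rule assms)
  then have "bump (- cube_radius k) (cube_radius k) 1 x = 0"
    using bump_nonneg by (metis less_eq_real_def)
  then show ?thesis by (simp only: mollifier_def div_0)
qed

text \<open>This identity makes \<open>y \<mapsto> mollifier k (x - y)\<close> a multiple of another bump, and therefore a test function.\<close>
lemma bump_reflect: "bump a b k (x - y) = bump (x - b) (x - a) k y"
  unfolding bump_def
proof (rule prod.cong[OF refl])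
  fix j
  have 1: "real k * ((x - y) $ j) + - (real k * (a $ j)) = - real k * (y $ j) + real k * ((x - a) $ j)"
    by (simp add: right_diff_distrib)
  have 2: "- real k * ((x - y) $ j) + real k * (b $ j) = real k * (y $ j) + - (real k * ((x - b) $ j))"
    by (simp add: right_diff_distrib)
  show "flat 1 (real k * ((x - y) $ j) + - (real k * (a $ j))) * flat 1 (- real k * ((x - y) $ j) + real k * (b $ j))
      = flat 1 (real k * (y $ j) + - (real k * ((x - b) $ j))) * flat 1 (- real k * (y $ j) + real k * ((x - a) $ j))"
    unfolding 1 2 by (rule mult.commute)
qed

lemma bump_cmult_test: "(\<lambda>x. bump a b k x / c) \<in> test_functions"
proof -
  have "(\<lambda>x. inverse c * bump a b k x) \<in> test_functions"
    by (intro test_function_cmult bump_flat_algebra bump_test)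
  then show ?thesis unfolding divide_inverse_commute .
qed

lemma mollifier_reflect_test: "(\<lambda>y. mollifier k (x - y)) \<in> test_functions"
  unfolding mollifier_def bump_reflect by (rule bump_cmult_test)

lemma mollifier_test: "mollifier k \<in> test_functions"
  unfolding mollifier_def[abs_def] by (rule bump_cmult_test)

lemma integral_mollifier: "(LINT x|lborel. mollifier k (x :: real^'n::finite)) = 1"
proof -
  have "(LINT z|lborel. bump (- cube_radius k) (cube_radius k :: real^'n) 1 z) \<noteq> 0"
    using bump_integral_pos[of k, where 'n='n] by linarith
  then show ?thesis by (simp only: mollifier_def integral_divide_zero divide_self_if if_False)
qed

lemma partial_deriv_reflect:
  assumes "f differentiable (at (x - y))"
  shows "partial_deriv i (\<lambda>y. f (x - y)) y = - partial_deriv i f (x - y)"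
proof -
  let ?D = "frechet_derivative f (at (x - y))"
  have D: "(f has_derivative ?D) (at (x - y))"
    using assms by (simp add: frechet_derivative_works)
  have "((\<lambda>y. x - y) has_derivative (\<lambda>h. - h)) (at y)"
    by (auto intro!: derivative_eq_intros)
  from has_derivative_compose[OF this D]
  have "frechet_derivative (\<lambda>y. f (x - y)) (at y) = (\<lambda>h. ?D (- h))"
    using frechet_derivative_at by metis
  moreover have "linear ?D" using D by (rule has_derivative_linear)
  ultimately show ?thesis by (simp add: partial_deriv_def linear_neg)
qed

lemma partial_mollifier_eq_0:
  "x \<notin> cbox (- cube_radius k) (cube_radius k) \<Longrightarrow> partial_deriv i (mollifier k) x = 0"
  by (rule partial_deriv_eq_0_outside[OF closed_cbox])
     (use mollifier_eq_0 box_subset_cbox in blast)+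

lemma line_has_derivative:
  fixes f :: "real^'n::finite \<Rightarrow> real"
  assumes "\<And>x. f differentiable (at x)"
  shows "((\<lambda>s. f (z + s *\<^sub>R axis i 1)) has_real_derivative partial_deriv i f (z + s *\<^sub>R axis i 1)) (at s)"
proof -
  let ?D = "frechet_derivative f (at (z + s *\<^sub>R axis i 1))"
  have D: "(f has_derivative ?D) (at (z + s *\<^sub>R axis i 1))"
    using assms by (simp add: frechet_derivative_works)
  have "((\<lambda>s. z + s *\<^sub>R axis i 1) has_derivative (\<lambda>h. h *\<^sub>R axis i 1)) (at s)"
    by (auto intro!: derivative_eq_intros)
  from has_derivative_compose[OF this D]
  have "((\<lambda>s. f (z + s *\<^sub>R axis i 1)) has_derivative (\<lambda>h. ?D (h *\<^sub>R axis i 1))) (at s)" .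
  moreover have "?D (h *\<^sub>R axis i 1) = ?D (axis i 1) * h" for h
    using has_derivative_linear[OF D] by (simp add: linear_scale)
  ultimately show ?thesis
    by (simp add: has_field_derivative_def partial_deriv_def[abs_def])
qed

lemma line_integral_partial:
  fixes f :: "real^'n::finite \<Rightarrow> real"
  assumes "\<And>x. f differentiable (at x)" "continuous_on UNIV (partial_deriv i f)" "0 \<le> R"
  shows "(LINT s:{0..R}|lborel. partial_deriv i f (z + s *\<^sub>R axis i 1)) = f (z + R *\<^sub>R axis i 1) - f z"
proof -
  have "(LINT s|lborel. partial_deriv i f (z + s *\<^sub>R axis i 1) * indicator {0..R} s)
      = f (z + R *\<^sub>R axis i 1) - f (z + 0 *\<^sub>R axis i 1)"
  proof (rule integral_FTC_Icc_real[OF assms(3)])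
    show "((\<lambda>s. f (z + s *\<^sub>R axis i 1)) has_real_derivative partial_deriv i f (z + s *\<^sub>R axis i 1)) (at s)" for s
      by (rule line_has_derivative[OF assms(1)])
    show "isCont (\<lambda>s. partial_deriv i f (z + s *\<^sub>R axis i 1)) s" for s
      by (rule continuous_at_compose[unfolded o_def])
         (use assms(2) in \<open>auto intro!: continuous_intros simp: continuous_on_eq_continuous_at\<close>)
  qed
  then show ?thesis by (simp add: set_lebesgue_integral_def mult.commute)
qed

section \<open>Convolutions and integration by parts\<close>

lemma distr_lborel_shift: "distr lborel borel (\<lambda>x. x - y) = (lborel :: 'a::euclidean_space measure)"
proof -
  have "(\<lambda>x. x - y) = (+) (- y)" by auto
  then show ?thesis using lborel_distr_plus[of "- y"] by simp
qed

lemma nn_integral_lborel_shift: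
  fixes f :: "'a::euclidean_space \<Rightarrow> ennreal"
  assumes [measurable]: "f \<in> borel_measurable borel"
  shows "(\<integral>\<^sup>+x. f (x - y) \<partial>lborel) = (\<integral>\<^sup>+x. f x \<partial>lborel)"
proof -
  have "(\<integral>\<^sup>+x. f x \<partial>lborel) = (\<integral>\<^sup>+x. f x \<partial>distr lborel borel (\<lambda>x. x - y))"
    by (simp only: distr_lborel_shift)
  also have "\<dots> = (\<integral>\<^sup>+x. f (x - y) \<partial>lborel)" by (rule nn_integral_distr) auto
  finally show ?thesis by (rule sym)
qed

lemma lborel_integral_shift:
  fixes f :: "'a::euclidean_space \<Rightarrow> real"
  assumes [measurable]: "f \<in> borel_measurable borel"
  shows "(LINT x|lborel. f (x - y)) = (LINT x|lborel. f x)"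
proof -
  have "(LINT x|lborel. f x) = (LINT x|distr lborel borel (\<lambda>x. x - y). f x)"
    by (simp only: distr_lborel_shift)
  also have "\<dots> = (LINT x|lborel. f (x - y))" by (rule integral_distr) auto
  finally show ?thesis by (rule sym)
qed

lemma integrable_lborel_shift:
  fixes f :: "'a::euclidean_space \<Rightarrow> real"
  assumes "integrable lborel f"
  shows "integrable lborel (\<lambda>x. f (x - y))"
proof -
  have "integrable (distr lborel borel (\<lambda>x. x - y)) f"
    using assms by (simp only: distr_lborel_shift)
  then show ?thesis by (subst (asm) integrable_distr_eq) (use assms in auto)
qed

text \<open>Functions are smoothed with \<open>Q\<close> Lebesgue measure, the parts of a gradient measure with \<open>Q\<close> the part itself
and \<open>u = 1\<close>.\<close>
lemma integrable_convolution_pair: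
  fixes Q :: "('a::euclidean_space) measure" and u g :: "'a \<Rightarrow> real"
  assumes Q: "sigma_finite_measure Q" and sets_Q [measurable_cong]: "sets Q = sets borel"
    and u: "integrable Q u" and g: "integrable lborel g"
  shows "integrable (lborel \<Otimes>\<^sub>M Q) (\<lambda>(x, y). u y * g (x - y))"
proof (rule integrableI_bounded)
  interpret Q: sigma_finite_measure Q by fact
  interpret pair_sigma_finite lborel Q ..
  have [measurable]: "u \<in> borel_measurable Q" "g \<in> borel_measurable borel" using u g by auto
  then have [measurable]: "u \<in> borel_measurable borel" by (simp cong: measurable_cong_sets add: sets_Q)
  show "(\<lambda>(x, y). u y * g (x - y)) \<in> borel_measurable (lborel \<Otimes>\<^sub>M Q)" by measurable
  have "(\<integral>\<^sup>+z. ennreal (norm (case z of (x, y) \<Rightarrow> u y * g (x - y))) \<partial>(lborel \<Otimes>\<^sub>M Q))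
      = (\<integral>\<^sup>+y. \<integral>\<^sup>+x. ennreal \<bar>u y\<bar> * ennreal \<bar>g (x - y)\<bar> \<partial>lborel \<partial>Q)"
    by (subst nn_integral_snd[symmetric]) (auto simp: case_prod_unfold abs_mult ennreal_mult)
  also have "\<dots> = (\<integral>\<^sup>+y. ennreal \<bar>u y\<bar> * (\<integral>\<^sup>+x. ennreal \<bar>g x\<bar> \<partial>lborel) \<partial>Q)"
    by (subst nn_integral_cmult) (auto simp: nn_integral_lborel_shift[of "\<lambda>x. ennreal \<bar>g x\<bar>"])
  also have "\<dots> = (\<integral>\<^sup>+y. ennreal \<bar>u y\<bar> \<partial>Q) * (\<integral>\<^sup>+x. ennreal \<bar>g x\<bar> \<partial>lborel)"
    by (rule nn_integral_multc) auto
  also have "\<dots> < \<infinity>"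
    using u g by (auto simp: integrable_iff_bounded ennreal_mult_less_top)
  finally show "(\<integral>\<^sup>+z. ennreal (norm (case z of (x, y) \<Rightarrow> u y * g (x - y))) \<partial>(lborel \<Otimes>\<^sub>M Q)) < \<infinity>" .
qed

lemma convolution_swap:
  fixes Q :: "('a::euclidean_space) measure" and u g s :: "'a \<Rightarrow> real"
  assumes Q: "sigma_finite_measure Q" and sets_Q [measurable_cong]: "sets Q = sets borel"
    and u: "integrable Q u" and g: "integrable lborel g"
    and s [measurable]: "s \<in> borel_measurable borel" and B: "\<And>x. \<bar>s x\<bar> \<le> B"
  shows "integrable lborel (\<lambda>x. s x * (LINT y|Q. u y * g (x - y)))"
    and "integrable Q (\<lambda>y. u y * (LINT x|lborel. s x * g (x - y)))"
    and "(LINT x|lborel. s x * (LINT y|Q. u y * g (x - y))) = (LINT y|Q. u y * (LINT x|lborel. s x * g (x - y)))"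
proof -
  interpret Q: sigma_finite_measure Q by fact
  interpret P: pair_sigma_finite lborel Q ..
  have [measurable]: "u \<in> borel_measurable Q" "g \<in> borel_measurable borel" using u g by auto
  then have [measurable]: "u \<in> borel_measurable borel" by (simp cong: measurable_cong_sets add: sets_Q)
  have "integrable (lborel \<Otimes>\<^sub>M Q) (\<lambda>z. B * (case z of (x, y) \<Rightarrow> u y * g (x - y)))"
    by (intro integrable_mult_right integrable_convolution_pair assms)
  then have int: "integrable (lborel \<Otimes>\<^sub>M Q) (\<lambda>(x, y). s x * (u y * g (x - y)))"
  proof (rule Bochner_Integration.integrable_bound)
    show "(\<lambda>(x, y). s x * (u y * g (x - y))) \<in> borel_measurable (lborel \<Otimes>\<^sub>M Q)" by measurable
    have "\<bar>s x\<bar> * a \<le> \<bar>B\<bar> * a" if "0 \<le> a" for x a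
      using B[of x] that by (intro mult_right_mono) auto
    then show "AE z in lborel \<Otimes>\<^sub>M Q. norm (case z of (x, y) \<Rightarrow> s x * (u y * g (x - y)))
        \<le> norm (B * (case z of (x, y) \<Rightarrow> u y * g (x - y)))"
      by (intro AE_I2) (auto simp: abs_mult)
  qed
  show "integrable lborel (\<lambda>x. s x * (LINT y|Q. u y * g (x - y)))"
    using P.integrable_fst'[OF int] by simp
  have *: "(LINT x|lborel. s x * (u y * g (x - y))) = u y * (LINT x|lborel. s x * g (x - y))" for y
    by (subst integral_mult_right_zero[symmetric]) (simp add: mult_ac)
  show "integrable Q (\<lambda>y. u y * (LINT x|lborel. s x * g (x - y)))"
    using P.integrable_snd[of "\<lambda>x y. s x * (u y * g (x - y))"] int by (simp add: *)
  show "(LINT x|lborel. s x * (LINT y|Q. u y * g (x - y))) = (LINT y|Q. u y * (LINT x|lborel. s x * g (x - y)))"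
    using P.Fubini_integral[of "\<lambda>x y. s x * (u y * g (x - y))"] int by (simp add: *)
qed

text \<open>By translation invariance \<open>F (x + e) - F x\<close> has integral \<open>0\<close>; by the fundamental theorem of calculus along
lines and Fubini's theorem the same integral equals that of the partial derivative.\<close>
lemma integral_partial_deriv_eq_0:
  fixes F :: "real^'n::finite \<Rightarrow> real"
  assumes F: "\<And>x. F differentiable (at x)" and D: "continuous_on UNIV (partial_deriv i F)"
    and S: "compact S" "\<And>x. x \<notin> S \<Longrightarrow> F x = 0"
  shows "(LINT x|lborel. partial_deriv i F x) = 0"
proof -
  let ?e = "axis i 1 :: real^'n" and ?D = "partial_deriv i F"
  have contF: "continuous_on UNIV F"
    using F by (auto intro!: continuous_at_imp_continuous_on differentiable_imp_continuous_within)
  have intF: "integrable lborel F" by (rule integrable_compact_support[OF S(1) contF S(2)])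
  have intD: "integrable lborel ?D"
    by (rule integrable_compact_support[OF S(1) D partial_deriv_eq_0_outside[OF compact_imp_closed[OF S(1)] S(2)]])
  have [measurable]: "?D \<in> borel_measurable borel" "F \<in> borel_measurable borel" using intD intF by auto
  have int: "integrable (lborel \<Otimes>\<^sub>M lborel) (\<lambda>(x, s). indicator {0..1::real} s * ?D (x + s *\<^sub>R ?e))"
  proof (rule integrableI_bounded)
    have "(\<integral>\<^sup>+z. ennreal (norm (case z of (x, s) \<Rightarrow> indicator {0..1::real} s * ?D (x + s *\<^sub>R ?e))) \<partial>(lborel \<Otimes>\<^sub>M lborel))
        = (\<integral>\<^sup>+s. \<integral>\<^sup>+x. indicator {0..1::real} s * ennreal \<bar>?D (x - - (s *\<^sub>R ?e))\<bar> \<partial>lborel \<partial>lborel)"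
      by (subst lborel_pair.nn_integral_snd[symmetric])
         (auto simp: case_prod_unfold abs_mult ennreal_mult indicator_def intro!: nn_integral_cong)
    also have "\<dots> = (\<integral>\<^sup>+s. indicator {0..1::real} s * (\<integral>\<^sup>+x. ennreal \<bar>?D x\<bar> \<partial>lborel) \<partial>lborel)"
      by (subst nn_integral_cmult, measurable, subst nn_integral_lborel_shift[of "\<lambda>x. ennreal \<bar>?D x\<bar>"], auto)
    also have "\<dots> = (\<integral>\<^sup>+x. ennreal \<bar>?D x\<bar> \<partial>lborel)"
      by (subst nn_integral_multc) auto
    also have "\<dots> < \<infinity>" using intD by (simp add: integrable_iff_bounded)
    finally show "(\<integral>\<^sup>+z. ennreal (norm (case z of (x, s) \<Rightarrow> indicator {0..1::real} s * ?D (x + s *\<^sub>R ?e))) \<partial>(lborel \<Otimes>\<^sub>M lborel)) < \<infinity>" .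
  qed measurable
  have "(LINT s|lborel. LINT x|lborel. indicator {0..1::real} s * ?D (x + s *\<^sub>R ?e))
      = (LINT s|lborel. indicator {0..1::real} s * (LINT x|lborel. ?D x))"
  proof -
    have "(LINT x|lborel. ?D (x + s *\<^sub>R ?e)) = (LINT x|lborel. ?D x)" for s
      using lborel_integral_shift[of ?D "- (s *\<^sub>R ?e)"] by simp
    then show ?thesis by simp
  qed
  then have "(LINT x|lborel. ?D x) = (LINT s|lborel. LINT x|lborel. indicator {0..1::real} s * ?D (x + s *\<^sub>R ?e))"
    by simp
  also have "\<dots> = (LINT x|lborel. LINT s|lborel. indicator {0..1::real} s * ?D (x + s *\<^sub>R ?e))"
    using lborel_pair.Fubini_integral[OF int] by simp
  also have "\<dots> = (LINT x|lborel. F (x - - ?e) - F x)"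
    using line_integral_partial[OF F D, of 1] by (simp add: set_lebesgue_integral_def)
  also have "\<dots> = (LINT x|lborel. F (x - - ?e)) - (LINT x|lborel. F x)"
    by (intro Bochner_Integration.integral_diff integrable_lborel_shift intF)
  also have "\<dots> = 0" by (simp only: lborel_integral_shift[of F] \<open>F \<in> borel_measurable borel\<close> diff_self)
  finally show ?thesis .
qed

lemma integral_by_parts_mollifier:
  fixes \<phi> :: "real^'n::finite \<Rightarrow> real"
  assumes \<phi>: "\<phi> \<in> test_functions"
  shows "(LINT x|lborel. \<phi> x * partial_deriv i (mollifier k) (x - y))
       = - (LINT x|lborel. partial_deriv i \<phi> x * mollifier k (x - y))"
proof -
  let ?m = "mollifier k :: real^'n \<Rightarrow> real"
  let ?F = "\<lambda>x. \<phi> x * ?m (x - y)"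
  have m: "?m \<in> test_functions" by (rule mollifier_test)
  have deriv: "(?F has_derivative (\<lambda>h. \<phi> x * frechet_derivative ?m (at (x - y)) h
      + frechet_derivative \<phi> (at x) h * ?m (x - y))) (at x)" for x
  proof -
    have 1: "(\<phi> has_derivative frechet_derivative \<phi> (at x)) (at x)"
      using test_function_differentiable[OF \<phi>] by (simp add: frechet_derivative_works)
    have 2: "(?m has_derivative frechet_derivative ?m (at (x - y))) (at (x - y))"
      using test_function_differentiable[OF m] by (simp add: frechet_derivative_works)
    have "((\<lambda>x. x - y) has_derivative (\<lambda>h. h)) (at x)" by (auto intro!: derivative_eq_intros)
    from has_derivative_compose[OF this 2]
    have "((\<lambda>x. ?m (x - y)) has_derivative frechet_derivative ?m (at (x - y))) (at x)" by simp
    from has_derivative_mult[OF 1 this] show ?thesis .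
  qed
  have D: "partial_deriv i ?F = (\<lambda>x. \<phi> x * partial_deriv i ?m (x - y) + partial_deriv i \<phi> x * ?m (x - y))"
    unfolding partial_deriv_def using frechet_derivative_at[OF deriv, symmetric] by simp
  have cm: "continuous_on UNIV (\<lambda>x. ?m (x - y))" "continuous_on UNIV (\<lambda>x. partial_deriv i ?m (x - y))"
    using test_function_props(1,2)[OF m]
    by (auto intro!: continuous_on_compose2[of UNIV _ UNIV "\<lambda>x. x - y"] continuous_intros)
  obtain S where S: "compact S" "\<And>x. x \<notin> S \<Longrightarrow> \<phi> x = 0" using test_function_support[OF \<phi>] by blast
  have S': "partial_deriv i \<phi> x = 0" if "x \<notin> S" for x
    by (rule partial_deriv_eq_0_outside[OF compact_imp_closed[OF S(1)] S(2) that])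
  have "(LINT x|lborel. partial_deriv i ?F x) = 0"
  proof (rule integral_partial_deriv_eq_0[OF _ _ S(1)])
    show "?F differentiable (at x)" for x using deriv by (rule differentiableI)
    show "continuous_on UNIV (partial_deriv i ?F)"
      unfolding D by (intro continuous_intros cm test_function_props[OF \<phi>])
  qed (simp add: S)
  moreover have "integrable lborel (\<lambda>x. \<phi> x * partial_deriv i ?m (x - y))"
    by (rule integrable_compact_support[OF S(1)])
       (auto intro!: continuous_intros cm test_function_props[OF \<phi>] simp: S)
  moreover have "integrable lborel (\<lambda>x. partial_deriv i \<phi> x * ?m (x - y))"
    by (rule integrable_compact_support[OF S(1)])
       (auto intro!: continuous_intros cm test_function_props[OF \<phi>] simp: S')
  ultimately show ?thesis by (simp add: D)
qed

lemma cube_radius_tendsto: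
  fixes y :: "real^'n::finite"
  assumes "0 < d"
  shows "\<forall>\<^sub>F k in sequentially. \<forall>x. x - y \<in> box (- cube_radius k) (cube_radius k) \<longrightarrow> dist x y < d"
proof -
  have "(\<lambda>k. real CARD('n) * (1 / (real k + 1))) \<longlonglongrightarrow> real CARD('n) * 0"
    using LIMSEQ_inverse_real_of_nat by (intro tendsto_mult tendsto_const) (simp add: field_simps)
  then have "\<forall>\<^sub>F k in sequentially. real CARD('n) * (1 / (real k + 1)) < d"
    using assms by (intro order_tendstoD(2)) auto
  then show ?thesis
  proof eventually_elim
    case (elim k)
    show ?case
    proof (intro allI impI)
      fix x :: "real^'n" assume x: "x - y \<in> box (- cube_radius k) (cube_radius k)"
      have "dist x y \<le> (\<Sum>j\<in>UNIV. \<bar>(x - y) $ j\<bar>)"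
        unfolding dist_norm by (rule norm_le_l1_cart)
      also have "\<dots> \<le> (\<Sum>j\<in>(UNIV::'n set). 1 / (real k + 1))"
      proof (rule sum_mono)
        fix j
        have "(- cube_radius k) $ j < (x - y) $ j" "(x - y) $ j < cube_radius k $ j"
          using x unfolding mem_box_cart by blast+
        then show "\<bar>(x - y) $ j\<bar> \<le> 1 / (real k + 1)"
          by (simp add: cube_radius_def abs_le_iff)
      qed
      also have "\<dots> < d" using elim by simp
      finally show "dist x y < d" .
    qed
  qed
qed

lemma mollifier_approx_identity:
  fixes f :: "real^'n::finite \<Rightarrow> real"
  assumes [measurable]: "f \<in> borel_measurable borel" and B: "\<And>x. \<bar>f x\<bar> \<le> B" and f: "isCont f y"
  shows "(\<lambda>k. LINT x|lborel. f x * mollifier k (x - y)) \<longlonglongrightarrow> f y"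
proof (rule tendstoI)
  fix e :: real assume e: "0 < e"
  obtain d where d: "0 < d" "\<And>x. dist x y < d \<Longrightarrow> \<bar>f x - f y\<bar> \<le> e / 2"
  proof -
    have "0 < e / 2" using e by simp
    with f obtain d where "0 < d" "\<And>x. dist x y < d \<Longrightarrow> dist (f x) (f y) < e / 2"
      unfolding continuous_at_eps_delta by blast
    then show ?thesis using that by (metis dist_real_def less_imp_le)
  qed
  show "\<forall>\<^sub>F k in sequentially. dist (LINT x|lborel. f x * mollifier k (x - y)) (f y) < e"
    using cube_radius_tendsto[OF d(1), of y]
  proof eventually_elim
    case (elim k)
    have [measurable]: "mollifier k \<in> borel_measurable (borel :: (real^'n) measure)"
      by (rule test_function_measurable[OF mollifier_test])
    have im: "integrable lborel (\<lambda>x. mollifier k (x - y))"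
      by (intro integrable_lborel_shift test_function_integrable_lborel mollifier_test)
    have ifm: "integrable lborel (\<lambda>x. f x * mollifier k (x - y))"
    proof (rule Bochner_Integration.integrable_bound[OF integrable_mult_right[OF im, of B]])
      have "\<bar>f x\<bar> * a \<le> \<bar>B\<bar> * a" if "0 \<le> a" for x a
        using B[of x] that by (intro mult_right_mono) auto
      then show "AE x in lborel. norm (f x * mollifier k (x - y)) \<le> norm (B * mollifier k (x - y))"
        by (intro AE_I2) (auto simp: abs_mult)
    qed measurable
    have one: "(LINT x|lborel. mollifier k (x - y)) = 1"
      by (simp add: lborel_integral_shift[of "mollifier k"] integral_mollifier)
    have "(LINT x|lborel. f x * mollifier k (x - y)) - f y
        = (LINT x|lborel. f x * mollifier k (x - y)) - (LINT x|lborel. f y * mollifier k (x - y))"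
      by (simp add: one)
    also have "\<dots> = (LINT x|lborel. (f x - f y) * mollifier k (x - y))"
      using ifm im by (simp add: left_diff_distrib)
    also have "\<bar>\<dots>\<bar> \<le> (LINT x|lborel. \<bar>(f x - f y) * mollifier k (x - y)\<bar>)"
      by (rule integral_abs_bound)
    also have "\<dots> \<le> (LINT x|lborel. e / 2 * mollifier k (x - y))"
    proof (rule integral_mono)
      show "integrable lborel (\<lambda>x. \<bar>(f x - f y) * mollifier k (x - y)\<bar>)"
        using ifm im by (auto simp: left_diff_distrib)
      show "\<bar>(f x - f y) * mollifier k (x - y)\<bar> \<le> e / 2 * mollifier k (x - y)" for x
      proof (cases "x - y \<in> box (- cube_radius k) (cube_radius k)")
        case True
        then have "\<bar>f x - f y\<bar> \<le> e / 2" using elim d(2) by blast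
        then have "\<bar>f x - f y\<bar> * mollifier k (x - y) \<le> e / 2 * mollifier k (x - y)"
          by (rule mult_right_mono) (rule mollifier_nonneg)
        then show ?thesis by (simp only: abs_mult abs_of_nonneg[OF mollifier_nonneg])
      next
        case False
        then show ?thesis by (simp add: mollifier_eq_0)
      qed
    qed (use im in auto)
    also have "\<dots> = e / 2" by (simp add: one)
    finally show ?case using e by (simp add: dist_real_def)
  qed
qed

section \<open>Total variation by duality\<close>

text \<open>The index is shifted by \<open>n\<close> because partitions are indexed by natural numbers: for a function with values in
\<open>[-1, 1]\<close> the sets with \<open>k \<le> 2 n\<close> cover everything.\<close>
definition level_set :: "nat \<Rightarrow> ('a \<Rightarrow> real) \<Rightarrow> nat \<Rightarrow> 'a set"
  where "level_set n f k = {x. \<lfloor>real n * f x\<rfloor> = int k - int n}"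

lemma level_set_borel [measurable]:
  assumes [measurable]: "f \<in> borel_measurable borel"
  shows "level_set n f k \<in> sets borel"
  unfolding level_set_def by measurable

lemma disjoint_level_set: "disjoint_family (level_set n f)"
  by (auto simp: disjoint_family_on_def level_set_def)

lemma UN_level_set:
  assumes "\<And>x. \<bar>f x\<bar> \<le> 1"
  shows "(\<Union>k. level_set n f k) = UNIV"
proof -
  have "x \<in> level_set n f (nat (\<lfloor>real n * f x\<rfloor> + int n))" for x
  proof -
    have "real n * (- 1) \<le> real n * f x"
      using assms[of x] by (intro mult_left_mono) (auto simp: abs_le_iff)
    then have "- int n \<le> \<lfloor>real n * f x\<rfloor>" by (simp add: le_floor_iff)
    then show ?thesis by (simp add: level_set_def)
  qed
  then show ?thesis by blast
qed

lemma level_set_approx: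
  assumes "\<And>x. \<bar>f x\<bar> \<le> 1" "0 < n"
  shows "\<bar>f x - (\<Sum>k\<le>2 * n. (real k - real n) / real n * indicator (level_set n f k) x)\<bar> \<le> 1 / real n"
proof -
  define j where "j = nat (\<lfloor>real n * f x\<rfloor> + int n)"
  have "real n * (- 1) \<le> real n * f x" "real n * f x \<le> real n * 1"
    using assms(1)[of x] by (intro mult_left_mono; auto simp: abs_le_iff)+
  then have b: "- int n \<le> \<lfloor>real n * f x\<rfloor>" "\<lfloor>real n * f x\<rfloor> \<le> int n"
    by (simp_all add: le_floor_iff floor_le_iff)
  have j: "int j = \<lfloor>real n * f x\<rfloor> + int n" "j \<le> 2 * n" using b by (auto simp: j_def)
  have "(\<Sum>k\<le>2 * n. (real k - real n) / real n * indicator (level_set n f k) x)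
      = (\<Sum>k\<le>2 * n. if k = j then (real j - real n) / real n else 0)"
    using j(1) by (intro sum.cong) (auto simp: level_set_def indicator_def)
  also have "\<dots> = (real j - real n) / real n" using j(2) by simp
  also have "real j - real n = of_int \<lfloor>real n * f x\<rfloor>" using j(1) by linarith
  finally have eq: "(\<Sum>k\<le>2 * n. (real k - real n) / real n * indicator (level_set n f k) x)
      = of_int \<lfloor>real n * f x\<rfloor> / real n" .
  have "f x - of_int \<lfloor>real n * f x\<rfloor> / real n = frac (real n * f x) / real n"
    using assms(2) by (simp add: frac_def field_simps)
  moreover have "0 \<le> frac (real n * f x)" "frac (real n * f x) \<le> 1"
    using frac_lt_1[of "real n * f x"] by auto
  ultimately show ?thesis unfolding eq by (simp add: abs_mult divide_right_mono)
qed

lemma sum_norm_le_variation: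
  fixes A :: "nat \<Rightarrow> (real^'n::finite) set"
  assumes "\<And>k. A k \<in> sets borel" "disjoint_family A" "(\<Union>k. A k) = UNIV"
    and fin: "variation_measure \<mu> UNIV < top"
  shows "(\<Sum>k\<in>K. norm (\<mu> (A k))) \<le> enn2real (variation_measure \<mu> UNIV)"
proof (cases "finite K")
  case True
  have "ennreal (\<Sum>k\<in>K. norm (\<mu> (A k))) = (\<Sum>k\<in>K. ennreal (norm (\<mu> (A k))))"
    by (simp add: sum_ennreal)
  also have "\<dots> \<le> (\<Sum>k. ennreal (norm (\<mu> (A k))))"
    by (rule sum_le_suminf) (use True in auto)
  also have "\<dots> \<le> variation_measure \<mu> UNIV"
    unfolding variation_measure_def by (rule SUP_upper) (use assms in auto)
  finally show ?thesis
    using fin by (metis enn2real_mono enn2real_ennreal sum_nonneg norm_ge_zero)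
qed simp

text \<open>Variation is defined by partitions, so \<open>\<phi>\<close> is replaced by a step function on its level sets, which form
a partition.  The coefficients of the step function have modulus at most \<open>1\<close>, and its distance to \<open>\<phi>\<close> is
at most \<open>1 / n\<close> uniformly.\<close>
lemma integral_le_variation:
  fixes P N :: "(real^'n::finite) measure"
  assumes P: "finite_measure P" "sets P = sets borel" and N: "finite_measure N" "sets N = sets borel"
    and \<mu>: "\<And>E. \<mu> E $ i = measure P E - measure N E"
    and \<phi> [measurable]: "\<phi> \<in> borel_measurable borel" and \<phi>1: "\<And>x. \<bar>\<phi> x\<bar> \<le> 1"
    and fin: "variation_measure \<mu> UNIV < top"
  shows "\<bar>(LINT x|P. \<phi> x) - (LINT x|N. \<phi> x)\<bar> \<le> enn2real (variation_measure \<mu> UNIV)"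
proof -
  let ?V = "enn2real (variation_measure \<mu> UNIV)"
  define C where "C = measure P UNIV + measure N UNIV"
  define c where "c n k = (real k - real n) / real n" for n k :: nat
  have approx: "\<bar>(LINT x|M. \<phi> x) - (\<Sum>k\<le>2 * n. c n k * measure M (level_set n \<phi> k))\<bar> \<le> measure M UNIV / real n"
    if M: "finite_measure M" "sets M = sets borel" and n: "0 < n" for M :: "(real^'n) measure" and n
  proof -
    interpret finite_measure M by fact
    note [measurable_cong] = M(2)
    have sp: "space M = UNIV" using sets_eq_imp_space_eq[OF M(2)] by simp
    have A: "level_set n \<phi> k \<in> sets M" for k unfolding M(2) by measurable
    have i\<phi>: "integrable M \<phi>" by (rule integrable_const_bound[of _ 1]) (use \<phi>1 in auto)
    have ist: "integrable M (\<lambda>x. \<Sum>k\<le>2 * n. c n k * indicator (level_set n \<phi> k) x)"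
      using A by (intro Bochner_Integration.integrable_sum integrable_mult_right integrable_real_indicator) (auto simp: less_top[symmetric])
    have "(LINT x|M. (\<Sum>k\<le>2 * n. c n k * indicator (level_set n \<phi> k) x))
        = (\<Sum>k\<le>2 * n. LINT x|M. c n k * indicator (level_set n \<phi> k) x)"
      using A by (intro Bochner_Integration.integral_sum integrable_mult_right integrable_real_indicator)
        (auto simp: less_top[symmetric])
    also have "\<dots> = (\<Sum>k\<le>2 * n. c n k * measure M (level_set n \<phi> k))"
      by (simp add: sp)
    finally have "(LINT x|M. \<phi> x) - (\<Sum>k\<le>2 * n. c n k * measure M (level_set n \<phi> k))
        = (LINT x|M. \<phi> x - (\<Sum>k\<le>2 * n. c n k * indicator (level_set n \<phi> k) x))"
      using i\<phi> ist by simp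
    also have "\<bar>\<dots>\<bar> \<le> (LINT x|M. \<bar>\<phi> x - (\<Sum>k\<le>2 * n. c n k * indicator (level_set n \<phi> k) x)\<bar>)"
      by (rule integral_abs_bound)
    also have "\<dots> \<le> (LINT x|M. 1 / real n)"
      using i\<phi> ist level_set_approx[OF \<phi>1 n] unfolding c_def by (intro integral_mono) auto
    finally show ?thesis by (simp add: sp)
  qed
  have "\<bar>(LINT x|P. \<phi> x) - (LINT x|N. \<phi> x)\<bar> \<le> ?V + C * inverse (real n)" if n: "0 < n" for n
  proof -
    have c1: "\<bar>c n k\<bar> \<le> 1" if "k \<le> 2 * n" for k
      using that n by (auto simp: c_def abs_le_iff field_simps)
    have "\<bar>(\<Sum>k\<le>2 * n. c n k * measure P (level_set n \<phi> k)) - (\<Sum>k\<le>2 * n. c n k * measure N (level_set n \<phi> k))\<bar>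
        = \<bar>\<Sum>k\<le>2 * n. c n k * (\<mu> (level_set n \<phi> k) $ i)\<bar>"
      by (simp add: \<mu> sum_subtractf[symmetric] right_diff_distrib)
    also have "\<dots> \<le> (\<Sum>k\<le>2 * n. \<bar>c n k * (\<mu> (level_set n \<phi> k) $ i)\<bar>)" by (rule sum_abs)
    also have "\<dots> \<le> (\<Sum>k\<le>2 * n. norm (\<mu> (level_set n \<phi> k)))"
    proof (rule sum_mono)
      fix k assume "k \<in> {..2 * n}"
      then have "\<bar>c n k\<bar> * \<bar>\<mu> (level_set n \<phi> k) $ i\<bar> \<le> 1 * norm (\<mu> (level_set n \<phi> k))"
        by (intro mult_mono c1 component_le_norm_cart) auto
      then show "\<bar>c n k * (\<mu> (level_set n \<phi> k) $ i)\<bar> \<le> norm (\<mu> (level_set n \<phi> k))"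
        by (simp add: abs_mult)
    qed
    also have "\<dots> \<le> ?V"
      by (intro sum_norm_le_variation disjoint_level_set UN_level_set \<phi>1 fin) measurable
    finally have "\<bar>(LINT x|P. \<phi> x) - (LINT x|N. \<phi> x)\<bar>
        \<le> ?V + measure P UNIV / real n + measure N UNIV / real n"
      using approx[OF P n] approx[OF N n] by linarith
    then show ?thesis by (simp add: C_def divide_inverse distrib_right)
  qed
  then have "\<forall>\<^sub>F n in sequentially. \<bar>(LINT x|P. \<phi> x) - (LINT x|N. \<phi> x)\<bar> \<le> ?V + C * inverse (real n)"
    by (intro eventually_sequentiallyI[of 1]) auto
  moreover have "(\<lambda>n. ?V + C * inverse (real n)) \<longlonglongrightarrow> ?V + C * 0"
    by (intro tendsto_intros lim_inverse_n)
  ultimately have "\<bar>(LINT x|P. \<phi> x) - (LINT x|N. \<phi> x)\<bar> \<le> ?V + C * 0"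
    by (intro tendsto_lowerbound[where F = sequentially]) auto
  then show ?thesis by simp
qed

definition total_variation :: "(real^'n::finite \<Rightarrow> real) \<Rightarrow> real"
  where "total_variation u = enn2real (variation_measure (gradient_measure u) UNIV)"

text \<open>\<open>moll u k\<close> is the convolution of \<open>u\<close> with a mollifier and \<open>moll_deriv u i k\<close> its \<open>i\<close>-th partial derivative, written
with the derivative already on the mollifier so that Fubini's theorem alone governs both.\<close>
definition moll :: "(real^'n::finite \<Rightarrow> real) \<Rightarrow> nat \<Rightarrow> real^'n \<Rightarrow> real"
  where "moll u k x = (LINT y|lborel. u y * mollifier k (x - y))"

definition moll_deriv :: "(real^'n::finite \<Rightarrow> real) \<Rightarrow> 'n \<Rightarrow> nat \<Rightarrow> real^'n \<Rightarrow> real"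
  where "moll_deriv u i k x = (LINT y|lborel. u y * partial_deriv i (mollifier k) (x - y))"

text \<open>The transposes of \<open>moll\<close> and \<open>moll_deriv\<close> under the pairing \<open>\<integral>s v\<close>: the same kernels, integrated over the
other variable.\<close>
definition adj_moll :: "(real^'n::finite \<Rightarrow> real) \<Rightarrow> nat \<Rightarrow> real^'n \<Rightarrow> real"
  where "adj_moll s k y = (LINT x|lborel. s x * mollifier k (x - y))"

definition adj_deriv :: "(real^'n::finite \<Rightarrow> real) \<Rightarrow> 'n \<Rightarrow> nat \<Rightarrow> real^'n \<Rightarrow> real"
  where "adj_deriv s i k y = (LINT x|lborel. s x * partial_deriv i (mollifier k) (x - y))"

lemma mollifier_measurable [measurable]:
  "mollifier k \<in> borel_measurable borel" "partial_deriv i (mollifier k) \<in> borel_measurable borel"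
  by (intro test_function_measurable mollifier_test)+

lemma mollifier_integrable:
  "integrable lborel (mollifier k)" "integrable lborel (partial_deriv i (mollifier k))"
  by (intro test_function_integrable_lborel mollifier_test)+

lemma moll_measurable [measurable]:
  assumes [measurable]: "u \<in> borel_measurable borel"
  shows "moll u k \<in> borel_measurable borel" "moll_deriv u i k \<in> borel_measurable borel"
  unfolding moll_def[abs_def] moll_deriv_def[abs_def]
  by (intro borel_measurable_integrable[where M = lborel, simplified] lborel.borel_measurable_lebesgue_integral; measurable)+

lemma adj_measurable [measurable]:
  assumes [measurable]: "s \<in> borel_measurable borel"
  shows "adj_moll s k \<in> borel_measurable borel" "adj_deriv s i k \<in> borel_measurable borel"
  unfolding adj_moll_def[abs_def] adj_deriv_def[abs_def]
  by (intro lborel.borel_measurable_lebesgue_integral; measurable)+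

lemma moll_dual:
  assumes "integrable lborel u" "s \<in> borel_measurable borel" "\<And>x. \<bar>s x\<bar> \<le> B"
  shows "(LINT x|lborel. s x * moll u k x) = (LINT y|lborel. u y * adj_moll s k y)"
    and "integrable lborel (\<lambda>x. s x * moll u k x)"
  unfolding moll_def adj_moll_def
  by (intro convolution_swap[OF lborel.sigma_finite_measure_axioms _ _ _ assms(2,3)] assms mollifier_integrable; simp)+

lemma moll_deriv_dual:
  assumes "integrable lborel u" "s \<in> borel_measurable borel" "\<And>x. \<bar>s x\<bar> \<le> B"
  shows "(LINT x|lborel. s x * moll_deriv u i k x) = (LINT y|lborel. u y * adj_deriv s i k y)"
    and "integrable lborel (\<lambda>x. s x * moll_deriv u i k x)"
  unfolding moll_deriv_def adj_deriv_def
  by (intro convolution_swap[OF lborel.sigma_finite_measure_axioms _ _ _ assms(2,3)] assms mollifier_integrable; simp)+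

lemma integral_mult_le_bound:
  fixes s g :: "'a \<Rightarrow> real"
  assumes "\<And>x. \<bar>s x\<bar> \<le> B" "integrable M g" "s \<in> borel_measurable M"
  shows "integrable M (\<lambda>x. s x * g x)" "\<bar>LINT x|M. s x * g x\<bar> \<le> B * (LINT x|M. \<bar>g x\<bar>)"
proof -
  have le: "\<bar>s x * g x\<bar> \<le> B * \<bar>g x\<bar>" for x
    using assms(1)[of x] by (simp add: abs_mult mult_right_mono)
  show i: "integrable M (\<lambda>x. s x * g x)"
    by (rule Bochner_Integration.integrable_bound[of M "\<lambda>x. B * \<bar>g x\<bar>"])
       (use assms le in \<open>auto intro!: AE_I2 order_trans[OF le abs_ge_self]\<close>)
  have "\<bar>LINT x|M. s x * g x\<bar> \<le> (LINT x|M. \<bar>s x * g x\<bar>)" by (rule integral_abs_bound)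
  also have "\<dots> \<le> (LINT x|M. B * \<bar>g x\<bar>)" using i assms le by (intro integral_mono) auto
  finally show "\<bar>LINT x|M. s x * g x\<bar> \<le> B * (LINT x|M. \<bar>g x\<bar>)" by simp
qed

lemma adj_bound:
  assumes "\<And>x. \<bar>s x\<bar> \<le> B" "s \<in> borel_measurable borel"
  shows "\<bar>adj_moll s k y\<bar> \<le> B"
    and "\<bar>adj_deriv s i k y\<bar> \<le> B * (LINT x|lborel. \<bar>partial_deriv i (mollifier k) x\<bar>)"
proof -
  have "\<bar>adj_moll s k y\<bar> \<le> B * (LINT x|lborel. \<bar>mollifier k (x - y)\<bar>)"
    unfolding adj_moll_def
    by (intro integral_mult_le_bound integrable_lborel_shift mollifier_integrable) (use assms in auto)
  then show "\<bar>adj_moll s k y\<bar> \<le> B"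
    by (simp add: lborel_integral_shift[of "mollifier k"] integral_mollifier abs_of_nonneg[OF mollifier_nonneg])
  have "\<bar>adj_deriv s i k y\<bar> \<le> B * (LINT x|lborel. \<bar>partial_deriv i (mollifier k) (x - y)\<bar>)"
    unfolding adj_deriv_def
    by (intro integral_mult_le_bound integrable_lborel_shift mollifier_integrable) (use assms in auto)
  then show "\<bar>adj_deriv s i k y\<bar> \<le> B * (LINT x|lborel. \<bar>partial_deriv i (mollifier k) x\<bar>)"
    by (simp add: lborel_integral_shift[of "\<lambda>x. \<bar>partial_deriv i (mollifier k) x\<bar>"])
qed

text \<open>Each \<open>mollifier k (x - y)\<close> is a test function of \<open>y\<close>, so the mollified derivative at \<open>x\<close> is its integral against
the gradient measure of \<open>u\<close>.  Exchanging the integrals moves the averaging onto \<open>s\<close>, and an average of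
values in \<open>[-1, 1]\<close> stays in \<open>[-1, 1]\<close>.\<close>
lemma moll_deriv_dual_bound:
  fixes u :: "real^'n::finite \<Rightarrow> real"
  assumes u: "u \<in> BV_cube" and s [measurable]: "s \<in> borel_measurable borel" and s1: "\<And>x. \<bar>s x\<bar> \<le> 1"
  shows "\<bar>LINT x|lborel. s x * moll_deriv u i k x\<bar> \<le> total_variation u"
proof -
  obtain P N where P: "finite_measure P" "sets P = sets borel" and N: "finite_measure N" "sets N = sets borel"
    and \<mu>: "\<And>E. gradient_measure u E $ i = measure P E - measure N E"
    and ibp: "\<And>\<phi>. \<phi> \<in> test_functions \<Longrightarrow> (LINT x|lborel. u x * partial_deriv i \<phi> x)
                           = - ((LINT x|P. \<phi> x) - (LINT x|N. \<phi> x))"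
    by (rule is_gradient_measureE[OF BV_cubeD(3)[OF u], of i]) (rule that)
  have D: "moll_deriv u i k x = (LINT y|P. 1 * mollifier k (x - y)) - (LINT y|N. 1 * mollifier k (x - y))" for x
  proof -
    have "partial_deriv i (mollifier k) (x - y) = - partial_deriv i (\<lambda>y. mollifier k (x - y)) y" for y
      using partial_deriv_reflect[OF test_function_differentiable[OF mollifier_test], of i k x y] by simp
    then have "moll_deriv u i k x = - (LINT y|lborel. u y * partial_deriv i (\<lambda>y. mollifier k (x - y)) y)"
      by (simp add: moll_deriv_def)
    also have "\<dots> = (LINT y|P. mollifier k (x - y)) - (LINT y|N. mollifier k (x - y))"
      unfolding ibp[OF mollifier_reflect_test] by simp
    finally show ?thesis by simp
  qed
  have swap: "integrable lborel (\<lambda>x. s x * (LINT y|M. 1 * mollifier k (x - y)))"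
    "(LINT x|lborel. s x * (LINT y|M. 1 * mollifier k (x - y))) = (LINT y|M. 1 * adj_moll s k y)"
    if M: "finite_measure M" "sets M = sets borel" for M :: "(real^'n) measure"
  proof -
    interpret M: finite_measure M by fact
    show "integrable lborel (\<lambda>x. s x * (LINT y|M. 1 * mollifier k (x - y)))"
      by (rule convolution_swap(1)[OF M.sigma_finite_measure_axioms M(2) _ _ s s1])
         (auto intro: mollifier_integrable)
    show "(LINT x|lborel. s x * (LINT y|M. 1 * mollifier k (x - y))) = (LINT y|M. 1 * adj_moll s k y)"
      unfolding adj_moll_def
      by (rule convolution_swap(3)[OF M.sigma_finite_measure_axioms M(2) _ _ s s1])
         (auto intro: mollifier_integrable)
  qed
  have "(LINT x|lborel. s x * moll_deriv u i k x)
      = (LINT y|P. adj_moll s k y) - (LINT y|N. adj_moll s k y)"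
    unfolding D right_diff_distrib using swap[OF P] swap[OF N] by simp
  also have "\<bar>\<dots>\<bar> \<le> total_variation u"
    unfolding total_variation_def
    by (rule integral_le_variation[OF P N \<mu>])
       (use adj_bound(1)[OF s1 s] variation_measure_finite[OF BV_cubeD(3)[OF u]] in auto)
  finally show ?thesis .
qed

lemma integral_abs_moll_deriv_le:
  assumes u: "u \<in> BV_cube"
  shows "integrable lborel (moll_deriv u i k)" "(LINT x|lborel. \<bar>moll_deriv u i k x\<bar>) \<le> total_variation u"
proof -
  have [measurable]: "u \<in> borel_measurable borel" using BV_cubeD(2)[OF u] .
  show "integrable lborel (moll_deriv u i k)"
    using moll_deriv_dual(2)[OF BV_cubeD(1)[OF u], of "\<lambda>_. 1" 1 i k] by simp
  have "(LINT x|lborel. \<bar>moll_deriv u i k x\<bar>) = (LINT x|lborel. sgn (moll_deriv u i k x) * moll_deriv u i k x)"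
    by (simp add: abs_sgn mult.commute)
  also have "\<dots> \<le> total_variation u"
    using moll_deriv_dual_bound[OF u, of "\<lambda>x. sgn (moll_deriv u i k x)" i k] by (auto simp: sgn_if)
  finally show "(LINT x|lborel. \<bar>moll_deriv u i k x\<bar>) \<le> total_variation u" .
qed

section \<open>The Sobolev inequality in dual form\<close>

lemma moll_eq_0:
  assumes u: "AE x in lborel. x \<notin> cbox 0 1 \<longrightarrow> u x = 0" and x: "x $ j > 2 \<or> x $ j < - 1"
  shows "moll u k x = 0"
proof -
  have "AE y in lborel. u y * mollifier k (x - y) = 0"
    using u
  proof eventually_elim
    case (elim y)
    show ?case
    proof (cases "y \<in> cbox 0 1")
      case True
      then have y: "0 \<le> y $ j" "y $ j \<le> 1" by (auto simp: mem_box_cart)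
      have r: "cube_radius k $ j \<le> (1 :: real)" by (simp add: cube_radius_def)
      then have "\<not> (- cube_radius k $ j < (x - y) $ j \<and> (x - y) $ j < cube_radius k $ j)"
        using x y r by auto
      then have "x - y \<notin> box (- cube_radius k) (cube_radius k)"
        unfolding mem_box_cart by (auto intro!: exI[of _ j])
      then show ?thesis by (simp add: mollifier_eq_0)
    qed (use elim in simp)
  qed
  then show ?thesis unfolding moll_def by (rule integral_eq_zero_AE)
qed

lemma moll_deriv_eq_0:
  assumes u: "AE x in lborel. x \<notin> cbox 0 1 \<longrightarrow> u x = 0" and x: "x \<notin> cbox (\<chi> j. - 1) (\<chi> j. 2)"
  shows "moll_deriv u i k x = 0"
proof -
  obtain j where j: "x $ j > 2 \<or> x $ j < - 1"
    using x by (auto simp: mem_box_cart not_le)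
  have "AE y in lborel. u y * partial_deriv i (mollifier k) (x - y) = 0"
    using u
  proof eventually_elim
    case (elim y)
    show ?case
    proof (cases "y \<in> cbox 0 1")
      case True
      then have y: "0 \<le> y $ j" "y $ j \<le> 1" by (auto simp: mem_box_cart)
      have r: "cube_radius k $ j \<le> (1 :: real)" by (simp add: cube_radius_def)
      then have "\<not> (- cube_radius k $ j \<le> (x - y) $ j \<and> (x - y) $ j \<le> cube_radius k $ j)"
        using j y r by auto
      then have "x - y \<notin> cbox (- cube_radius k) (cube_radius k)"
        unfolding mem_box_cart by (auto intro!: exI[of _ j])
      then show ?thesis by (simp add: partial_mollifier_eq_0)
    qed (use elim in simp)
  qed
  then show ?thesis unfolding moll_deriv_def by (rule integral_eq_zero_AE)
qed

lemma (in pair_sigma_finite) integrable_pair_mult: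
  fixes f :: "'a \<Rightarrow> real" and g :: "'b \<Rightarrow> real"
  assumes "integrable M1 f" "integrable M2 g"
  shows "integrable (M1 \<Otimes>\<^sub>M M2) (\<lambda>(x, y). f x * g y)"
proof (rule Fubini_integrable)
  show "(\<lambda>(x, y). f x * g y) \<in> borel_measurable (M1 \<Otimes>\<^sub>M M2)"
    using assms[THEN borel_measurable_integrable] by measurable
qed (use assms in \<open>auto simp: abs_mult\<close>)

text \<open>Far out on the line through \<open>x\<close> the mollified function vanishes, so its value at \<open>x\<close> is minus the integral of
the derivative over a segment of that line.\<close>
lemma abs_moll_le_line_integral:
  fixes u :: "real^'n::finite \<Rightarrow> real"
  assumes u: "integrable lborel u" and u0: "AE x in lborel. x \<notin> cbox 0 1 \<longrightarrow> u x = 0"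
  shows "ennreal \<bar>moll u k x\<bar> \<le> (\<integral>\<^sup>+s. ennreal \<bar>moll_deriv u i k (x + s *\<^sub>R axis i 1)\<bar> \<partial>lborel)"
proof -
  let ?e = "axis i 1 :: real^'n" and ?m = "mollifier k :: real^'n \<Rightarrow> real"
  let ?D = "partial_deriv i ?m"
  \<comment> \<open>The mollified function is supported in the cube \<open>[-1, 2]\<^sup>d\<close>, and \<open>x $ i + R \<ge> 3\<close>.\<close>
  define R where "R = 3 + \<bar>x $ i\<bar>"
  have R: "0 \<le> R" by (simp add: R_def)
  have [measurable]: "u \<in> borel_measurable borel" using u by auto
  have m: "?m \<in> test_functions" by (rule mollifier_test)
  obtain B where B: "\<And>z. \<bar>?D z\<bar> \<le> B" using test_function_props(4)[OF m, of i] by blast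
  have um: "integrable lborel (\<lambda>y. u y * ?m (z - y))" for z
  proof -
    obtain B' where B': "\<And>z. \<bar>?m z\<bar> \<le> B'" using test_function_props(3)[OF m] by blast
    have "integrable lborel (\<lambda>y. ?m (z - y) * u y)"
      by (rule integral_mult_le_bound(1)[of _ B']) (use B' u in auto)
    then show ?thesis by (simp add: mult.commute)
  qed
  have int: "integrable (lborel \<Otimes>\<^sub>M lborel) (\<lambda>(y, s). u y * (indicator {0..R} s * ?D (x - y + s *\<^sub>R ?e)))"
  proof (rule Bochner_Integration.integrable_bound)
    show "integrable (lborel \<Otimes>\<^sub>M lborel) (\<lambda>(y, s). u y * (B * indicator {0..R} s))"
      by (intro lborel_pair.integrable_pair_mult u integrable_mult_right integrable_real_indicator)
         (auto simp: emeasure_lborel_Icc_eq)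
    have "\<bar>a\<bar> * (indicator {0..R} s * \<bar>?D z\<bar>) \<le> \<bar>a\<bar> * (\<bar>B\<bar> * indicator {0..R} s)" for a s z
      using order_trans[OF B[of z] abs_ge_self] by (intro mult_left_mono) (auto simp: indicator_def)
    then show "AE z in lborel \<Otimes>\<^sub>M lborel. norm (case z of (y, s) \<Rightarrow> u y * (indicator {0..R} s * ?D (x - y + s *\<^sub>R ?e)))
        \<le> norm (case z of (y, s) \<Rightarrow> u y * (B * indicator {0..R} s))"
      by (intro AE_I2) (auto simp: abs_mult)
  qed measurable
  have inner: "(LINT y|lborel. u y * (indicator {0..R} s * ?D (x - y + s *\<^sub>R ?e)))
      = indicator {0..R} s * moll_deriv u i k (x + s *\<^sub>R ?e)" for s
  proof -
    have "x - y + s *\<^sub>R ?e = x + s *\<^sub>R ?e - y" for y by simp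
    then have "u y * (indicator {0..R} s * ?D (x - y + s *\<^sub>R ?e))
        = indicator {0..R} s * (u y * ?D (x + s *\<^sub>R ?e - y))" for y
      by (simp only: mult.left_commute)
    then show ?thesis unfolding moll_deriv_def by (simp only: integral_mult_right_zero)
  qed
  have "moll u k (x + R *\<^sub>R ?e) = 0"
    by (rule moll_eq_0[OF u0, of _ i]) (auto simp: R_def)
  then have "- moll u k x = moll u k (x + R *\<^sub>R ?e) - moll u k x" by simp
  also have "\<dots> = (LINT y|lborel. u y * (?m (x - y + R *\<^sub>R ?e) - ?m (x - y)))"
    using um[of "x + R *\<^sub>R ?e"] um[of x]
    by (simp add: moll_def right_diff_distrib algebra_simps)
  also have "\<dots> = (LINT y|lborel. LINT s|lborel. u y * (indicator {0..R} s * ?D (x - y + s *\<^sub>R ?e)))"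
    using line_integral_partial[OF test_function_differentiable[OF m] test_function_props(2)[OF m] R]
    by (simp add: set_lebesgue_integral_def)
  also have "\<dots> = (LINT s|lborel. LINT y|lborel. u y * (indicator {0..R} s * ?D (x - y + s *\<^sub>R ?e)))"
    using lborel_pair.Fubini_integral[OF int] by simp
  also have "\<dots> = (LINT s|lborel. indicator {0..R} s * moll_deriv u i k (x + s *\<^sub>R ?e))"
    unfolding inner ..
  finally have eq: "- moll u k x = (LINT s|lborel. indicator {0..R} s * moll_deriv u i k (x + s *\<^sub>R ?e))" .
  have "ennreal \<bar>moll u k x\<bar> = ennreal (norm (LINT s|lborel. indicator {0..R} s * moll_deriv u i k (x + s *\<^sub>R ?e)))"
    unfolding eq[symmetric] by simp
  also have "\<dots> \<le> (\<integral>\<^sup>+s. ennreal (norm (indicator {0..R} s * moll_deriv u i k (x + s *\<^sub>R ?e))) \<partial>lborel)"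
  proof (rule integral_norm_bound_ennreal)
    have "integrable lborel (\<lambda>s. LINT y|lborel. u y * (indicator {0..R} s * ?D (x - y + s *\<^sub>R ?e)))"
      using lborel_pair.integrable_snd[OF int] by simp
    then show "integrable lborel (\<lambda>s. indicator {0..R} s * moll_deriv u i k (x + s *\<^sub>R ?e))"
      unfolding inner .
  qed
  also have "\<dots> \<le> (\<integral>\<^sup>+s. ennreal \<bar>moll_deriv u i k (x + s *\<^sub>R ?e)\<bar> \<partial>lborel)"
    by (intro nn_integral_mono ennreal_leI) (auto simp: indicator_def)
  finally show ?thesis .
qed

text \<open>A function that is bounded by its line integrals in each of the \<open>d\<close> coordinate directions is bounded by
their geometric mean.  Each of these line integrals is constant in its own direction, which is what the
product inequality asks for.  The bound with \<open>G\<close> on the left is the Sobolev inequality in dual form: it gives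
the pairing with an \<open>L\<^sup>d\<close> function directly, also for \<open>d = 1\<close>, where the Sobolev exponent is infinite.\<close>
lemma gagliardo_nirenberg_lborel:
  fixes G W :: "real^'n::finite \<Rightarrow> ennreal" and D :: "'n \<Rightarrow> real^'n \<Rightarrow> ennreal"
  assumes [measurable]: "G \<in> borel_measurable borel" "\<And>i. D i \<in> borel_measurable borel"
    and [measurable]: "W \<in> borel_measurable borel"
    and W: "\<And>i x. W x \<le> (\<integral>\<^sup>+s. D i (x + s *\<^sub>R axis i 1) \<partial>lborel)"
  shows "(\<integral>\<^sup>+x. G x * W x \<partial>lborel) ^ CARD('n)
    \<le> (\<integral>\<^sup>+x. G x ^ CARD('n) \<partial>lborel) * (\<Prod>i\<in>UNIV. \<integral>\<^sup>+x. D i x \<partial>lborel)"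
proof -
  let ?d = "CARD('n)" and ?B = "Basis :: (real^'n) set"
  let ?M = "\<lambda>_ :: real^'n. lborel :: real measure"
  interpret product_sigma_finite ?M by standard
  have d: "0 < ?d" "card ?B = ?d" by simp_all
  \<comment> \<open>\<open>T\<close> carries the product measure indexed by the basis to Lebesgue measure.\<close>
  define T where "T x = (\<Sum>b\<in>?B. x b *\<^sub>R b)" for x :: "real^'n \<Rightarrow> real"
  have T [measurable]: "T \<in> measurable (PiM ?B ?M) borel"
    unfolding T_def[abs_def] by measurable
  have nnT: "(\<integral>\<^sup>+x. F x \<partial>lborel) = (\<integral>\<^sup>+x. F (T x) \<partial>PiM ?B ?M)"
    if [measurable]: "F \<in> borel_measurable borel" for F :: "real^'n \<Rightarrow> ennreal"
    unfolding T_def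
    by (subst lborel_eq, subst nn_integral_distr) (use T in \<open>auto simp: T_def[abs_def]\<close>)
  define idx where "idx b = (SOME i. b = (axis i 1 :: real^'n))" for b
  have idx: "axis (idx b) 1 = b" if "b \<in> ?B" for b
    using that someI_ex[of "\<lambda>i. b = (axis i 1 :: real^'n)"] by (auto simp: Basis_vec_def idx_def)
  have idx_axis: "idx (axis i 1) = i" for i
    unfolding idx_def by (auto simp: axis_eq_axis)
  define c where "c b x = ennroot ?d (\<integral>\<^sup>+s. D (idx b) (T (x(b := s))) \<partial>lborel)" for b x
  have ins: "insert b (?B - {b}) = ?B" if "b \<in> ?B" for b using that by auto
  have Tupd [measurable]: "(\<lambda>(x, s). T (x(b := s))) \<in> measurable (PiM (?B - {b}) ?M \<Otimes>\<^sub>M lborel) borel"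
    if b: "b \<in> ?B" for b
  proof -
    have "(\<lambda>(x, s). x(b := s)) \<in> measurable (PiM (?B - {b}) ?M \<Otimes>\<^sub>M ?M b) (PiM (insert b (?B - {b})) ?M)"
      by (rule measurable_add_dim)
    then have "(\<lambda>(x, s). x(b := s)) \<in> measurable (PiM (?B - {b}) ?M \<Otimes>\<^sub>M lborel) (PiM ?B ?M)"
      by (simp only: ins[OF b])
    from measurable_compose[OF this T] show ?thesis by (simp add: case_prod_unfold)
  qed
  have c: "c b \<in> borel_measurable (PiM (?B - {b}) ?M)" if b: "b \<in> ?B" for b
  proof -
    note [measurable] = Tupd[OF b]
    show ?thesis unfolding c_def[abs_def] by measurable
  qed
  have T_add: "T (x(b := x b + s)) = T x + s *\<^sub>R b" if b: "b \<in> ?B" for x b s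
  proof -
    have "T (x(b := x b + s)) = (x b + s) *\<^sub>R b + (\<Sum>a\<in>?B - {b}. x a *\<^sub>R a)"
      unfolding T_def using b by (subst sum.remove[of _ b]) auto
    also have "\<dots> = T x + s *\<^sub>R b"
      unfolding T_def using b by (subst sum.remove[of ?B b]) (auto simp: algebra_simps)
    finally show ?thesis .
  qed
  have W': "W (T x) \<le> (\<Prod>b\<in>?B. c b (restrict x (?B - {b})))" for x
  proof -
    have root: "ennroot ?d (W (T x)) \<le> c b (restrict x (?B - {b}))" if b: "b \<in> ?B" for b
    proof (rule power_le_imp_le_ennreal[OF _ d(1)])
      have "W (T x) \<le> (\<integral>\<^sup>+s. D (idx b) (T x + s *\<^sub>R b) \<partial>lborel)"
        using W[of "T x" "idx b"] by (simp add: idx b)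
      also have "\<dots> = (\<integral>\<^sup>+s. D (idx b) (T x + (s - x b) *\<^sub>R b) \<partial>lborel)"
        by (rule nn_integral_lborel_shift[symmetric]) measurable
      also have "\<dots> = (\<integral>\<^sup>+s. D (idx b) (T ((restrict x (?B - {b}))(b := s))) \<partial>lborel)"
      proof (rule nn_integral_cong)
        fix s
        have "T x + (s - x b) *\<^sub>R b = T (x(b := s))" using T_add[OF b, of x "s - x b"] by simp
        also have "\<dots> = T ((restrict x (?B - {b}))(b := s))"
          unfolding T_def by (rule sum.cong) auto
        finally show "D (idx b) (T x + (s - x b) *\<^sub>R b) = D (idx b) (T ((restrict x (?B - {b}))(b := s)))" by simp
      qed
      finally show "ennroot ?d (W (T x)) ^ ?d \<le> c b (restrict x (?B - {b})) ^ ?d"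
        unfolding c_def ennroot_power[OF d(1)] .
    qed
    have "W (T x) = (\<Prod>b\<in>?B. ennroot ?d (W (T x)))"
      using ennroot_power[OF d(1)] by simp
    also have "\<dots> \<le> (\<Prod>b\<in>?B. c b (restrict x (?B - {b})))"
      by (intro prod_mono_ennreal root)
    finally show ?thesis .
  qed
  have cint: "(\<integral>\<^sup>+x. c b x ^ ?d \<partial>PiM (?B - {b}) ?M) = (\<integral>\<^sup>+x. D (idx b) x \<partial>lborel)" if b: "b \<in> ?B" for b
  proof -
    have "(\<integral>\<^sup>+x. D (idx b) x \<partial>lborel) = (\<integral>\<^sup>+x. D (idx b) (T x) \<partial>PiM (insert b (?B - {b})) ?M)"
      unfolding ins[OF b] by (rule nnT) measurable
    also have "\<dots> = (\<integral>\<^sup>+x. \<integral>\<^sup>+s. D (idx b) (T (x(b := s))) \<partial>lborel \<partial>PiM (?B - {b}) ?M)"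
    proof (rule product_nn_integral_insert)
      show "(\<lambda>x. D (idx b) (T x)) \<in> borel_measurable (PiM (insert b (?B - {b})) ?M)"
        unfolding ins[OF b] by measurable
    qed auto
    finally show ?thesis by (simp add: c_def ennroot_power)
  qed
  have "(\<integral>\<^sup>+x. G x * W x \<partial>lborel) ^ ?d \<le> (\<integral>\<^sup>+x. G (T x) * (\<Prod>b\<in>?B. c b (restrict x (?B - {b}))) \<partial>PiM ?B ?M) ^ ?d"
    by (subst nnT, measurable) (intro power_mono nn_integral_mono mult_left_mono W', auto)
  also have "\<dots> \<le> (\<integral>\<^sup>+x. G (T x) ^ ?d \<partial>PiM ?B ?M) * (\<Prod>b\<in>?B. \<integral>\<^sup>+x. c b x ^ ?d \<partial>PiM (?B - {b}) ?M)"
    using gagliardo_product_inequality[of ?B ?B "\<lambda>x. G (T x)" c] c by simp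
  also have "(\<Prod>b\<in>?B. \<integral>\<^sup>+x. c b x ^ ?d \<partial>PiM (?B - {b}) ?M) = (\<Prod>b\<in>?B. \<integral>\<^sup>+x. D (idx b) x \<partial>lborel)"
    by (intro prod.cong refl cint)
  also have "\<dots> = (\<Prod>i\<in>UNIV. \<integral>\<^sup>+x. D (idx (axis i 1)) x \<partial>lborel)"
    by (rule prod.reindex_bij_betw[symmetric])
       (auto simp: bij_betw_def inj_on_def axis_eq_axis Basis_vec_def)
  also have "\<dots> = (\<Prod>i\<in>UNIV. \<integral>\<^sup>+x. D i x \<partial>lborel)" by (simp only: idx_axis)
  also have "(\<integral>\<^sup>+x. G (T x) ^ ?d \<partial>PiM ?B ?M) = (\<integral>\<^sup>+x. G x ^ ?d \<partial>lborel)"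
    by (subst nnT) auto
  finally show ?thesis .
qed

lemma sobolev_mollified:
  fixes u :: "real^'n::finite \<Rightarrow> real"
  assumes u: "u \<in> BV_cube" and [measurable]: "g \<in> borel_measurable borel"
  shows "(\<integral>\<^sup>+x. ennreal \<bar>g x\<bar> * ennreal \<bar>moll u k x\<bar> \<partial>lborel) ^ CARD('n)
    \<le> (\<integral>\<^sup>+x. ennreal \<bar>g x\<bar> ^ CARD('n) \<partial>lborel) * ennreal (total_variation u) ^ CARD('n)"
proof -
  have [measurable]: "u \<in> borel_measurable borel" using BV_cubeD(2)[OF u] .
  have "(\<integral>\<^sup>+x. ennreal \<bar>g x\<bar> * ennreal \<bar>moll u k x\<bar> \<partial>lborel) ^ CARD('n)
    \<le> (\<integral>\<^sup>+x. ennreal \<bar>g x\<bar> ^ CARD('n) \<partial>lborel) * (\<Prod>i\<in>UNIV. \<integral>\<^sup>+x. ennreal \<bar>moll_deriv u i k x\<bar> \<partial>lborel)"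
    by (rule gagliardo_nirenberg_lborel)
       (auto intro: abs_moll_le_line_integral BV_cubeD[OF u])
  also have "\<dots> \<le> (\<integral>\<^sup>+x. ennreal \<bar>g x\<bar> ^ CARD('n) \<partial>lborel) * (\<Prod>i\<in>(UNIV::'n set). ennreal (total_variation u))"
  proof (intro mult_left_mono prod_mono_ennreal)
    fix i :: 'n
    show "(\<integral>\<^sup>+x. ennreal \<bar>moll_deriv u i k x\<bar> \<partial>lborel) \<le> ennreal (total_variation u)"
      using integral_abs_moll_deriv_le[OF u, of i k]
      by (subst nn_integral_eq_integral) (auto intro: ennreal_leI)
  qed simp
  finally show ?thesis by simp
qed

lemma bump_eq_0:
  assumes "x \<notin> box a b"
  shows "bump a b k x = 0"
proof -
  obtain j where j: "\<not> (a $ j < x $ j \<and> x $ j < b $ j)" using assms by (auto simp: mem_box_cart)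
  have "\<not> 0 < real k * (x $ j) + - (real k * (a $ j)) \<or> \<not> 0 < - real k * (x $ j) + real k * (b $ j)"
  proof (rule ccontr)
    assume "\<not> ?thesis"
    then have "real k * (a $ j) < real k * (x $ j)" "real k * (x $ j) < real k * (b $ j)" by simp_all
    then have "a $ j < x $ j" "x $ j < b $ j"
      by (meson mult_less_cancel_left_disj of_nat_0_le_iff linorder_not_less)+
    then show False using j by blast
  qed
  then have "flat 1 (real k * (x $ j) + - (real k * (a $ j))) * flat 1 (- real k * (x $ j) + real k * (b $ j)) = 0"
    unfolding flat_def by auto
  then show ?thesis unfolding bump_def by (intro prod_zero) auto
qed

text \<open>Mollification converges weakly; the convergence is taken on the side of the continuous factor.\<close>
lemma adj_moll_tendsto:
  fixes u g :: "real^'n::finite \<Rightarrow> real"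
  assumes u: "integrable lborel u" and g: "continuous_on UNIV g" and B: "\<And>x. \<bar>g x\<bar> \<le> B"
  shows "(\<lambda>k. LINT y|lborel. u y * adj_moll g k y) \<longlonglongrightarrow> (LINT y|lborel. u y * g y)"
proof (rule integral_dominated_convergence[where w = "\<lambda>y. \<bar>B\<bar> * \<bar>u y\<bar>"])
  have [measurable]: "u \<in> borel_measurable borel" using u by auto
  have [measurable]: "g \<in> borel_measurable borel" using g by (rule borel_measurable_continuous_onI)
  show "(\<lambda>y. u y * g y) \<in> borel_measurable lborel"
    "\<And>k. (\<lambda>y. u y * adj_moll g k y) \<in> borel_measurable lborel" by measurable
  show "AE y in lborel. (\<lambda>k. u y * adj_moll g k y) \<longlonglongrightarrow> u y * g y"
    unfolding adj_moll_def
    by (intro AE_I2 tendsto_mult tendsto_const mollifier_approx_identity[OF _ B])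
       (use g in \<open>auto simp: continuous_on_eq_continuous_at\<close>)
  show "AE y in lborel. norm (u y * adj_moll g k y) \<le> \<bar>B\<bar> * \<bar>u y\<bar>" for k
  proof (intro AE_I2)
    fix y
    have "\<bar>adj_moll g k y\<bar> \<le> B" by (rule adj_bound(1)[OF B]) measurable
    then have "\<bar>u y\<bar> * \<bar>adj_moll g k y\<bar> \<le> \<bar>u y\<bar> * \<bar>B\<bar>" by (intro mult_left_mono) auto
    then show "norm (u y * adj_moll g k y) \<le> \<bar>B\<bar> * \<bar>u y\<bar>" by (simp add: abs_mult mult.commute)
  qed
qed (use u in auto)

lemma sobolev_continuous:
  fixes u g :: "real^'n::finite \<Rightarrow> real"
  assumes u: "u \<in> BV_cube" and g: "continuous_on UNIV g" and g0: "\<And>x. x \<notin> cbox 0 1 \<Longrightarrow> g x = 0"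
  shows "\<bar>LINT y|lborel. u y * g y\<bar> ^ CARD('n) \<le> (LINT x|lborel. \<bar>g x\<bar> ^ CARD('n)) * total_variation u ^ CARD('n)"
proof -
  let ?d = "CARD('n)"
  have [measurable]: "g \<in> borel_measurable borel" using g by (rule borel_measurable_continuous_onI)
  have "compact (g ` cbox 0 1)"
    by (intro compact_continuous_image compact_cbox continuous_on_subset[OF g]) simp
  then obtain B where "\<forall>x\<in>cbox 0 1. \<bar>g x\<bar> \<le> B" by (auto dest!: compact_imp_bounded simp: bounded_iff)
  then have B: "\<bar>g x\<bar> \<le> max B 0" for x using g0[of x] by (cases "x \<in> cbox 0 1") (auto simp: le_max_iff_disj)
  have igd: "integrable lborel (\<lambda>x. \<bar>g x\<bar> ^ ?d)"
    by (rule integrable_compact_support[OF compact_cbox[of 0 1]])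
       (auto intro!: continuous_intros g simp: g0)
  have tv: "0 \<le> total_variation u" by (simp add: total_variation_def)
  have *: "\<bar>LINT x|lborel. g x * moll u k x\<bar> ^ ?d \<le> (LINT x|lborel. \<bar>g x\<bar> ^ ?d) * total_variation u ^ ?d" for k
  proof -
    have i: "integrable lborel (\<lambda>x. g x * moll u k x)"
      by (rule moll_dual(2)[OF BV_cubeD(1)[OF u] _ B]) auto
    have "ennreal \<bar>LINT x|lborel. g x * moll u k x\<bar> \<le> (\<integral>\<^sup>+x. ennreal \<bar>g x\<bar> * ennreal \<bar>moll u k x\<bar> \<partial>lborel)"
      using integral_norm_bound_ennreal[OF i] by (simp add: abs_mult ennreal_mult)
    then have "ennreal \<bar>LINT x|lborel. g x * moll u k x\<bar> ^ ?d \<le> (\<integral>\<^sup>+x. ennreal \<bar>g x\<bar> * ennreal \<bar>moll u k x\<bar> \<partial>lborel) ^ ?d"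
      by (intro power_mono) auto
    also have "\<dots> \<le> (\<integral>\<^sup>+x. ennreal \<bar>g x\<bar> ^ ?d \<partial>lborel) * ennreal (total_variation u) ^ ?d"
      by (rule sobolev_mollified[OF u]) measurable
    also have "(\<integral>\<^sup>+x. ennreal \<bar>g x\<bar> ^ ?d \<partial>lborel) = ennreal (LINT x|lborel. \<bar>g x\<bar> ^ ?d)"
      using igd by (subst nn_integral_eq_integral[symmetric]) (auto simp: ennreal_power)
    finally show ?thesis
      using tv by (simp add: ennreal_power ennreal_mult[symmetric])
  qed
  have "(\<lambda>k. LINT x|lborel. g x * moll u k x) \<longlonglongrightarrow> (LINT y|lborel. u y * g y)"
    using adj_moll_tendsto[OF BV_cubeD(1)[OF u] g B] moll_dual(1)[OF BV_cubeD(1)[OF u] _ B] by simp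
  then have "(\<lambda>k. \<bar>LINT x|lborel. g x * moll u k x\<bar> ^ ?d) \<longlonglongrightarrow> \<bar>LINT y|lborel. u y * g y\<bar> ^ ?d"
    by (intro tendsto_intros)
  then show ?thesis by (rule LIMSEQ_le_const2) (use * in auto)
qed

lemma AE_cube_interior: "AE x in lborel. x \<in> cbox 0 1 \<longleftrightarrow> x \<in> box 0 (1 :: real^'n::finite)"
proof -
  have "negligible (cbox 0 1 - box 0 (1 :: real^'n))" by (rule negligible_frontier_interval)
  then have "cbox 0 1 - box 0 (1 :: real^'n) \<in> null_sets lborel"
    by (auto simp: negligible_iff_null_sets null_sets_completion_iff)
  then have "AE x in lborel. x \<notin> cbox 0 1 - box 0 (1 :: real^'n)" by (rule AE_not_in)
  then show ?thesis by eventually_elim (use box_subset_cbox in blast)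
qed

text \<open>A Borel function is an almost everywhere limit of continuous functions.  Truncating them at \<open>B\<close> makes the
convergence dominated, and multiplying by bumps that converge to the indicator of the open cube makes
them vanish outside the cube.\<close>
lemma sobolev_bounded:
  fixes u g :: "real^'n::finite \<Rightarrow> real"
  assumes u: "u \<in> BV_cube" and [measurable]: "g \<in> borel_measurable borel" and B: "\<And>x. \<bar>g x\<bar> \<le> B"
  shows "\<bar>LINT x:cbox 0 1|lborel. g x * u x\<bar> ^ CARD('n)
    \<le> (LINT x:cbox 0 1|lborel. \<bar>g x\<bar> ^ CARD('n)) * total_variation u ^ CARD('n)"
proof -
  let ?d = "CARD('n)" and ?Q = "cbox 0 (1 :: real^'n)"
  have [measurable]: "u \<in> borel_measurable borel" using BV_cubeD(2)[OF u] .
  have B0: "0 \<le> B" using B[of undefined] by (meson abs_ge_zero order_trans)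
  have "g measurable_on UNIV"
    by (rule lebesgue_measurable_imp_measurable_on_real) (auto intro: measurable_completion)
  then obtain N h where N: "negligible N" and h: "\<And>n. continuous_on UNIV (h n)"
    and hg: "\<And>x. x \<notin> N \<Longrightarrow> (\<lambda>n. h n x) \<longlonglongrightarrow> g x"
    unfolding measurable_on_def by auto
  have "N \<in> null_sets (completion lborel)" using N by (simp add: negligible_iff_null_sets)
  then have "AE x in completion lborel. x \<notin> N" by (rule AE_not_in)
  then have AEN: "AE x in lborel. x \<notin> N" by (simp add: AE_completion_iff)
  define f where "f n x = max (- B) (min B (h n x)) * bump 0 1 n x" for n x
  have bump_cont: "continuous_on UNIV (bump 0 1 n :: real^'n \<Rightarrow> real)" for n
    by (rule test_function_props(1)[OF bump_test])
  have fc: "continuous_on UNIV (f n)" for n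
    unfolding f_def by (intro continuous_intros h bump_cont)
  have [measurable]: "f n \<in> borel_measurable borel" for n
    by (rule borel_measurable_continuous_onI[OF fc])
  have f0: "f n x = 0" if "x \<notin> ?Q" for n x
  proof -
    have "x \<notin> box 0 1" using that box_subset_cbox by blast
    then show ?thesis by (simp add: f_def bump_eq_0)
  qed
  have fB: "\<bar>f n x\<bar> \<le> B" for n x
  proof -
    have "\<bar>max (- B) (min B (h n x))\<bar> * \<bar>bump 0 1 n x\<bar> \<le> B * 1"
      using B0 by (intro mult_mono bump_le) auto
    then show ?thesis by (simp add: f_def abs_mult)
  qed
  have flim: "AE x in lborel. (\<lambda>n. f n x) \<longlonglongrightarrow> indicator ?Q x * g x"
    using AEN AE_cube_interior
  proof eventually_elim
    case (elim x)
    have "(\<lambda>n. f n x) \<longlonglongrightarrow> max (- B) (min B (g x)) * indicator (box 0 1) x"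
      unfolding f_def by (intro tendsto_intros hg elim bump_tendsto)
    moreover have "max (- B) (min B (g x)) = g x" using B[of x] by auto
    moreover have "indicator (box 0 1) x = (indicator ?Q x :: real)" using elim by (simp add: indicator_def)
    ultimately show ?case by (simp add: mult.commute)
  qed
  have 1: "(\<lambda>n. LINT x|lborel. u x * f n x) \<longlonglongrightarrow> (LINT x|lborel. u x * (indicator ?Q x * g x))"
  proof (rule integral_dominated_convergence[where w = "\<lambda>x. B * \<bar>u x\<bar>"])
    show "AE x in lborel. (\<lambda>n. u x * f n x) \<longlonglongrightarrow> u x * (indicator ?Q x * g x)"
      using flim by eventually_elim (intro tendsto_intros)
    show "AE x in lborel. norm (u x * f n x) \<le> B * \<bar>u x\<bar>" for n
      using mult_right_mono[OF fB[of n] abs_ge_zero[of "u _"]] by (intro AE_I2) (simp add: abs_mult mult.commute)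
  qed (use BV_cubeD(1)[OF u] in auto)
  have 2: "(\<lambda>n. LINT x|lborel. \<bar>f n x\<bar> ^ ?d) \<longlonglongrightarrow> (LINT x|lborel. \<bar>indicator ?Q x * g x\<bar> ^ ?d)"
  proof (rule integral_dominated_convergence[where w = "\<lambda>x. B ^ ?d * indicator ?Q x"])
    show "AE x in lborel. (\<lambda>n. \<bar>f n x\<bar> ^ ?d) \<longlonglongrightarrow> \<bar>indicator ?Q x * g x\<bar> ^ ?d"
      using flim by eventually_elim (intro tendsto_intros)
    show "AE x in lborel. norm (\<bar>f n x\<bar> ^ ?d) \<le> B ^ ?d * indicator ?Q x" for n
      using fB f0 by (intro AE_I2) (auto simp: indicator_def power_mono power_0_left)
    show "integrable lborel (\<lambda>x. B ^ ?d * indicator ?Q x)"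
      by (intro integrable_mult_right integrable_real_indicator) (auto simp: emeasure_lborel_cbox_eq)
  qed auto
  have "\<bar>LINT x|lborel. u x * (indicator ?Q x * g x)\<bar> ^ ?d \<le> (LINT x|lborel. \<bar>indicator ?Q x * g x\<bar> ^ ?d) * total_variation u ^ ?d"
  proof (rule LIMSEQ_le)
    show "(\<lambda>n. \<bar>LINT x|lborel. u x * f n x\<bar> ^ ?d) \<longlonglongrightarrow> \<bar>LINT x|lborel. u x * (indicator ?Q x * g x)\<bar> ^ ?d"
      by (intro tendsto_intros 1)
    show "(\<lambda>n. (LINT x|lborel. \<bar>f n x\<bar> ^ ?d) * total_variation u ^ ?d)
        \<longlonglongrightarrow> (LINT x|lborel. \<bar>indicator ?Q x * g x\<bar> ^ ?d) * total_variation u ^ ?d"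
      by (intro tendsto_intros 2)
    show "\<exists>N. \<forall>n\<ge>N. \<bar>LINT x|lborel. u x * f n x\<bar> ^ ?d \<le> (LINT x|lborel. \<bar>f n x\<bar> ^ ?d) * total_variation u ^ ?d"
      using sobolev_continuous[OF u fc f0] by blast
  qed
  moreover have "(LINT x|lborel. u x * (indicator ?Q x * g x)) = (LINT x:?Q|lborel. g x * u x)"
    by (simp add: set_lebesgue_integral_def mult_ac)
  moreover have "(LINT x|lborel. \<bar>indicator ?Q x * g x\<bar> ^ ?d) = (LINT x:?Q|lborel. \<bar>g x\<bar> ^ ?d)"
    unfolding set_lebesgue_integral_def
    by (intro Bochner_Integration.integral_cong) (auto simp: indicator_def power_0_left)
  ultimately show ?thesis by simp
qed

section \<open>Weak compactness of probability measures on a compact set\<close>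

lemma summable_ternary:
  fixes a :: "nat \<Rightarrow> real"
  assumes "\<And>q. \<bar>a q\<bar> \<le> 1"
  shows "summable (\<lambda>q. a q * (1/3) ^ Suc q)"
proof (rule summable_comparison_test'[where N = 0])
  show "summable (\<lambda>q. (1/3 :: real) ^ Suc q)"
    unfolding summable_Suc_iff by (rule summable_geometric) simp
  show "norm (a q * (1/3) ^ Suc q) \<le> (1/3) ^ Suc q" for q
    using assms[of q] by (simp add: abs_mult)
qed

lemma suminf_ternary_bound:
  fixes a :: "nat \<Rightarrow> real"
  assumes "\<And>q. \<bar>a q\<bar> \<le> 1"
  shows "\<bar>\<Sum>q. a q * (1/3) ^ Suc q\<bar> \<le> 1 / 2"
proof -
  have s: "summable (\<lambda>q. \<bar>a q\<bar> * (1/3) ^ Suc q)" using assms by (intro summable_ternary) simp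
  have "\<bar>\<Sum>q. a q * (1/3) ^ Suc q\<bar> \<le> (\<Sum>q. \<bar>a q * (1/3) ^ Suc q\<bar>)"
    using s by (intro summable_rabs) (simp add: abs_mult)
  also have "\<dots> = (\<Sum>q. \<bar>a q\<bar> * (1/3) ^ Suc q)" by (simp add: abs_mult)
  also have "\<dots> \<le> (\<Sum>q. 1 * (1/3 :: real) ^ Suc q)"
  proof (rule suminf_le)
    show "\<bar>a q\<bar> * (1/3) ^ Suc q \<le> 1 * (1/3) ^ Suc q" for q
      using assms[of q] by (intro mult_right_mono) auto
    show "summable (\<lambda>q. 1 * (1/3 :: real) ^ Suc q)" by (rule summable_ternary) simp
  qed (rule s)
  also have "\<dots> = (\<Sum>q. (1/3 :: real) * (1/3) ^ q)" by simp
  also have "\<dots> = 1/3 * (1 / (1 - 1/3))"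
    by (subst suminf_mult) (auto simp: suminf_geometric summable_geometric)
  finally show ?thesis by simp
qed

text \<open>In base \<open>3\<close>, with digits \<open>0\<close> and \<open>1\<close> only, the tail after the first differing digit can cancel at most half of
that digit.  So close numbers have long common initial strings of digits.\<close>
lemma ternary_separation:
  fixes a :: "nat \<Rightarrow> real"
  assumes a: "\<And>q. \<bar>a q\<bar> \<le> 1" and p: "\<bar>a p\<bar> = 1" "\<And>q. q < p \<Longrightarrow> a q = 0"
  shows "(1/3) ^ Suc p / 2 \<le> \<bar>\<Sum>q. a q * (1/3) ^ Suc q\<bar>"
proof -
  have "(\<Sum>q. a q * (1/3) ^ Suc q) = (\<Sum>q. a (q + Suc p) * (1/3) ^ Suc (q + Suc p)) + (\<Sum>q<Suc p. a q * (1/3) ^ Suc q)"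
    by (rule suminf_split_initial_segment[OF summable_ternary[OF a]])
  also have "(\<Sum>q<Suc p. a q * (1/3) ^ Suc q) = a p * (1/3) ^ Suc p"
    using p(2) by (simp add: sum.neutral)
  also have "(\<Sum>q. a (q + Suc p) * (1/3) ^ Suc (q + Suc p)) = (1/3) ^ Suc p * (\<Sum>q. a (q + Suc p) * (1/3) ^ Suc q)"
    unfolding suminf_mult[OF summable_ternary[OF a], symmetric] by (simp add: power_add mult_ac)
  finally have eq: "(\<Sum>q. a q * (1/3) ^ Suc q) = (1/3) ^ Suc p * ((\<Sum>q. a (q + Suc p) * (1/3) ^ Suc q) + a p)"
    by (simp add: distrib_left mult.commute)
  have "\<bar>\<Sum>q. a (q + Suc p) * (1/3) ^ Suc q\<bar> \<le> 1 / 2" by (rule suminf_ternary_bound[OF a])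
  then have "1 / 2 \<le> \<bar>(\<Sum>q. a (q + Suc p) * (1/3) ^ Suc q) + a p\<bar>" using p(1) by linarith
  then have "(1/3) ^ Suc p * (1/2) \<le> (1/3) ^ Suc p * \<bar>(\<Sum>q. a (q + Suc p) * (1/3) ^ Suc q) + a p\<bar>"
    by (intro mult_left_mono) auto
  then show ?thesis unfolding eq by (simp add: abs_mult)
qed

text \<open>A compact set is parametrised by a continuous curve \<open>c\<close> that has a Borel right inverse \<open>h\<close>.  The code \<open>h x\<close>
lists as ternary digits whether \<open>x\<close> lies in each of the half-spaces with rational boundary orthogonal to
a coordinate axis.  Finitely many of these half-spaces determine a point of \<open>K\<close> up to \<open>\<epsilon>\<close>, so the inverse of \<open>h\<close> is
uniformly continuous on \<open>h ` K\<close>; it extends to the closure and then, by Tietze's theorem, to the line.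
Weak convergence asks for continuity of \<open>c\<close> alone; \<open>h\<close> jumps at the boundaries of the half-spaces.\<close>
lemma compact_borel_coding:
  fixes K :: "(real^'n::finite) set"
  assumes K: "compact K"
  obtains h :: "real^'n \<Rightarrow> real" and c :: "real \<Rightarrow> real^'n"
  where "h \<in> borel_measurable borel" "\<And>x. \<bar>h x\<bar> \<le> 1/2" "continuous_on UNIV c" "\<And>x. x \<in> K \<Longrightarrow> c (h x) = x"
proof -
  define S :: "('n \<times> real) set" where "S = UNIV \<times> \<rat>"
  have S: "countable S" unfolding S_def by (intro countable_SIGMA countable_finite countable_rat) auto
  define e where "e = from_nat_into S"
  define dig where "dig x p = (if x $ fst (e p) < snd (e p) then 1 else 0 :: real)" for x :: "real^'n" and p
  have dig1: "\<bar>dig x p\<bar> \<le> 1" "\<bar>dig x p - dig y p\<bar> \<le> 1" for x y p by (auto simp: dig_def)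
  define h where "h x = (\<Sum>p. dig x p * (1/3) ^ Suc p)" for x
  have h: "h \<in> borel_measurable borel"
    unfolding h_def[abs_def] dig_def by measurable
  have hb: "\<bar>h x\<bar> \<le> 1/2" for x
    unfolding h_def by (rule suminf_ternary_bound[OF dig1(1)])
  have sep: "dig x p = dig y p" if close: "\<bar>h x - h y\<bar> < (1/3) ^ m / 2" and pm: "p < m" for x y p m
  proof (rule ccontr)
    assume ne: "dig x p \<noteq> dig y p"
    define p0 where "p0 = (LEAST p. dig x p \<noteq> dig y p)"
    have p0: "dig x p0 \<noteq> dig y p0" unfolding p0_def by (rule LeastI[of "\<lambda>p. dig x p \<noteq> dig y p"]) (rule ne)
    have lt: "dig x q = dig y q" if "q < p0" for q using not_less_Least that unfolding p0_def by blast
    have "p0 \<le> p" unfolding p0_def by (rule Least_le) (rule ne)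
    then have p0m: "Suc p0 \<le> m" using pm by simp
    have "h x - h y = (\<Sum>q. dig x q * (1/3) ^ Suc q - dig y q * (1/3) ^ Suc q)"
      unfolding h_def by (rule suminf_diff[OF summable_ternary summable_ternary]) (rule dig1)+
    then have hd: "h x - h y = (\<Sum>q. (dig x q - dig y q) * (1/3) ^ Suc q)"
      by (simp only: left_diff_distrib)
    have "(1/3) ^ Suc p0 / 2 \<le> \<bar>h x - h y\<bar>"
      unfolding hd by (rule ternary_separation) (use p0 lt dig1(2) in \<open>auto simp: dig_def split: if_splits\<close>)
    moreover have "(1/3 :: real) ^ m \<le> (1/3) ^ Suc p0" using p0m by (intro power_decreasing) auto
    ultimately show False using close by simp
  qed
  have unif: "\<exists>d>0. \<forall>x\<in>K. \<forall>y\<in>K. \<bar>h x - h y\<bar> < d \<longrightarrow> dist x y < \<epsilon>" if \<epsilon>: "0 < \<epsilon>" for \<epsilon>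
  proof -
    obtain B0 where B0: "\<forall>x\<in>K. norm x \<le> B0" using compact_imp_bounded[OF K] by (auto simp: bounded_iff)
    obtain B :: nat where B: "B0 \<le> real B" using real_arch_simple by blast
    obtain N :: nat where N: "real CARD('n) / \<epsilon> < real N" using reals_Archimedean2 by blast
    have N0: "0 < real N" using N \<epsilon> by (meson divide_nonneg_pos of_nat_0_le_iff order_le_less_trans)
    \<comment> \<open>A grid of half-spaces of mesh \<open>1 / N\<close> that covers the range of all coordinates of points of \<open>K\<close>.\<close>
    define F where "F = (\<lambda>(i, k). (i :: 'n, real_of_int k / real N)) ` (UNIV \<times> {- int B * int N .. int B * int N})"
    have F: "finite F" "F \<subseteq> S" by (auto simp: F_def S_def)
    define m where "m = Suc (Max (insert 0 (to_nat_on S ` F)))"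
    have agree: "x $ i < q \<longleftrightarrow> y $ i < q" if "\<bar>h x - h y\<bar> < (1/3) ^ m / 2" "(i, q) \<in> F" for x y i q
    proof -
      let ?p = "to_nat_on S (i, q)"
      have "?p < m" unfolding m_def using F that(2) by (auto simp: less_Suc_eq_le intro!: Max_ge)
      then have "dig x ?p = dig y ?p" by (rule sep[OF that(1)])
      moreover have "e ?p = (i, q)" unfolding e_def using from_nat_into_to_nat_on[OF S] F that(2) by blast
      ultimately show ?thesis by (auto simp: dig_def split: if_splits)
    qed
    have close: "y $ i - x $ i \<le> 1 / real N"
      if xy: "x \<in> K" "y \<in> K" "\<bar>h x - h y\<bar> < (1/3) ^ m / 2" for x y i
    proof (rule ccontr)
      assume "\<not> ?thesis"
      then have gap: "x $ i < y $ i - 1 / real N" by simp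
      \<comment> \<open>The last grid value up to \<open>y $ i\<close> separates \<open>x $ i\<close> from \<open>y $ i\<close>.\<close>
      define k where "k = \<lfloor>real N * y $ i\<rfloor>"
      have k1: "real_of_int k \<le> real N * y $ i" "real N * y $ i < real_of_int k + 1" by (simp_all add: k_def)
      have "\<bar>y $ i\<bar> \<le> real B" using component_le_norm_cart[of y i] B0 xy(2) B by force
      then have yB: "- real B \<le> y $ i" "y $ i \<le> real B" by (auto simp: abs_le_iff)
      have "real N * (- real B) \<le> real N * y $ i" "real N * y $ i \<le> real N * real B"
        using yB by (intro mult_left_mono; simp)+
      then have "- (int B * int N) \<le> k" "k \<le> int B * int N"
        unfolding k_def by (auto simp: le_floor_iff floor_le_iff mult.commute)
      then have "(i, real_of_int k / real N) \<in> F" by (force simp: F_def)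
      from agree[OF xy(3) this] have iff: "x $ i < real_of_int k / real N \<longleftrightarrow> y $ i < real_of_int k / real N" .
      have "(real N * y $ i - 1) / real N < real_of_int k / real N"
        using k1 N0 by (intro divide_strict_right_mono) auto
      then have "y $ i - 1 / real N < real_of_int k / real N"
        using N0 by (simp add: diff_divide_distrib)
      moreover have "\<not> y $ i < real_of_int k / real N"
        using k1 N0 by (simp add: not_less pos_divide_le_eq mult.commute)
      ultimately show False using gap iff by linarith
    qed
    have "dist x y < \<epsilon>" if xy: "x \<in> K" "y \<in> K" "\<bar>h x - h y\<bar> < (1/3) ^ m / 2" for x y
    proof -
      have "\<bar>(x - y) $ i\<bar> \<le> 1 / real N" for i
        using close[OF xy, of i] close[of y x i] xy by (simp add: abs_minus_commute abs_le_iff)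
      then have "(\<Sum>i\<in>UNIV. \<bar>(x - y) $ i\<bar>) \<le> (\<Sum>i\<in>(UNIV::'n set). 1 / real N)" by (intro sum_mono) auto
      also have "\<dots> < \<epsilon>" using N N0 \<epsilon> by (simp add: field_simps)
      finally show ?thesis unfolding dist_norm using norm_le_l1_cart[of "x - y"] by linarith
    qed
    then show ?thesis by (intro exI[of _ "(1/3) ^ m / 2"]) auto
  qed
  have inj: "inj_on h K"
  proof (rule inj_onI, rule ccontr)
    fix x y assume xy: "x \<in> K" "y \<in> K" "h x = h y" "x \<noteq> y"
    then obtain d where "d > 0" "\<forall>x'\<in>K. \<forall>y'\<in>K. \<bar>h x' - h y'\<bar> < d \<longrightarrow> dist x' y' < dist x y"
      using unif[of "dist x y"] by auto
    then show False using xy by force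
  qed
  have "uniformly_continuous_on (h ` K) (inv_into K h)"
    unfolding uniformly_continuous_on_def
  proof (intro allI impI)
    fix \<epsilon> :: real assume "0 < \<epsilon>"
    then obtain d where "d > 0" "\<forall>x\<in>K. \<forall>y\<in>K. \<bar>h x - h y\<bar> < d \<longrightarrow> dist x y < \<epsilon>" using unif by blast
    then show "\<exists>d>0. \<forall>x\<in>h ` K. \<forall>x'\<in>h ` K. dist x' x < d \<longrightarrow> dist (inv_into K h x') (inv_into K h x) < \<epsilon>"
      using inj by (intro exI[of _ d]) (auto simp: dist_real_def)
  qed
  then obtain c0 where c0: "uniformly_continuous_on (closure (h ` K)) c0" "\<And>t. t \<in> h ` K \<Longrightarrow> inv_into K h t = c0 t"
    by (rule uniformly_continuous_on_extension_on_closure) blast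
  then have "continuous_on (closure (h ` K)) c0" by (intro uniformly_continuous_imp_continuous)
  then obtain c where c: "continuous_on UNIV c" "\<And>t. t \<in> closure (h ` K) \<Longrightarrow> c t = c0 t"
    using Tietze_unbounded[of "closure (h ` K)" c0 UNIV] by auto
  have "c (h x) = x" if "x \<in> K" for x
    using that c(2)[of "h x"] c0(2)[of "h x"] inj closure_subset[of "h ` K"] by auto
  then show ?thesis using that h hb c(1) by blast
qed

text \<open>The measures are moved to the line by the Borel code \<open>h\<close>, where Helly's theorem provides a weakly
convergent subsequence, and its limit is moved back by the continuous curve \<open>c\<close>.  Since \<open>c (h x) = x\<close> on \<open>K\<close>,
integrals of \<open>\<phi>\<close> are integrals of the continuous function \<open>\<phi> \<circ> c\<close> on the line.\<close>
lemma prob_measures_weakly_compact: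
  fixes M :: "nat \<Rightarrow> (real^'n::finite) measure"
  assumes K: "compact K" and M: "\<And>k. prob_space (M k)" "\<And>k. sets (M k) = sets borel" "\<And>k. AE x in M k. x \<in> K"
  obtains r Q where "strict_mono (r :: nat \<Rightarrow> nat)" "prob_space Q" "sets Q = sets borel"
    "\<And>(\<phi> :: real^'n \<Rightarrow> real) B. continuous_on UNIV \<phi> \<Longrightarrow> (\<And>x. \<bar>\<phi> x\<bar> \<le> B) \<Longrightarrow> (\<lambda>k. LINT x|M (r k). \<phi> x) \<longlonglongrightarrow> (LINT x|Q. \<phi> x)"
proof -
  obtain h :: "real^'n \<Rightarrow> real" and c where h: "h \<in> borel_measurable borel" "\<And>x. \<bar>h x\<bar> \<le> 1/2"
    and c: "continuous_on UNIV c" "\<And>x. x \<in> K \<Longrightarrow> c (h x) = x"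
    using compact_borel_coding[OF K] by blast
  have c_meas: "c \<in> borel_measurable borel" using c(1) by (rule borel_measurable_continuous_onI)
  have hM: "h \<in> borel_measurable (M k)" for k using h(1) M(2) by (simp cong: measurable_cong_sets)
  define \<mu> where "\<mu> k = distr (M k) borel h" for k
  have rd: "real_distribution (\<mu> k)" for k
    unfolding \<mu>_def real_distribution_def real_distribution_axioms_def
    using prob_space.prob_space_distr[OF M(1) hM] by simp
  have "tight \<mu>"
    unfolding tight_def
  proof (intro conjI allI impI rd)
    fix \<epsilon> :: real assume "0 < \<epsilon>"
    have "measure (\<mu> k) {-1<..1} = 1" for k
    proof -
      have "h -` {-1<..1} \<inter> space (M k) = space (M k)"
        using h(2) by (auto simp: abs_le_iff) (smt (verit) h(2) abs_le_iff field_sum_of_halves)+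
      then show ?thesis
        unfolding \<mu>_def by (simp add: measure_distr[OF hM] prob_space.prob_space[OF M(1)])
    qed
    then show "\<exists>a b. a < b \<and> (\<forall>k. 1 - \<epsilon> < measure (\<mu> k) {a<..b})"
      using \<open>0 < \<epsilon>\<close> by (intro exI[of _ "-1"] exI[of _ 1]) auto
  qed
  then obtain r R where r: "strict_mono (r :: nat \<Rightarrow> nat)" and R: "real_distribution R" "weak_conv_m (\<mu> \<circ> id \<circ> r) R"
    using tight_imp_convergent_subsubsequence[of \<mu> id] by (auto simp: strict_mono_id)
  interpret R: real_distribution R by fact
  have cR: "c \<in> borel_measurable R" using c_meas by simp
  show ?thesis
  proof (rule that[OF r, of "distr R borel c"])
    show "prob_space (distr R borel c)" by (rule R.prob_space_distr[OF cR])
    fix \<phi> :: "real^'n \<Rightarrow> real" and B assume \<phi>: "continuous_on UNIV \<phi>" and B: "\<And>x. \<bar>\<phi> x\<bar> \<le> B"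
    have \<phi>m: "\<phi> \<in> borel_measurable borel" using \<phi> by (rule borel_measurable_continuous_onI)
    have cont: "isCont (\<lambda>t. \<phi> (c t)) t" for t
      using continuous_on_compose2[OF \<phi> c(1)] by (simp add: continuous_on_eq_continuous_at)
    have "(\<lambda>k. LINT t|(\<mu> \<circ> id \<circ> r) k. \<phi> (c t)) \<longlonglongrightarrow> (LINT t|R. \<phi> (c t))"
      by (rule weak_conv_imp_integral_bdd_continuous_conv[OF _ R cont]) (use rd B in auto)
    moreover have "(LINT t|(\<mu> \<circ> id \<circ> r) k. \<phi> (c t)) = (LINT x|M (r k). \<phi> x)" for k
    proof -
      have "(LINT t|\<mu> (r k). \<phi> (c t)) = (LINT x|M (r k). \<phi> (c (h x)))"
        unfolding \<mu>_def by (rule integral_distr[OF hM measurable_compose[OF c_meas \<phi>m]])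
      also have "\<dots> = (LINT x|M (r k). \<phi> x)"
      proof (rule integral_cong_AE)
        show "AE x in M (r k). \<phi> (c (h x)) = \<phi> x" using M(3)[of "r k"] by eventually_elim (simp add: c(2))
      qed (use \<phi>m c_meas h(1) M(2) in \<open>simp_all cong: measurable_cong_sets\<close>)
      finally show ?thesis by simp
    qed
    moreover have "(LINT t|R. \<phi> (c t)) = (LINT x|distr R borel c. \<phi> x)"
      by (rule integral_distr[symmetric, OF cR \<phi>m])
    ultimately show "(\<lambda>k. LINT x|M (r k). \<phi> x) \<longlonglongrightarrow> (LINT x|distr R borel c. \<phi> x)" by simp
  qed simp
qed

section \<open>Functions whose mollified derivatives are bounded in \<open>L\<^sup>1\<close>\<close>

lemma prob_space_lborel_density:
  fixes f :: "'a::euclidean_space \<Rightarrow> real"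
  assumes f: "integrable lborel f" "\<And>x. 0 \<le> f x" "(LINT x|lborel. f x) = 1"
  shows "prob_space (density lborel f)"
proof (rule prob_spaceI)
  have "emeasure (density lborel f) (space (density lborel f)) = (\<integral>\<^sup>+x. ennreal (f x) \<partial>lborel)"
    using f by (subst emeasure_density) auto
  also have "\<dots> = 1" using f by (subst nn_integral_eq_integral) auto
  finally show "emeasure (density lborel f) (space (density lborel f)) = 1" .
qed

lemma integral_moll_deriv_eq_0:
  fixes u :: "real^'n::finite \<Rightarrow> real"
  assumes u: "integrable lborel u"
  shows "(LINT x|lborel. moll_deriv u i k x) = 0"
proof -
  let ?m = "mollifier k :: real^'n \<Rightarrow> real"
  obtain S where S: "compact S" "\<And>x. x \<notin> S \<Longrightarrow> ?m x = 0"
    using test_function_support[OF mollifier_test] by blast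
  have "(LINT x|lborel. partial_deriv i ?m x) = 0"
    by (rule integral_partial_deriv_eq_0[OF test_function_differentiable[OF mollifier_test]
          test_function_props(2)[OF mollifier_test] S])
  then have "adj_deriv (\<lambda>_. 1) i k y = 0" for y
    by (simp add: adj_deriv_def lborel_integral_shift[of "partial_deriv i ?m"])
  then show ?thesis
    using moll_deriv_dual(1)[OF u, of "\<lambda>_. 1" 1 i k] by simp
qed

text \<open>The positive and negative parts of the mollified derivatives are densities of measures of mass at
most \<open>C\<close> on a fixed cube, so along a subsequence they converge weakly to measures \<open>P\<close> and \<open>N\<close>.  Against a
test function \<open>\<phi>\<close>, Fubini's theorem and integration by parts turn them into the pairing of \<open>u\<close> with mollified
derivatives of \<open>\<phi>\<close>, which converge; so \<open>P - N\<close> is the \<open>i\<close>-th derivative of \<open>u\<close>.\<close>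
lemma mollified_derivatives_converge:
  fixes u :: "real^'n::finite \<Rightarrow> real"
  assumes u: "integrable lborel u" and u0: "AE x in lborel. x \<notin> cbox 0 1 \<longrightarrow> u x = 0"
    and C: "0 < C" and bound: "\<And>k. (LINT x|lborel. \<bar>moll_deriv u i k x\<bar>) \<le> C"
  obtains P N where "finite_measure P" "finite_measure N" "sets P = sets borel" "sets N = sets borel"
    "emeasure P UNIV \<le> ennreal C" "emeasure N UNIV \<le> ennreal C"
    "\<And>\<phi>. \<phi> \<in> test_functions \<Longrightarrow>
      (LINT x|lborel. u x * partial_deriv i \<phi> x) = - ((LINT x|P. \<phi> x) - (LINT x|N. \<phi> x))"
proof -
  have [measurable]: "u \<in> borel_measurable borel" using u by auto
  let ?K = "cbox (\<chi> j. - 1) (\<chi> j. 2) :: (real^'n) set" and ?Q = "cbox 0 1 :: (real^'n) set"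
  define v where "v k = moll_deriv u i k" for k
  have [measurable]: "v k \<in> borel_measurable borel" for k unfolding v_def by measurable
  have iv: "integrable lborel (v k)" for k
    using moll_deriv_dual(2)[OF u, of "\<lambda>_. 1" 1 i k] by (simp add: v_def)
  have v0: "v k x = 0" if "x \<notin> ?K" for k x unfolding v_def by (rule moll_deriv_eq_0[OF u0 that])
  define a where "a k = (LINT x|lborel. max (v k x) 0)" for k
  have ap: "(LINT x|lborel. max (- v k x) 0) = a k" for k
  proof -
    have "(LINT x|lborel. max (v k x) 0) - (LINT x|lborel. max (- v k x) 0)
        = (LINT x|lborel. max (v k x) 0 - max (- v k x) 0)" using iv[of k] by simp
    also have "\<dots> = (LINT x|lborel. v k x)"
      by (intro Bochner_Integration.integral_cong) auto
    also have "\<dots> = 0" unfolding v_def by (rule integral_moll_deriv_eq_0[OF u])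
    finally show ?thesis by (simp add: a_def)
  qed
  have aC: "a k \<le> C" for k
  proof -
    have "a k \<le> (LINT x|lborel. \<bar>v k x\<bar>)"
      unfolding a_def using iv[of k] by (intro integral_mono) auto
    then show ?thesis using bound[of k] by (simp add: v_def)
  qed
  \<comment> \<open>For \<open>b = 1\<close> and \<open>b = -1\<close> these are probability densities.  Both parts of \<open>v k\<close> have the same mass \<open>a k\<close>, because
    \<open>v k\<close> has integral \<open>0\<close>; so both are filled up to mass \<open>C\<close> by the same multiple of the uniform density on the
    unit cube, which cancels in the difference.\<close>
  define f where "f b k x = (max (b * v k x) 0 + (C - a k) * indicator ?Q x) / C" for b k x
  have iQ: "integrable lborel (indicator ?Q :: _ \<Rightarrow> real)"
    by (intro integrable_real_indicator) (auto simp: emeasure_lborel_cbox_eq)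
  have "0 \<in> ?Q" by (simp add: mem_box_cart del: cbox_interval)
  then have "?Q \<noteq> {}" by blast
  then have "measure lborel ?Q = (\<Prod>j\<in>UNIV. (1 :: real^'n) $ j - 0 $ j)" by (rule content_cbox_cart)
  then have mQ: "measure lborel ?Q = 1" by (simp del: cbox_interval)
  have f: "integrable lborel (f b k)" "\<And>x. 0 \<le> f b k x" "(LINT x|lborel. f b k x) = 1"
    if "b = 1 \<or> b = -1" for b k
  proof -
    have im: "integrable lborel (\<lambda>x. max (b * v k x) 0)" using iv[of k] by auto
    show "integrable lborel (f b k)" unfolding f_def
      using im iQ by (intro integrable_divide_zero) auto
    show "0 \<le> f b k x" for x unfolding f_def using aC[of k] C by (auto simp: indicator_def)
    have "(LINT x|lborel. max (b * v k x) 0) = a k" using that ap[of k] by (auto simp: a_def)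
    then show "(LINT x|lborel. f b k x) = 1" unfolding f_def using im iQ mQ C
      by (simp del: cbox_interval)
  qed
  have fm [measurable]: "f b k \<in> borel_measurable borel" for b k unfolding f_def by measurable
  define M where "M b k = density lborel (\<lambda>x. ennreal (f b k x))" for b k
  have M: "prob_space (M b k)" "sets (M b k) = sets borel" "AE x in M b k. x \<in> ?K" if "b = 1 \<or> b = -1" for b k
  proof -
    show "prob_space (M b k)" unfolding M_def by (rule prob_space_lborel_density[OF f[OF that]])
    show "sets (M b k) = sets borel" by (simp add: M_def)
    have "?Q \<subseteq> ?K"
    proof
      fix x assume "x \<in> ?Q"
      then have "0 \<le> x $ j" "x $ j \<le> 1" for j by (simp_all add: mem_box_cart del: cbox_interval)
      then have "- 1 \<le> x $ j \<and> x $ j \<le> 2" for j by (meson neg_le_0_iff_le one_le_numeral order_trans zero_le_one)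
      then show "x \<in> ?K" by (simp add: mem_box_cart del: cbox_interval)
    qed
    then have "f b k x = 0" if "x \<notin> ?K" for x
    proof -
      have "x \<notin> ?Q" using \<open>?Q \<subseteq> ?K\<close> that by blast
      then show ?thesis using v0[OF that, of k] by (simp add: f_def del: cbox_interval)
    qed
    then have "0 < f b k x \<longrightarrow> x \<in> ?K" for x by force
    then show "AE x in M b k. x \<in> ?K" unfolding M_def by (subst AE_density) auto
  qed
  obtain r1 Q1 where r1: "strict_mono (r1 :: nat \<Rightarrow> nat)" and Q1: "prob_space Q1" "sets Q1 = sets borel"
    and lim1: "\<And>(\<phi> :: real^'n \<Rightarrow> real) B. continuous_on UNIV \<phi> \<Longrightarrow> (\<And>x. \<bar>\<phi> x\<bar> \<le> B) \<Longrightarrow>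
      (\<lambda>k. LINT x|M 1 (r1 k). \<phi> x) \<longlonglongrightarrow> (LINT x|Q1. \<phi> x)"
    by (rule prob_measures_weakly_compact[of ?K "M 1"]) (use M in auto)
  obtain r2 Q2 where r2: "strict_mono (r2 :: nat \<Rightarrow> nat)" and Q2: "prob_space Q2" "sets Q2 = sets borel"
    and lim2: "\<And>(\<phi> :: real^'n \<Rightarrow> real) B. continuous_on UNIV \<phi> \<Longrightarrow> (\<And>x. \<bar>\<phi> x\<bar> \<le> B) \<Longrightarrow>
      (\<lambda>k. LINT x|M (-1) (r1 (r2 k)). \<phi> x) \<longlonglongrightarrow> (LINT x|Q2. \<phi> x)"
    by (rule prob_measures_weakly_compact[of ?K "\<lambda>k. M (-1) (r1 k)"]) (use M in auto)
  define P where "P Q = density Q (\<lambda>_ :: real^'n. ennreal C)" for Q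
  have Pem: "emeasure (P Q) UNIV = ennreal C" "finite_measure (P Q)" "sets (P Q) = sets borel"
    "\<And>\<phi>. \<phi> \<in> test_functions \<Longrightarrow> (LINT x|P Q. \<phi> x) = C * (LINT x|Q. \<phi> x)"
    if Q: "prob_space Q" "sets Q = sets borel" for Q
  proof -
    have sp: "space Q = UNIV" using sets_eq_imp_space_eq[OF Q(2)] by simp
    show em: "emeasure (P Q) UNIV = ennreal C"
      using prob_space.emeasure_space_1[OF Q(1)] Q(2) by (simp add: P_def emeasure_density_const sp)
    show "finite_measure (P Q)" by (rule finite_measureI) (simp add: P_def sp em[unfolded P_def])
    show "sets (P Q) = sets borel" by (simp add: P_def Q)
    show "(LINT x|P Q. \<phi> x) = C * (LINT x|Q. \<phi> x)" if "\<phi> \<in> test_functions" for \<phi>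
    proof -
      have "\<phi> \<in> borel_measurable Q"
        using test_function_measurable(1)[OF that] Q(2) by (simp cong: measurable_cong_sets)
      then show ?thesis unfolding P_def using C by (simp add: integral_density)
    qed
  qed
  show ?thesis
  proof (rule that[of "P Q1" "P Q2"])
    fix \<phi> :: "real^'n \<Rightarrow> real" assume \<phi>: "\<phi> \<in> test_functions"
    note \<phi>c = test_function_props(1)[OF \<phi>]
    note d\<phi>c = test_function_props(2)[OF \<phi>, of i]
    obtain B where B: "\<And>x. \<bar>\<phi> x\<bar> \<le> B" using test_function_props(3)[OF \<phi>] by blast
    obtain B' where B': "\<And>x. \<bar>partial_deriv i \<phi> x\<bar> \<le> B'" using test_function_props(4)[OF \<phi>, of i] by blast
    have [measurable]: "\<phi> \<in> borel_measurable borel" by (rule test_function_measurable[OF \<phi>])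
    have diff: "C * (LINT x|M 1 k. \<phi> x) - C * (LINT x|M (-1) k. \<phi> x) = (LINT x|lborel. \<phi> x * v k x)" for k
    proof -
      have L: "(LINT x|M b k. \<phi> x) = (LINT x|lborel. \<phi> x * f b k x)" "integrable lborel (\<lambda>x. \<phi> x * f b k x)"
        if "b = 1 \<or> b = -1" for b
      proof -
        show "(LINT x|M b k. \<phi> x) = (LINT x|lborel. \<phi> x * f b k x)"
          unfolding M_def using f(2)[OF that] by (subst integral_density) (auto simp: mult.commute)
        show "integrable lborel (\<lambda>x. \<phi> x * f b k x)"
          by (rule integral_mult_le_bound(1)[OF B f(1)[OF that]]) auto
      qed
      have "C * (LINT x|M 1 k. \<phi> x) - C * (LINT x|M (-1) k. \<phi> x)
          = (LINT x|lborel. C * (\<phi> x * f 1 k x) - C * (\<phi> x * f (-1) k x))"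
        using L[of 1] L[of "-1"] by simp
      also have "\<dots> = (LINT x|lborel. \<phi> x * v k x)"
      proof (rule Bochner_Integration.integral_cong[OF refl])
        fix x
        have "C * f 1 k x - C * f (-1) k x = v k x" using C by (simp add: f_def max_def)
        then show "C * (\<phi> x * f 1 k x) - C * (\<phi> x * f (-1) k x) = \<phi> x * v k x"
          by (simp only: mult.left_commute[of C] flip: right_diff_distrib)
      qed
      finally show ?thesis .
    qed
    have "(\<lambda>k. LINT y|lborel. u y * adj_moll (partial_deriv i \<phi>) k y) \<longlonglongrightarrow> (LINT y|lborel. u y * partial_deriv i \<phi> y)"
      by (rule adj_moll_tendsto[OF u d\<phi>c B'])
    moreover have "(LINT y|lborel. u y * adj_moll (partial_deriv i \<phi>) k y) = - (LINT x|lborel. \<phi> x * v k x)" for k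
    proof -
      have "adj_deriv \<phi> i k y = - adj_moll (partial_deriv i \<phi>) k y" for y
        unfolding adj_deriv_def adj_moll_def by (rule integral_by_parts_mollifier[OF \<phi>])
      then show ?thesis
        using moll_deriv_dual(1)[OF u _ B, where i = i and k = k] by (simp add: v_def)
    qed
    ultimately have "(\<lambda>k. - (LINT x|lborel. \<phi> x * v k x)) \<longlonglongrightarrow> (LINT y|lborel. u y * partial_deriv i \<phi> y)"
      by simp
    from LIMSEQ_subseq_LIMSEQ[OF this strict_mono_o[OF r1 r2]]
    have l1: "(\<lambda>k. - (LINT x|lborel. \<phi> x * v (r1 (r2 k)) x)) \<longlonglongrightarrow> (LINT y|lborel. u y * partial_deriv i \<phi> y)"
      by (simp add: o_def)
    have "(\<lambda>k. LINT x|M 1 (r1 (r2 k)). \<phi> x) \<longlonglongrightarrow> (LINT x|Q1. \<phi> x)"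
      using LIMSEQ_subseq_LIMSEQ[OF lim1[OF \<phi>c B] r2] by (simp add: o_def)
    then have "(\<lambda>k. - (C * (LINT x|M 1 (r1 (r2 k)). \<phi> x) - C * (LINT x|M (-1) (r1 (r2 k)). \<phi> x)))
        \<longlonglongrightarrow> - (C * (LINT x|Q1. \<phi> x) - C * (LINT x|Q2. \<phi> x))"
      by (intro tendsto_intros lim2[OF \<phi>c B])
    then have "(\<lambda>k. - (LINT x|lborel. \<phi> x * v (r1 (r2 k)) x)) \<longlonglongrightarrow> - (C * (LINT x|Q1. \<phi> x) - C * (LINT x|Q2. \<phi> x))"
      unfolding diff .
    from LIMSEQ_unique[OF l1 this]
    show "(LINT x|lborel. u x * partial_deriv i \<phi> x) = - ((LINT x|P Q1. \<phi> x) - (LINT x|P Q2. \<phi> x))"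
      using Pem(4)[OF Q1 \<phi>] Pem(4)[OF Q2 \<phi>] by simp
  qed (use Pem[OF Q1] Pem[OF Q2] in auto)
qed

lemma variation_measure_le:
  fixes \<mu> :: "(real^'n::finite) set \<Rightarrow> real^'n"
  assumes P: "\<And>i. finite_measure (P i)" "\<And>i. sets (P i) = sets borel"
    and N: "\<And>i. finite_measure (N i)" "\<And>i. sets (N i) = sets borel"
    and \<mu>: "\<And>i E. \<mu> E $ i = measure (P i) E - measure (N i) E"
  shows "variation_measure \<mu> E \<le> (\<Sum>i\<in>UNIV. emeasure (P i) E + emeasure (N i) E)"
  unfolding variation_measure_def
proof (rule SUP_least, clarify)
  fix A :: "nat \<Rightarrow> (real^'n) set" assume A: "range A \<subseteq> sets borel" "disjoint_family A"
  have le: "ennreal (norm (\<mu> E)) \<le> (\<Sum>i\<in>UNIV. emeasure (P i) E + emeasure (N i) E)" for E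
  proof -
    have "norm (\<mu> E) \<le> (\<Sum>i\<in>UNIV. \<bar>\<mu> E $ i\<bar>)" by (rule norm_le_l1_cart)
    also have "\<dots> \<le> (\<Sum>i\<in>UNIV. measure (P i) E + measure (N i) E)"
      by (intro sum_mono) (auto simp: \<mu> abs_if)
    finally show ?thesis
      using P(1) N(1) by (simp add: finite_measure.emeasure_eq_measure ennreal_leI flip: ennreal_plus)
  qed
  have "(\<Sum>k. ennreal (norm (\<mu> (A k)))) \<le> (\<Sum>k. \<Sum>i\<in>UNIV. emeasure (P i) (A k) + emeasure (N i) (A k))"
    by (intro suminf_le le) auto
  also have "\<dots> = (\<Sum>i\<in>UNIV. \<Sum>k. emeasure (P i) (A k) + emeasure (N i) (A k))"
    by (rule suminf_sum) auto
  also have "\<dots> = (\<Sum>i\<in>UNIV. emeasure (P i) (\<Union>k. A k) + emeasure (N i) (\<Union>k. A k))"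
    using A P N by (simp add: suminf_emeasure flip: suminf_add)
  finally show "(\<Sum>k. ennreal (norm (\<mu> (A k)))) \<le> (\<Sum>i\<in>UNIV. emeasure (P i) (\<Union>k. A k) + emeasure (N i) (\<Union>k. A k))" .
qed

text \<open>The variation is at most the total mass of the \<open>d\<close> pairs \<open>P i\<close>, \<open>N i\<close>, each measure having mass at most \<open>C\<close>.\<close>
lemma gradient_measure_of_bounded_mollifications:
  fixes u :: "real^'n::finite \<Rightarrow> real"
  assumes u: "integrable lborel u" and u0: "AE x in lborel. x \<notin> cbox 0 1 \<longrightarrow> u x = 0"
    and C: "0 < C" and bound: "\<And>i k. (LINT x|lborel. \<bar>moll_deriv u i k x\<bar>) \<le> C"
  shows "u \<in> BV_cube" "total_variation u \<le> 2 * real CARD('n) * C"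
proof -
  define good where "good i P N \<longleftrightarrow> finite_measure P \<and> finite_measure N \<and> sets P = sets borel \<and> sets N = sets borel
    \<and> emeasure P UNIV \<le> ennreal C \<and> emeasure N UNIV \<le> ennreal C \<and>
    (\<forall>\<phi>\<in>test_functions. (LINT x|lborel. u x * partial_deriv i \<phi> x) = - ((LINT x|P. \<phi> x) - (LINT x|N. \<phi> x)))"
    for i and P N :: "(real^'n) measure"
  have "\<exists>P N. good i P N" for i
    unfolding good_def by (rule mollified_derivatives_converge[OF u u0 C bound, of i]) blast
  then have "\<forall>i. \<exists>P N. good i P N" by blast
  then obtain P N where good: "\<And>i. good i (P i) (N i)"
    unfolding choice_iff by blast
  have PN: "\<And>i. finite_measure (P i)" "\<And>i. finite_measure (N i)" "\<And>i. sets (P i) = sets borel" "\<And>i. sets (N i) = sets borel"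
    and mass: "\<And>i. emeasure (P i) UNIV \<le> ennreal C" "\<And>i. emeasure (N i) UNIV \<le> ennreal C"
    and ibp: "\<And>i \<phi>. \<phi> \<in> test_functions \<Longrightarrow>
      (LINT x|lborel. u x * partial_deriv i \<phi> x) = - ((LINT x|P i. \<phi> x) - (LINT x|N i. \<phi> x))"
    using good unfolding good_def by blast+
  define \<mu> where "\<mu> E = (\<chi> i. measure (P i) E - measure (N i) E)" for E
  have \<mu>: "\<mu> E $ i = measure (P i) E - measure (N i) E" for E i by (simp add: \<mu>_def)
  have grad: "is_gradient_measure u \<mu>"
    unfolding is_gradient_measure_def
  proof
    fix i
    show "\<exists>P N. finite_measure P \<and> finite_measure N \<and> sets P = sets borel \<and> sets N = sets borel \<and>
      (\<forall>E. \<mu> E $ i = measure P E - measure N E) \<and>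
      (\<forall>\<phi>\<in>test_functions. (LINT x|lborel. u x * partial_deriv i \<phi> x) = - ((LINT x|P. \<phi> x) - (LINT x|N. \<phi> x)))"
      using PN \<mu> ibp by (intro exI[of _ "P i"] exI[of _ "N i"]) simp
  qed
  show "u \<in> BV_cube" by (rule BV_cubeI[OF u grad u0])
  have "variation_measure \<mu> UNIV \<le> (\<Sum>i\<in>UNIV. emeasure (P i) UNIV + emeasure (N i) UNIV)"
    by (rule variation_measure_le[OF PN(1,3,2,4) \<mu>])
  also have "\<dots> \<le> (\<Sum>i\<in>(UNIV::'n set). ennreal C + ennreal C)"
    by (intro sum_mono add_mono mass)
  also have "\<dots> = ennreal (2 * real CARD('n) * C)"
    using C by (simp add: ennreal_of_nat_eq_real_of_nat flip: ennreal_plus ennreal_mult)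
  finally have "enn2real (variation_measure \<mu> UNIV) \<le> 2 * real CARD('n) * C"
    using C by (intro enn2real_leI) auto
  then show "total_variation u \<le> 2 * real CARD('n) * C"
    by (simp add: total_variation_def gradient_measure_eqI[OF grad])
qed

section \<open>The Radon-Nikodym theorem for real charges\<close>

text \<open>Bounded signed measures, as plain set functions.\<close>
locale real_charge =
  fixes M :: "'a measure" and \<nu> :: "'a set \<Rightarrow> real" and L :: real
  assumes sums: "\<And>A. range A \<subseteq> sets M \<Longrightarrow> disjoint_family A \<Longrightarrow> (\<lambda>k. \<nu> (A k)) sums \<nu> (\<Union>k::nat. A k)"
    and add: "\<And>A B. A \<in> sets M \<Longrightarrow> B \<in> sets M \<Longrightarrow> A \<inter> B = {} \<Longrightarrow> \<nu> (A \<union> B) = \<nu> A + \<nu> B"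
    and bound: "\<And>A. A \<in> sets M \<Longrightarrow> \<bar>\<nu> A\<bar> \<le> L"
begin

text \<open>The positive variation of \<open>\<nu>\<close>.\<close>
definition upper :: "'a set \<Rightarrow> real"
  where "upper A = (SUP B\<in>{B\<in>sets M. B \<subseteq> A}. \<nu> B)"

lemma empty: "\<nu> {} = 0"
  using add[of "{}" "{}"] by simp

lemma bdd: "bdd_above (\<nu> ` {B\<in>sets M. B \<subseteq> A})"
  using bound by (intro bdd_aboveI[of _ L]) (auto simp: abs_le_iff)

lemma le_upper: "B \<in> sets M \<Longrightarrow> B \<subseteq> A \<Longrightarrow> \<nu> B \<le> upper A"
  unfolding upper_def by (rule cSUP_upper[OF _ bdd]) auto

lemma upper_le: "(\<And>B. B \<in> sets M \<Longrightarrow> B \<subseteq> A \<Longrightarrow> \<nu> B \<le> c) \<Longrightarrow> upper A \<le> c"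
  unfolding upper_def by (rule cSUP_least) auto

lemma upper_nonneg: "0 \<le> upper A"
  using le_upper[of "{}" A] empty by simp

lemma upper_mono: "A \<subseteq> B \<Longrightarrow> upper A \<le> upper B"
  by (intro upper_le le_upper) auto

lemma upper_superadd:
  assumes "A \<inter> B = {}"
  shows "upper A + upper B \<le> upper (A \<union> B)"
proof -
  have "upper A \<le> upper (A \<union> B) - \<nu> D" if D: "D \<in> sets M" "D \<subseteq> B" for D
  proof (rule upper_le)
    fix C assume C: "C \<in> sets M" "C \<subseteq> A"
    have "\<nu> (C \<union> D) = \<nu> C + \<nu> D" by (rule add) (use C D assms in auto)
    moreover have "\<nu> (C \<union> D) \<le> upper (A \<union> B)" by (rule le_upper) (use C D in auto)
    ultimately show "\<nu> C \<le> upper (A \<union> B) - \<nu> D" by simp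
  qed
  then have "\<nu> D \<le> upper (A \<union> B) - upper A" if "D \<in> sets M" "D \<subseteq> B" for D
    using that by (metis le_diff_eq add.commute)
  then have "upper B \<le> upper (A \<union> B) - upper A" by (rule upper_le)
  then show ?thesis by linarith
qed

lemma upper_sum_le:
  assumes "disjoint_family A"
  shows "(\<Sum>k<n. upper (A k)) \<le> upper (\<Union>k<n::nat. A k)"
proof (induction n)
  case (Suc n)
  have "A n \<inter> (\<Union>k<n. A k) = {}" 
  proof (rule ccontr)
    assume "\<not> ?thesis"
    then obtain x k where "x \<in> A n" "k < n" "x \<in> A k" by blast
    then show False using disjoint_family_onD[OF assms, of n k] by auto
  qed
  then have "upper (A n) + upper (\<Union>k<n. A k) \<le> upper (A n \<union> (\<Union>k<n. A k))" by (rule upper_superadd)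
  moreover have "(\<Union>k<Suc n. A k) = A n \<union> (\<Union>k<n. A k)" by (auto simp: less_Suc_eq)
  ultimately show ?case using Suc by simp
qed (simp add: upper_nonneg)

lemma upper_sums:
  assumes A: "range A \<subseteq> sets M" "disjoint_family A"
  shows "(\<Sum>k. ennreal (upper (A k))) = ennreal (upper (\<Union>k. A k))"
proof -
  have le: "(\<Sum>k<n. upper (A k)) \<le> upper (\<Union>k. A k)" for n
    by (rule order_trans[OF upper_sum_le[OF A(2)] upper_mono]) blast
  have sm: "summable (\<lambda>k. upper (A k))"
    by (rule summableI_nonneg_bounded[OF upper_nonneg le])
  have "upper (\<Union>k. A k) \<le> (\<Sum>k. upper (A k))"
  proof (rule upper_le)
    fix B assume B: "B \<in> sets M" "B \<subseteq> (\<Union>k. A k)"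
    have "(\<lambda>k. \<nu> (B \<inter> A k)) sums \<nu> (\<Union>k. B \<inter> A k)"
      by (rule sums) (use A B in \<open>auto simp: disjoint_family_on_def\<close>)
    moreover have "(\<Union>k. B \<inter> A k) = B" using B by auto
    ultimately have s: "(\<lambda>k. \<nu> (B \<inter> A k)) sums \<nu> B" by simp
    show "\<nu> B \<le> (\<Sum>k. upper (A k))"
      by (rule sums_le[OF _ s summable_sums[OF sm]]) (use A B in \<open>auto intro!: le_upper\<close>)
  qed
  moreover have "(\<Sum>k. upper (A k)) \<le> upper (\<Union>k. A k)" by (rule suminf_le_const[OF sm le])
  ultimately have "(\<Sum>k. upper (A k)) = upper (\<Union>k. A k)" by linarith
  then show ?thesis by (rule subst[where P = "\<lambda>z. (\<Sum>k. ennreal (upper (A k))) = ennreal z"])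
      (rule suminf_ennreal2[OF upper_nonneg sm])
qed

definition upper_measure :: "'a measure"
  where "upper_measure = measure_of (space M) (sets M) (\<lambda>A. ennreal (upper A))"

lemma sets_upper_measure: "sets upper_measure = sets M"
  by (simp add: upper_measure_def)

lemma emeasure_upper_measure: "A \<in> sets M \<Longrightarrow> emeasure upper_measure A = ennreal (upper A)"
  unfolding upper_measure_def
proof (rule emeasure_measure_of_sigma)
  show "sigma_algebra (space M) (sets M)" by (rule sets.sigma_algebra_axioms)
  have "upper {} \<le> 0" by (rule upper_le) (simp add: empty)
  then show "positive (sets M) (\<lambda>A. ennreal (upper A))" by (simp add: positive_def ennreal_eq_0_iff)
  show "countably_additive (sets M) (\<lambda>A. ennreal (upper A))"
    by (rule countably_additiveI) (rule upper_sums)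
qed

lemma upper_density:
  assumes M: "sigma_finite_measure M" and null: "\<And>A. A \<in> null_sets M \<Longrightarrow> \<nu> A = 0"
  obtains f where "integrable M f" "\<And>A. A \<in> sets M \<Longrightarrow> upper A = (LINT x:A|M. f x)"
proof -
  interpret M: sigma_finite_measure M by fact
  let ?N = upper_measure
  have sp: "space ?N = space M" using sets_eq_imp_space_eq[OF sets_upper_measure] .
  have fin: "finite_measure ?N"
    by (rule finite_measureI) (simp add: sp emeasure_upper_measure)
  have ac: "absolutely_continuous M ?N"
  proof -
    have "A \<in> null_sets ?N" if A: "A \<in> null_sets M" for A
    proof -
      have "upper A \<le> 0"
      proof (rule upper_le)
        fix B assume "B \<in> sets M" "B \<subseteq> A"
        then have "B \<in> null_sets M" by (rule null_sets_subset[OF A])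
        then show "\<nu> B \<le> 0" by (simp only: null)
      qed
      then have "emeasure ?N A = 0"
        using A by (simp add: emeasure_upper_measure null_setsD2 ennreal_eq_0_iff)
      then show ?thesis using A by (intro null_setsI) (simp_all add: sets_upper_measure null_setsD2)
    qed
    then show ?thesis unfolding absolutely_continuous_def by blast
  qed
  obtain D where D: "D \<in> borel_measurable M" "AE x in M. RN_deriv M ?N x = ennreal (D x)" "\<And>x. 0 \<le> D x"
    using M.real_RN_deriv[OF fin ac sets_upper_measure] by blast
  have "density M (RN_deriv M ?N) = ?N" by (rule M.density_RN_deriv[OF ac sets_upper_measure])
  then have dens: "density M (\<lambda>x. ennreal (D x)) = ?N"
    using density_cong[of "RN_deriv M ?N" M "\<lambda>x. ennreal (D x)"] D by simp
  interpret N: finite_measure ?N by fact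
  have A: "integrable M (\<lambda>x. D x * indicator A x)" "upper A = (LINT x|M. D x * indicator A x)" if A: "A \<in> sets M" for A
  proof -
    have iN: "integrable ?N (indicator A :: _ \<Rightarrow> real)"
      using A by (intro integrable_real_indicator) (auto simp: sets_upper_measure less_top[symmetric])
    then show "integrable M (\<lambda>x. D x * indicator A x)"
      using D A unfolding dens[symmetric] by (subst (asm) integrable_real_density) auto
    have "upper A = measure ?N A"
      using A by (simp add: measure_def emeasure_upper_measure upper_nonneg)
    also have "\<dots> = (LINT x|?N. indicator A x)"
      using A sets.sets_into_space[OF A] by (simp add: sp Int_absorb2)
    also have "\<dots> = (LINT x|M. D x * indicator A x)"
      using D A unfolding dens[symmetric] by (subst integral_real_density) auto
    finally show "upper A = (LINT x|M. D x * indicator A x)" .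
  qed
  show ?thesis
  proof (rule that)
    have "integrable M (\<lambda>x. D x * indicator (space M) x)" by (rule A(1)[OF sets.top])
    moreover have "integrable M (\<lambda>x. D x * indicator (space M) x) \<longleftrightarrow> integrable M D"
      by (rule Bochner_Integration.integrable_cong) auto
    ultimately show "integrable M D" by blast
    show "upper A = (LINT x:A|M. D x)" if "A \<in> sets M" for A
      using A(2)[OF that] by (simp add: set_lebesgue_integral_def mult.commute)
  qed
qed

end

text \<open>Jordan's decomposition: passing from \<open>B\<close> to \<open>A - B\<close> exchanges the suprema of \<open>\<nu>\<close> and of \<open>-\<nu>\<close> over the measurable
subsets of \<open>A\<close>, up to the constant \<open>\<nu> A\<close>.  Each of the two variations has a density by the theorem for measures.\<close>
lemma signed_Radon_Nikodym:
  assumes M: "sigma_finite_measure M" and \<nu>: "real_charge M \<nu> L"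
    and null: "\<And>A. A \<in> null_sets M \<Longrightarrow> \<nu> A = 0"
  obtains f where "integrable M f" "\<And>A. A \<in> sets M \<Longrightarrow> \<nu> A = (LINT x:A|M. f x)"
proof -
  interpret p: real_charge M \<nu> L by fact
  interpret n: real_charge M "\<lambda>A. - \<nu> A" L
  proof
    show "(\<lambda>k. - \<nu> (A k)) sums - \<nu> (\<Union>k::nat. A k)" if "range A \<subseteq> sets M" "disjoint_family A" for A
      by (rule sums_minus[OF p.sums[OF that]])
    show "- \<nu> (A \<union> B) = - \<nu> A + - \<nu> B" if "A \<in> sets M" "B \<in> sets M" "A \<inter> B = {}" for A B
      using p.add[OF that] by simp
    show "\<bar>- \<nu> A\<bar> \<le> L" if "A \<in> sets M" for A
      using p.bound[OF that] by simp
  qed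
  obtain f where f: "integrable M f" "\<And>A. A \<in> sets M \<Longrightarrow> p.upper A = (LINT x:A|M. f x)"
    by (rule p.upper_density[OF M null]) blast+
  obtain g where g: "integrable M g" "\<And>A. A \<in> sets M \<Longrightarrow> n.upper A = (LINT x:A|M. g x)"
    by (rule n.upper_density[OF M]) (auto simp: null)
  have jordan: "\<nu> A = p.upper A - n.upper A" if A: "A \<in> sets M" for A
  proof -
    have split: "\<nu> A = \<nu> B + \<nu> (A - B)" if "B \<in> sets M" "B \<subseteq> A" for B
    proof -
      have "B \<union> (A - B) = A" "B \<inter> (A - B) = {}" using that by blast+
      then show ?thesis using p.add[of B "A - B"] that A by auto
    qed
    have "p.upper A \<le> \<nu> A + n.upper A"
    proof (rule p.upper_le)
      fix B assume B: "B \<in> sets M" "B \<subseteq> A"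
      have "- \<nu> (A - B) \<le> n.upper A" by (rule n.le_upper) (use A B in auto)
      then show "\<nu> B \<le> \<nu> A + n.upper A" using split[OF B] by linarith
    qed
    moreover have "n.upper A \<le> p.upper A - \<nu> A"
    proof (rule n.upper_le)
      fix B assume B: "B \<in> sets M" "B \<subseteq> A"
      have "\<nu> (A - B) \<le> p.upper A" by (rule p.le_upper) (use A B in auto)
      then show "- \<nu> B \<le> p.upper A - \<nu> A" using split[OF B] by linarith
    qed
    ultimately show ?thesis by simp
  qed
  show ?thesis
  proof (rule that[of "\<lambda>x. f x - g x"])
    show "integrable M (\<lambda>x. f x - g x)" by (rule Bochner_Integration.integrable_diff[OF f(1) g(1)])
    fix A assume A: "A \<in> sets M"
    have fg: "set_integrable M A f" "set_integrable M A g"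
      unfolding set_integrable_def by (rule integrable_mult_indicator[OF A f(1)], rule integrable_mult_indicator[OF A g(1)])
    show "\<nu> A = (LINT x:A|M. f x - g x)"
      unfolding jordan[OF A] f(2)[OF A] g(2)[OF A] by (rule set_integral_diff(2)[OF fg, symmetric])
  qed
qed

section \<open>Charges given by bounded Borel functions\<close>

lemma bv_cases:
  obtains u where "u \<in> BV_cube" "U = abs_bv u"
proof
  have "BV_rel (rep_bv U) (rep_bv U)" by (rule Quotient3_rep_reflp[OF Quotient3_bv])
  then show "rep_bv U \<in> BV_cube" by (simp add: BV_rel_def)
  show "U = abs_bv (rep_bv U)" by (rule Quotient3_abs_rep[OF Quotient3_bv, symmetric])
qed

lemma BV_rel_refl: "u \<in> BV_cube \<Longrightarrow> BV_rel u u"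
  by (simp add: BV_rel_def)

lemma norm_abs_bv: "u \<in> BV_cube \<Longrightarrow> norm (abs_bv u) = BV_norm u"
  by (rule norm_bv.abs_eq[OF BV_rel_refl])

lemma abs_bv_add: "u \<in> BV_cube \<Longrightarrow> v \<in> BV_cube \<Longrightarrow> abs_bv u + abs_bv v = abs_bv (\<lambda>x. u x + v x)"
  by (rule plus_bv.abs_eq[OF BV_rel_refl BV_rel_refl])

lemma abs_bv_scale: "u \<in> BV_cube \<Longrightarrow> c *\<^sub>R abs_bv u = abs_bv (\<lambda>x. c * u x)"
  by (rule scaleR_bv.abs_eq[OF BV_rel_refl])

lemma rep_abs_bv:
  assumes "u \<in> BV_cube"
  shows "rep_bv (abs_bv u) \<in> BV_cube" "AE x in lborel. rep_bv (abs_bv u) x = u x"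
proof -
  have "BV_rel (rep_bv (abs_bv u)) u"
    by (rule rep_abs_rsp_left[OF Quotient3_bv]) (rule BV_rel_refl[OF assms])
  then show "rep_bv (abs_bv u) \<in> BV_cube" "AE x in lborel. rep_bv (abs_bv u) x = u x"
    by (simp_all add: BV_rel_def)
qed

lemma BV_norm_bounds:
  assumes "u \<in> BV_cube"
  shows "(LINT x|lborel. \<bar>u x\<bar>) \<le> BV_norm u" "total_variation u \<le> BV_norm u" "0 \<le> BV_norm u"
proof -
  have "0 \<le> (LINT x|lborel. \<bar>u x\<bar>)" "0 \<le> total_variation u"
    by (simp_all add: total_variation_def)
  then show "(LINT x|lborel. \<bar>u x\<bar>) \<le> BV_norm u" "total_variation u \<le> BV_norm u" "0 \<le> BV_norm u"
    unfolding BV_norm_def total_variation_def by linarith+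
qed

definition bounded_borel :: "(real^'n::finite \<Rightarrow> real) \<Rightarrow> bool"
  where "bounded_borel f \<longleftrightarrow> f \<in> borel_measurable borel \<and> (\<exists>B. \<forall>x. \<bar>f x\<bar> \<le> B)"

lemma bounded_borelI: "f \<in> borel_measurable borel \<Longrightarrow> (\<And>x. \<bar>f x\<bar> \<le> B) \<Longrightarrow> bounded_borel f"
  by (auto simp: bounded_borel_def)

lemma bounded_borel_measurable [measurable_dest]: "bounded_borel f \<Longrightarrow> f \<in> borel_measurable borel"
  by (simp add: bounded_borel_def)

lemma bounded_borel_add:
  assumes "bounded_borel f" "bounded_borel g"
  shows "bounded_borel (\<lambda>x. f x + g x)"
proof -
  obtain B C where "\<And>x. \<bar>f x\<bar> \<le> B" "\<And>x. \<bar>g x\<bar> \<le> C" using assms by (auto simp: bounded_borel_def)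
  then have "\<bar>f x + g x\<bar> \<le> B + C" for x by (meson abs_triangle_ineq add_mono order_trans)
  then show ?thesis using assms by (intro bounded_borelI) (auto intro: bounded_borel_measurable)
qed

lemma bounded_borel_cmult:
  assumes "bounded_borel f"
  shows "bounded_borel (\<lambda>x. c * f x)"
proof -
  obtain B where "\<And>x. \<bar>f x\<bar> \<le> B" using assms by (auto simp: bounded_borel_def)
  then have "\<bar>c * f x\<bar> \<le> \<bar>c\<bar> * B" for x by (simp add: abs_mult mult_left_mono)
  then show ?thesis using assms by (intro bounded_borelI) (auto intro: bounded_borel_measurable)
qed

lemma bounded_borel_indicator: "A \<in> sets borel \<Longrightarrow> bounded_borel (indicator A)"
  by (intro bounded_borelI[of _ 1]) (auto simp: indicator_def)

lemma bounded_borel_sum: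
  assumes "finite K" "\<And>k. k \<in> K \<Longrightarrow> bounded_borel (f k)"
  shows "bounded_borel (\<lambda>x. \<Sum>k\<in>K. f k x)"
  using assms
proof (induction K)
  case empty
  then show ?case by (auto intro: bounded_borelI[of _ 0])
next
  case (insert k K)
  then show ?case using bounded_borel_add[of "f k" "\<lambda>x. \<Sum>k\<in>K. f k x"] by simp
qed

lemma integrable_bounded_borel_mult:
  assumes "bounded_borel f" "integrable lborel u"
  shows "integrable lborel (\<lambda>x. f x * u x)"
proof -
  obtain B where "\<And>x. \<bar>f x\<bar> \<le> B" using assms by (auto simp: bounded_borel_def)
  then show ?thesis
    by (rule integral_mult_le_bound(1)) (use assms in \<open>auto intro: bounded_borel_measurable\<close>)
qed

lemma cube_integral_eq:
  assumes u: "u \<in> BV_cube" and [measurable]: "f \<in> borel_measurable borel"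
  shows "(LINT x:cbox 0 1|lborel. f x * u x) = (LINT x|lborel. f x * u x)"
  unfolding set_lebesgue_integral_def
proof (rule integral_cong_AE)
  have [measurable]: "u \<in> borel_measurable borel" by (rule BV_cubeD[OF u])
  show "(\<lambda>x. indicator (cbox 0 1) x *\<^sub>R (f x * u x)) \<in> borel_measurable lborel"
    "(\<lambda>x. f x * u x) \<in> borel_measurable lborel" by measurable
  show "AE x in lborel. indicator (cbox 0 1) x *\<^sub>R (f x * u x) = f x * u x"
    using BV_cubeD(4)[OF u] by eventually_elim (auto simp: indicator_def)
qed

text \<open>For bounded Borel \<open>f\<close> this is the functional \<open>T\<^sub>f\<close>.  Representatives vanish almost everywhere outside the cube,
so the integral may run over the whole space, where the duality formulas for mollifiers apply.\<close>
definition cube_functional :: "(real^'n::finite \<Rightarrow> real) \<Rightarrow> ('n bv \<Rightarrow>\<^sub>L real)"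
  where "cube_functional f = Blinfun (\<lambda>U. LINT x|lborel. f x * rep_bv U x)"

lemma cube_functional_apply:
  fixes f :: "real^'n::finite \<Rightarrow> real"
  assumes f: "bounded_borel f" and u: "u \<in> BV_cube"
  shows "blinfun_apply (cube_functional f) (abs_bv u) = (LINT x|lborel. f x * u x)"
proof -
  obtain B where B: "\<And>x. \<bar>f x\<bar> \<le> B" using f by (auto simp: bounded_borel_def)
  have [measurable]: "f \<in> borel_measurable borel" using f by (rule bounded_borel_measurable)
  have rep: "(LINT x|lborel. f x * rep_bv (abs_bv u) x) = (LINT x|lborel. f x * u x)" if u: "u \<in> BV_cube" for u
  proof (rule integral_cong_AE)
    show "(\<lambda>x. f x * rep_bv (abs_bv u) x) \<in> borel_measurable lborel"
      using BV_cubeD(2)[OF rep_abs_bv(1)[OF u]] by measurable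
    show "(\<lambda>x. f x * u x) \<in> borel_measurable lborel"
      using BV_cubeD(2)[OF u] by measurable
    show "AE x in lborel. f x * rep_bv (abs_bv u) x = f x * u x"
      using rep_abs_bv(2)[OF u] by eventually_elim simp
  qed
  have "bounded_linear (\<lambda>U. LINT x|lborel. f x * rep_bv U x)"
  proof (rule bounded_linear_intro[where K = B])
    fix U V :: "'n bv" and c :: real
    obtain u where u: "u \<in> BV_cube" "U = abs_bv u" by (rule bv_cases)
    obtain v where v: "v \<in> BV_cube" "V = abs_bv v" by (rule bv_cases)
    have int: "integrable lborel (\<lambda>x. f x * u x)" "integrable lborel (\<lambda>x. f x * v x)"
      by (intro integrable_bounded_borel_mult f BV_cubeD u v)+
    show "(LINT x|lborel. f x * rep_bv (U + V) x) = (LINT x|lborel. f x * rep_bv U x) + (LINT x|lborel. f x * rep_bv V x)"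
      unfolding u(2) v(2) abs_bv_add[OF u(1) v(1)]
      using int by (simp add: rep u v BV_cube_add distrib_left)
    show "(LINT x|lborel. f x * rep_bv (c *\<^sub>R U) x) = c *\<^sub>R (LINT x|lborel. f x * rep_bv U x)"
      unfolding u(2) abs_bv_scale[OF u(1)]
      by (simp add: rep u BV_cube_scale mult.left_commute[of "f _" c])
    have "\<bar>LINT x|lborel. f x * u x\<bar> \<le> B * (LINT x|lborel. \<bar>u x\<bar>)"
      by (rule integral_mult_le_bound(2)[OF B BV_cubeD(1)[OF u(1)]]) simp
    also have "\<dots> \<le> B * BV_norm u"
      using B[of undefined] by (intro mult_left_mono BV_norm_bounds u) (meson abs_ge_zero order_trans)
    finally show "norm (LINT x|lborel. f x * rep_bv U x) \<le> norm U * B"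
      unfolding u(2) norm_abs_bv[OF u(1)] by (simp add: rep u mult.commute)
  qed
  then show ?thesis
    by (simp add: cube_functional_def bounded_linear_Blinfun_apply rep u)
qed

lemma bounded_borel_Ld_cube:
  fixes f :: "real^'n::finite \<Rightarrow> real"
  assumes f: "bounded_borel f"
  shows "f \<in> Ld_cube"
proof -
  obtain B where B: "\<And>x. \<bar>f x\<bar> \<le> B" using f by (auto simp: bounded_borel_def)
  have [measurable]: "f \<in> borel_measurable borel" using f by (rule bounded_borel_measurable)
  have "integrable lborel (\<lambda>x. B ^ CARD('n) * indicator (cbox 0 (1 :: real^'n)) x)"
    by (intro integrable_mult_right integrable_real_indicator) (auto simp: emeasure_lborel_cbox_eq)
  then have "set_integrable lborel (cbox 0 1) (\<lambda>x. \<bar>f x\<bar> ^ CARD('n))"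
    unfolding set_integrable_def
  proof (rule Bochner_Integration.integrable_bound)
    have "\<bar>f x\<bar> ^ CARD('n) \<le> \<bar>B ^ CARD('n)\<bar>" for x
      using power_mono[OF B[of x] abs_ge_zero, of "CARD('n)"] by linarith
    then show "AE x in lborel. norm (indicator (cbox 0 1) x *\<^sub>R \<bar>f x\<bar> ^ CARD('n))
        \<le> norm (B ^ CARD('n) * indicator (cbox 0 1) x)"
      by (intro AE_I2) (simp add: indicator_def del: cbox_interval)
  qed measurable
  then show ?thesis by (simp add: Ld_cube_def)
qed

lemma cube_functional_in_SCH:
  fixes f :: "real^'n::finite \<Rightarrow> real"
  assumes f: "bounded_borel f"
  shows "cube_functional f \<in> SCH"
proof -
  have "is_T_functional f (cube_functional f)"
    unfolding is_T_functional_def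
  proof (intro ballI conjI)
    fix u :: "real^'n \<Rightarrow> real" assume u: "u \<in> BV_cube"
    show "set_integrable lborel (cbox 0 1) (\<lambda>x. f x * u x)"
      unfolding set_integrable_def
      by (intro integrable_mult_indicator integrable_bounded_borel_mult f BV_cubeD u) simp
    show "blinfun_apply (cube_functional f) (abs_bv u) = (LINT x:cbox 0 1|lborel. f x * u x)"
      unfolding cube_integral_eq[OF u bounded_borel_measurable[OF f]] by (rule cube_functional_apply[OF f u])
  qed
  then have "cube_functional f \<in> {\<alpha>. \<exists>f\<in>Ld_cube. is_T_functional f \<alpha>}"
    using bounded_borel_Ld_cube[OF f] by blast
  then show ?thesis unfolding SCH_def by (rule subsetD[OF closure_subset])
qed

lemma norm_bv_functional_le:
  assumes "0 \<le> c" "\<And>u. u \<in> BV_cube \<Longrightarrow> \<bar>blinfun_apply \<beta> (abs_bv u)\<bar> \<le> c * BV_norm u"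
  shows "norm \<beta> \<le> c"
proof (rule norm_blinfun_bound[OF assms(1)])
  fix U :: "'a bv"
  obtain u where "u \<in> BV_cube" "U = abs_bv u" by (rule bv_cases)
  then show "norm (blinfun_apply \<beta> U) \<le> c * norm U"
    using assms(2) by (simp add: norm_abs_bv)
qed

lemma blinfun_bv_eqI:
  assumes "\<And>u. u \<in> BV_cube \<Longrightarrow> blinfun_apply \<beta> (abs_bv u) = blinfun_apply \<gamma> (abs_bv u)"
  shows "\<beta> = \<gamma>"
proof (rule blinfun_eqI)
  fix U :: "'a bv"
  obtain u where "u \<in> BV_cube" "U = abs_bv u" by (rule bv_cases)
  then show "blinfun_apply \<beta> U = blinfun_apply \<gamma> U" using assms by simp
qed

definition cube_charge :: "(real^'n::finite \<Rightarrow> real) \<Rightarrow> 'n sch"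
  where "cube_charge f = Abs_sch (cube_functional f)"

lemma Rep_cube_charge: "bounded_borel f \<Longrightarrow> Rep_sch (cube_charge f) = cube_functional f"
  unfolding cube_charge_def by (rule Abs_sch_inverse[OF cube_functional_in_SCH])

lemma cube_charge_add:
  fixes f :: "real^'n::finite \<Rightarrow> real"
  assumes f: "bounded_borel f" and g: "bounded_borel g"
  shows "cube_charge (\<lambda>x. f x + g x) = cube_charge f + cube_charge g"
proof -
  have "cube_functional (\<lambda>x. f x + g x) = cube_functional f + cube_functional g"
  proof (rule blinfun_bv_eqI)
    fix u :: "real^'n \<Rightarrow> real" assume u: "u \<in> BV_cube"
    have "integrable lborel (\<lambda>x. f x * u x)" "integrable lborel (\<lambda>x. g x * u x)"
      by (intro integrable_bounded_borel_mult f g BV_cubeD u)+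
    then show "blinfun_apply (cube_functional (\<lambda>x. f x + g x)) (abs_bv u) = blinfun_apply (cube_functional f + cube_functional g) (abs_bv u)"
      by (simp add: cube_functional_apply f g u bounded_borel_add blinfun.add_left distrib_right)
  qed
  then show ?thesis
    by (intro Rep_sch_inject[THEN iffD1]) (simp add: Rep_cube_charge f g bounded_borel_add plus_sch.rep_eq)
qed

lemma cube_charge_scale:
  fixes f :: "real^'n::finite \<Rightarrow> real"
  assumes f: "bounded_borel f"
  shows "cube_charge (\<lambda>x. c * f x) = c *\<^sub>R cube_charge f"
proof -
  have "cube_functional (\<lambda>x. c * f x) = c *\<^sub>R cube_functional f"
  proof (rule blinfun_bv_eqI)
    fix u :: "real^'n \<Rightarrow> real" assume u: "u \<in> BV_cube"
    show "blinfun_apply (cube_functional (\<lambda>x. c * f x)) (abs_bv u) = blinfun_apply (c *\<^sub>R cube_functional f) (abs_bv u)"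
      by (simp add: cube_functional_apply f u bounded_borel_cmult blinfun.scaleR_left mult.assoc)
  qed
  then show ?thesis
    by (intro Rep_sch_inject[THEN iffD1]) (simp add: Rep_cube_charge f bounded_borel_cmult scaleR_sch.rep_eq)
qed

lemma norm_cube_charge_le:
  assumes f: "bounded_borel f" and c: "0 \<le> c"
    and le: "\<And>u. u \<in> BV_cube \<Longrightarrow> \<bar>LINT x|lborel. f x * u x\<bar> \<le> c * BV_norm u"
  shows "norm (cube_charge f) \<le> c"
  unfolding norm_sch.rep_eq Rep_cube_charge[OF f]
  by (rule norm_bv_functional_le[OF c]) (simp add: cube_functional_apply f le)

lemma norm_cube_charge_le_sup:
  fixes f :: "real^'n::finite \<Rightarrow> real"
  assumes f: "f \<in> borel_measurable borel" and B: "\<And>x. \<bar>f x\<bar> \<le> B"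
  shows "norm (cube_charge f) \<le> B"
proof (rule norm_cube_charge_le)
  show "bounded_borel f" by (rule bounded_borelI[OF f B])
  show B0: "0 \<le> B" using B[of undefined] by (meson abs_ge_zero order_trans)
  fix u :: "real^'n \<Rightarrow> real" assume u: "u \<in> BV_cube"
  have "\<bar>LINT x|lborel. f x * u x\<bar> \<le> B * (LINT x|lborel. \<bar>u x\<bar>)"
    by (rule integral_mult_le_bound(2)[OF B BV_cubeD(1)[OF u]]) (use f in simp)
  also have "\<dots> \<le> B * BV_norm u" by (intro mult_left_mono BV_norm_bounds u B0)
  finally show "\<bar>LINT x|lborel. f x * u x\<bar> \<le> B * BV_norm u" .
qed

lemma le_root_mult:
  fixes a b c :: real
  assumes "a ^ n \<le> b * c ^ n" "0 < n" "0 \<le> b" "0 \<le> c"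
  shows "a \<le> root n b * c"
proof (rule power_le_imp_le_base)
  show "a ^ Suc (n - 1) \<le> (root n b * c) ^ Suc (n - 1)"
    using assms by (simp add: power_mult_distrib real_root_pow_pos2)
qed (use assms in simp)

text \<open>This is the Sobolev inequality: \<open>T\<^sub>f\<close> is bounded by the norm of \<open>f\<close> in \<open>L\<^sup>d\<close>.\<close>
lemma norm_cube_charge_le_Ld:
  fixes f :: "real^'n::finite \<Rightarrow> real"
  assumes f: "bounded_borel f"
  shows "norm (cube_charge f) \<le> root CARD('n) (LINT x:cbox 0 1|lborel. \<bar>f x\<bar> ^ CARD('n))"
proof (rule norm_cube_charge_le[OF f])
  have nn: "0 \<le> (LINT x:cbox 0 1|lborel. \<bar>f x\<bar> ^ CARD('n))"
    unfolding set_lebesgue_integral_def by simp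
  then show "0 \<le> root CARD('n) (LINT x:cbox 0 1|lborel. \<bar>f x\<bar> ^ CARD('n))" by simp
  fix u :: "real^'n \<Rightarrow> real" assume u: "u \<in> BV_cube"
  obtain B where B: "\<And>x. \<bar>f x\<bar> \<le> B" using f by (auto simp: bounded_borel_def)
  have tv: "0 \<le> total_variation u" by (simp add: total_variation_def)
  have "\<bar>LINT x|lborel. f x * u x\<bar> \<le> root CARD('n) (LINT x:cbox 0 1|lborel. \<bar>f x\<bar> ^ CARD('n)) * total_variation u"
    using sobolev_bounded[OF u bounded_borel_measurable[OF f] B] nn tv
    unfolding cube_integral_eq[OF u bounded_borel_measurable[OF f]] by (intro le_root_mult) auto
  also have "\<dots> \<le> root CARD('n) (LINT x:cbox 0 1|lborel. \<bar>f x\<bar> ^ CARD('n)) * BV_norm u"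
    using nn by (intro mult_left_mono BV_norm_bounds u) simp
  finally show "\<bar>LINT x|lborel. f x * u x\<bar> \<le> root CARD('n) (LINT x:cbox 0 1|lborel. \<bar>f x\<bar> ^ CARD('n)) * BV_norm u" .
qed

text \<open>These charges pair with \<open>u\<close> as \<open>s\<close> pairs with a mollified derivative of \<open>u\<close>, and therefore see only the
variation of \<open>u\<close>.  That their norms are at most \<open>1\<close>, for every \<open>k\<close> and every \<open>s\<close> bounded by \<open>1\<close>, is what lets a functional on
charges control a gradient.\<close>
lemma norm_cube_charge_adj_deriv_le:
  fixes s :: "real^'n::finite \<Rightarrow> real"
  assumes s: "s \<in> borel_measurable borel" and s1: "\<And>x. \<bar>s x\<bar> \<le> 1"
  shows "bounded_borel (adj_deriv s i k)" "norm (cube_charge (adj_deriv s i k)) \<le> 1"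
proof -
  show bb: "bounded_borel (adj_deriv s i k)"
    by (rule bounded_borelI[OF _ adj_bound(2)[OF s1 s]]) (use s in measurable)
  show "norm (cube_charge (adj_deriv s i k)) \<le> 1"
  proof (rule norm_cube_charge_le[OF bb])
    fix u :: "real^'n \<Rightarrow> real" assume u: "u \<in> BV_cube"
    have "(LINT x|lborel. adj_deriv s i k x * u x) = (LINT x|lborel. s x * moll_deriv u i k x)"
      using moll_deriv_dual(1)[OF BV_cubeD(1)[OF u] s s1] by (simp add: mult.commute)
    then show "\<bar>LINT x|lborel. adj_deriv s i k x * u x\<bar> \<le> 1 * BV_norm u"
      using order_trans[OF moll_deriv_dual_bound[OF u s s1] BV_norm_bounds(2)[OF u]] by simp
  qed simp
qed

section \<open>Functionals on charges as functions of bounded variation\<close>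

text \<open>Step functions on level sets approximate a bounded Borel function uniformly, and the functional is
continuous for uniform convergence.\<close>
lemma bounded_borel_functional_eq_0:
  fixes \<Psi> :: "(real^'n::finite \<Rightarrow> real) \<Rightarrow> real"
  assumes add: "\<And>f g. bounded_borel f \<Longrightarrow> bounded_borel g \<Longrightarrow> \<Psi> (\<lambda>x. f x + g x) = \<Psi> f + \<Psi> g"
    and scale: "\<And>c f. bounded_borel f \<Longrightarrow> \<Psi> (\<lambda>x. c * f x) = c * \<Psi> f"
    and bound: "\<And>f B. f \<in> borel_measurable borel \<Longrightarrow> (\<And>x. \<bar>f x\<bar> \<le> B) \<Longrightarrow> \<bar>\<Psi> f\<bar> \<le> K * B"
    and ind: "\<And>A. A \<in> sets borel \<Longrightarrow> \<Psi> (indicator A) = 0"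
    and f: "bounded_borel f"
  shows "\<Psi> f = 0"
proof -
  have sum: "\<Psi> (\<lambda>x. \<Sum>k\<in>I. c k * indicator (A k) x) = 0"
    if "finite I" "\<And>k. A k \<in> sets borel" for I and c :: "nat \<Rightarrow> real" and A :: "nat \<Rightarrow> (real^'n) set"
    using that(1)
  proof (induction I)
    case empty
    have "(indicator {} :: real^'n \<Rightarrow> real) = (\<lambda>_. 0)" by (simp add: fun_eq_iff)
    then show ?case using ind[of "{}"] by simp
  next
    case (insert k I)
    have b: "bounded_borel (\<lambda>x. c k * indicator (A k) x)" for k
      by (intro bounded_borel_cmult bounded_borel_indicator that)
    have "\<Psi> (\<lambda>x. c k * indicator (A k) x + (\<Sum>k\<in>I. c k * indicator (A k) x))
        = \<Psi> (\<lambda>x. c k * indicator (A k) x) + \<Psi> (\<lambda>x. \<Sum>k\<in>I. c k * indicator (A k) x)"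
      by (intro add b bounded_borel_sum insert.hyps)
    then show ?case
      unfolding sum.insert[OF insert.hyps] insert.IH scale[OF bounded_borel_indicator[OF that(2)]] ind[OF that(2)]
      by simp
  qed
  have unit: "\<Psi> g = 0" if g [measurable]: "g \<in> borel_measurable borel" and g1: "\<And>x. \<bar>g x\<bar> \<le> 1" for g
  proof -
    have "\<bar>\<Psi> g\<bar> \<le> K * (1 / real (Suc n))" for n
    proof -
      define s where "s x = (\<Sum>k\<le>2 * Suc n. (real k - real (Suc n)) / real (Suc n) * indicator (level_set (Suc n) g k) x)" for x
      have ls: "level_set (Suc n) g k \<in> sets borel" for k by measurable
      have s0: "\<Psi> s = 0" unfolding s_def[abs_def] by (rule sum) (use ls in auto)
      have bs: "bounded_borel s"
        unfolding s_def[abs_def] by (intro bounded_borel_sum bounded_borel_cmult bounded_borel_indicator ls) simp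
      note [measurable] = bounded_borel_measurable[OF bs]
      have "\<bar>g x - s x\<bar> \<le> 1 / real (Suc n)" for x
        unfolding s_def by (rule level_set_approx[OF g1]) simp
      then have "\<bar>\<Psi> (\<lambda>x. g x - s x)\<bar> \<le> K * (1 / real (Suc n))"
        by (intro bound) measurable
      moreover have "\<Psi> (\<lambda>x. g x + (- 1) * s x) = \<Psi> g + \<Psi> (\<lambda>x. (- 1) * s x)"
        by (intro add bounded_borel_cmult bs bounded_borelI[OF g g1])
      moreover have "\<Psi> (\<lambda>x. (- 1) * s x) = 0"
        using scale[OF bs, of "- 1"] s0 by simp
      ultimately show ?thesis by simp
    qed
    moreover have "(\<lambda>n. K * (1 / real (Suc n))) \<longlonglongrightarrow> K * 0"
      using LIMSEQ_inverse_real_of_nat by (intro tendsto_mult tendsto_const) (simp add: inverse_eq_divide)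
    ultimately have "\<bar>\<Psi> g\<bar> \<le> K * 0" by (intro LIMSEQ_le_const) auto
    then show ?thesis by simp
  qed
  obtain B where B: "\<And>x. \<bar>f x\<bar> \<le> B" using f by (auto simp: bounded_borel_def)
  have B1: "0 < \<bar>B\<bar> + 1" by simp
  have "\<bar>f x / (\<bar>B\<bar> + 1)\<bar> \<le> 1" for x
  proof -
    have "\<bar>f x\<bar> \<le> \<bar>B\<bar> + 1" using B[of x] by linarith
    then show ?thesis unfolding abs_divide abs_of_pos[OF B1] divide_le_eq_1_pos[OF B1] .
  qed
  then have "\<Psi> (\<lambda>x. f x / (\<bar>B\<bar> + 1)) = 0"
    using bounded_borel_measurable[OF f] by (intro unit) auto
  then have "1 / (\<bar>B\<bar> + 1) * \<Psi> f = 0"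
    using scale[OF f, of "1 / (\<bar>B\<bar> + 1)"] by simp
  then show ?thesis using B1 by auto
qed

text \<open>Countable additivity comes from the \<open>L\<^sup>d\<close> bound: the remainders of a disjoint union decrease to the empty set,
so the measure of their intersections with the cube tends to \<open>0\<close>.\<close>
lemma charge_functional_real_charge:
  fixes \<Lambda> :: "'n::finite sch \<Rightarrow>\<^sub>L real"
  defines "\<nu> \<equiv> \<lambda>A. blinfun_apply \<Lambda> (cube_charge (indicator A))"
  shows "real_charge lborel \<nu> (norm \<Lambda>)"
    and "\<And>A. A \<in> sets borel \<Longrightarrow> \<bar>\<nu> A\<bar> \<le> norm \<Lambda> * root CARD('n) (measure lborel (A \<inter> cbox 0 1))"
proof -
  let ?Q = "cbox 0 1 :: (real^'n) set"
  have Q: "?Q \<in> sets borel" by simp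
  have finQ: "emeasure lborel (A \<inter> ?Q) < top" for A
  proof -
    have "emeasure lborel (A \<inter> ?Q) \<le> emeasure lborel ?Q" by (intro emeasure_mono) (auto simp del: cbox_interval)
    also have "\<dots> < top" by (simp add: emeasure_lborel_cbox_eq less_top)
    finally show ?thesis .
  qed
  have le: "\<bar>\<nu> A\<bar> \<le> norm \<Lambda> * c" if "norm (cube_charge (indicator A)) \<le> c" for A c
  proof -
    have "\<bar>\<nu> A\<bar> \<le> norm \<Lambda> * norm (cube_charge (indicator A))"
      using norm_blinfun[of \<Lambda> "cube_charge (indicator A)"] by (simp add: \<nu>_def)
    also have "\<dots> \<le> norm \<Lambda> * c" by (intro mult_left_mono that) simp
    finally show ?thesis .
  qed
  show bound_Ld: "\<bar>\<nu> A\<bar> \<le> norm \<Lambda> * root CARD('n) (measure lborel (A \<inter> ?Q))" if A: "A \<in> sets borel" for A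
  proof -
    have "(LINT x:?Q|lborel. \<bar>indicator A x :: real\<bar> ^ CARD('n)) = (LINT x|lborel. indicator (A \<inter> ?Q) x)"
      unfolding set_lebesgue_integral_def
      by (intro Bochner_Integration.integral_cong) (auto simp: indicator_def power_0_left)
    also have "\<dots> = measure lborel (A \<inter> ?Q)" by simp
    finally have eq: "(LINT x:?Q|lborel. \<bar>indicator A x :: real\<bar> ^ CARD('n)) = measure lborel (A \<inter> ?Q)" .
    show ?thesis
      using le[OF norm_cube_charge_le_Ld[OF bounded_borel_indicator[OF A]]] unfolding eq .
  qed
  have add: "\<nu> (A \<union> B) = \<nu> A + \<nu> B" if "A \<in> sets borel" "B \<in> sets borel" "A \<inter> B = {}" for A B
  proof -
    have "(indicator (A \<union> B) :: _ \<Rightarrow> real) = (\<lambda>x. indicator A x + indicator B x)"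
      using that(3) by (auto simp: indicator_def fun_eq_iff)
    then show ?thesis
      using cube_charge_add[OF bounded_borel_indicator[OF that(1)] bounded_borel_indicator[OF that(2)]]
      by (simp add: \<nu>_def blinfun.add_right)
  qed
  show "real_charge lborel \<nu> (norm \<Lambda>)"
  proof
    show "\<nu> (A \<union> B) = \<nu> A + \<nu> B" if "A \<in> sets lborel" "B \<in> sets lborel" "A \<inter> B = {}" for A B
      using add that by simp
    show "\<bar>\<nu> A\<bar> \<le> norm \<Lambda>" if "A \<in> sets lborel" for A
      using le[OF norm_cube_charge_le_sup[of "indicator A" 1]] that by (auto simp: indicator_def)
    fix A :: "nat \<Rightarrow> (real^'n) set" assume A: "range A \<subseteq> sets lborel" "disjoint_family A"
    have Ak: "A k \<in> sets borel" for k using A by auto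
    have part: "(\<Sum>k<n. \<nu> (A k)) = \<nu> (\<Union>k<n. A k)" for n
    proof (induction n)
      case 0
      show ?case using add[of "{}" "{}"] by simp
    next
      case (Suc n)
      have "A n \<inter> (\<Union>k<n. A k) = {}"
      proof (rule ccontr)
        assume "\<not> ?thesis"
        then obtain x k where "x \<in> A n" "k < n" "x \<in> A k" by blast
        then show False using disjoint_family_onD[OF A(2), of n k] by auto
      qed
      then have "\<nu> (A n \<union> (\<Union>k<n. A k)) = \<nu> (A n) + \<nu> (\<Union>k<n. A k)" using Ak by (intro add) auto
      moreover have "(\<Union>k<Suc n. A k) = A n \<union> (\<Union>k<n. A k)" by (auto simp: less_Suc_eq)
      ultimately show ?case using Suc by simp
    qed
    define R where "R n = (\<Union>k. A k) - (\<Union>k<n. A k)" for n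
    have R: "R n \<in> sets borel" for n unfolding R_def using Ak by auto
    have tail: "\<nu> (\<Union>k. A k) = \<nu> (\<Union>k<n. A k) + \<nu> (R n)" for n
    proof -
      have "(\<Union>k. A k) = (\<Union>k<n. A k) \<union> R n" "(\<Union>k<n. A k) \<inter> R n = {}" by (auto simp: R_def)
      then show ?thesis using add[of "\<Union>k<n. A k" "R n"] R Ak by auto
    qed
    have "(\<lambda>n. measure lborel (R n \<inter> ?Q)) \<longlonglongrightarrow> measure lborel (\<Inter>n. R n \<inter> ?Q)"
    proof (rule Lim_measure_decseq)
      show "range (\<lambda>n. R n \<inter> ?Q) \<subseteq> sets lborel" using R by auto
      show "decseq (\<lambda>n. R n \<inter> ?Q)" 
      proof (rule decseq_SucI)
        show "R (Suc n) \<inter> ?Q \<subseteq> R n \<inter> ?Q" for n unfolding R_def lessThan_Suc by blast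
      qed
      show "emeasure lborel (R n \<inter> ?Q) \<noteq> \<infinity>" for n using finQ[of "R n"] by auto
    qed
    moreover have "(\<Inter>n. R n \<inter> ?Q) = {}"
    proof (rule ccontr)
      assume "\<not> ?thesis"
      then obtain x where x: "\<And>n. x \<in> R n" by blast
      then obtain k where "x \<in> A k" unfolding R_def by blast
      then show False using x[of "Suc k"] unfolding R_def by blast
    qed
    ultimately have "(\<lambda>n. measure lborel (R n \<inter> ?Q)) \<longlonglongrightarrow> 0" by simp
    then have "(\<lambda>n. norm \<Lambda> * root CARD('n) (measure lborel (R n \<inter> ?Q))) \<longlonglongrightarrow> norm \<Lambda> * root CARD('n) 0"
      by (intro tendsto_mult tendsto_const tendsto_real_root)
    then have lim0: "(\<lambda>n. norm \<Lambda> * root CARD('n) (measure lborel (R n \<inter> ?Q))) \<longlonglongrightarrow> 0" by simp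
    have "\<forall>n. norm (\<nu> (R n)) \<le> norm \<Lambda> * root CARD('n) (measure lborel (R n \<inter> ?Q))"
      unfolding real_norm_def using bound_Ld[OF R] by blast
    then have "(\<lambda>n. \<nu> (R n)) \<longlonglongrightarrow> 0"
      by (rule Lim_null_comparison[OF always_eventually lim0])
    then have "(\<lambda>n. \<nu> (\<Union>k. A k) - \<nu> (R n)) \<longlonglongrightarrow> \<nu> (\<Union>k. A k) - 0" by (intro tendsto_intros)
    moreover have "\<nu> (\<Union>k. A k) - \<nu> (R n) = (\<Sum>k<n. \<nu> (A k))" for n using tail[of n] part[of n] by linarith
    ultimately show "(\<lambda>k. \<nu> (A k)) sums \<nu> (\<Union>k. A k)" by (simp add: sums_def)
  qed
qed

text \<open>By the \<open>L\<^sup>d\<close> bound the charge \<open>\<nu>\<close> vanishes on Lebesgue null sets and on sets disjoint from the cube, so it has a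
density there.  Both sides of the formula are continuous for uniform convergence of \<open>f\<close>, and they agree on
indicators by the choice of the density.\<close>
lemma charge_functional_density:
  fixes \<Lambda> :: "'n::finite sch \<Rightarrow>\<^sub>L real"
  obtains u where "integrable lborel u" "AE x in lborel. x \<notin> cbox 0 1 \<longrightarrow> u x = 0"
    "\<And>f. bounded_borel f \<Longrightarrow> blinfun_apply \<Lambda> (cube_charge f) = (LINT x|lborel. f x * u x)"
proof -
  let ?Q = "cbox 0 1 :: (real^'n) set"
  define \<nu> where "\<nu> A = blinfun_apply \<Lambda> (cube_charge (indicator A))" for A
  have charge: "real_charge lborel \<nu> (norm \<Lambda>)"
    and bound: "\<And>A. A \<in> sets borel \<Longrightarrow> \<bar>\<nu> A\<bar> \<le> norm \<Lambda> * root CARD('n) (measure lborel (A \<inter> ?Q))"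
    using charge_functional_real_charge[where \<Lambda> = \<Lambda>] unfolding \<nu>_def[abs_def] by blast+
  have nuQ: "\<nu> A = 0" if "A \<in> sets borel" "measure lborel (A \<inter> ?Q) = 0" for A
    using bound[OF that(1)] that(2) by simp
  have null: "\<nu> A = 0" if "A \<in> null_sets lborel" for A
  proof (rule nuQ)
    show "A \<in> sets borel" using that by auto
    have "A \<inter> ?Q \<in> null_sets lborel" by (rule null_set_Int2[OF that]) simp
    then show "measure lborel (A \<inter> ?Q) = 0" by (simp add: measure_eq_0_null_sets)
  qed
  obtain w where w: "integrable lborel w" "\<And>A. A \<in> sets lborel \<Longrightarrow> \<nu> A = (LINT x:A|lborel. w x)"
    by (rule signed_Radon_Nikodym[OF lborel.sigma_finite_measure_axioms charge null]) blast+
  define u where "u x = indicator ?Q x * w x" for x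
  have iu: "integrable lborel u"
    unfolding u_def using integrable_mult_indicator[OF _ w(1), of ?Q] by simp
  have \<nu>u: "\<nu> A = (LINT x|lborel. indicator A x * u x)" if A: "A \<in> sets borel" for A
  proof -
    have "\<nu> ((A \<inter> ?Q) \<union> (A - ?Q)) = \<nu> (A \<inter> ?Q) + \<nu> (A - ?Q)"
      by (rule real_charge.add[OF charge]) (use A in auto)
    moreover have "(A \<inter> ?Q) \<union> (A - ?Q) = A" by blast
    moreover have "\<nu> (A - ?Q) = 0"
    proof (rule nuQ)
      have "(A - ?Q) \<inter> ?Q = {}" by blast
      then show "measure lborel ((A - ?Q) \<inter> ?Q) = 0" by simp
    qed (use A in auto)
    moreover have "\<nu> (A \<inter> ?Q) = (LINT x|lborel. indicator A x * u x)"
      using w(2)[of "A \<inter> ?Q"] A by (simp add: set_lebesgue_integral_def u_def indicator_inter_arith mult.assoc)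
    ultimately show ?thesis by simp
  qed
  define \<Psi> where "\<Psi> f = blinfun_apply \<Lambda> (cube_charge f) - (LINT x|lborel. f x * u x)" for f
  have zero: "\<Psi> f = 0" if "bounded_borel f" for f
  proof (rule bounded_borel_functional_eq_0[OF _ _ _ _ that])
    show "\<Psi> (\<lambda>x. f x + g x) = \<Psi> f + \<Psi> g" if f: "bounded_borel f" and g: "bounded_borel g" for f g
      using integrable_bounded_borel_mult[OF f iu] integrable_bounded_borel_mult[OF g iu]
      by (simp add: \<Psi>_def cube_charge_add[OF f g] blinfun.add_right distrib_right)
    show "\<Psi> (\<lambda>x. c * f x) = c * \<Psi> f" if f: "bounded_borel f" for c f
      by (simp add: \<Psi>_def cube_charge_scale[OF f] blinfun.scaleR_right mult.assoc right_diff_distrib)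
    show "\<Psi> (indicator A) = 0" if "A \<in> sets borel" for A
      using \<nu>u[OF that] by (simp add: \<Psi>_def \<nu>_def)
    show "\<bar>\<Psi> f\<bar> \<le> (norm \<Lambda> + (LINT x|lborel. \<bar>u x\<bar>)) * B"
      if f: "f \<in> borel_measurable borel" and B: "\<And>x. \<bar>f x\<bar> \<le> B" for f B
    proof -
      have "\<bar>blinfun_apply \<Lambda> (cube_charge f)\<bar> \<le> norm \<Lambda> * norm (cube_charge f)"
        using norm_blinfun[of \<Lambda> "cube_charge f"] by simp
      also have "\<dots> \<le> norm \<Lambda> * B" by (intro mult_left_mono norm_cube_charge_le_sup f B) simp
      finally have "\<bar>blinfun_apply \<Lambda> (cube_charge f)\<bar> \<le> norm \<Lambda> * B" .
      moreover have "\<bar>LINT x|lborel. f x * u x\<bar> \<le> B * (LINT x|lborel. \<bar>u x\<bar>)"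
        by (rule integral_mult_le_bound(2)[OF B iu]) (use f in simp)
      moreover have "\<bar>\<Psi> f\<bar> \<le> \<bar>blinfun_apply \<Lambda> (cube_charge f)\<bar> + \<bar>LINT x|lborel. f x * u x\<bar>"
        unfolding \<Psi>_def by (rule abs_triangle_ineq4)
      moreover have "(norm \<Lambda> + (LINT x|lborel. \<bar>u x\<bar>)) * B = norm \<Lambda> * B + B * (LINT x|lborel. \<bar>u x\<bar>)"
        by (simp add: algebra_simps)
      ultimately show ?thesis by linarith
    qed
  qed
  show ?thesis
  proof (rule that[OF iu])
    show "AE x in lborel. x \<notin> cbox 0 1 \<longrightarrow> u x = 0" by (simp add: u_def del: cbox_interval)
    show "blinfun_apply \<Lambda> (cube_charge f) = (LINT x|lborel. f x * u x)" if "bounded_borel f" for f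
      using zero[OF that] by (simp add: \<Psi>_def)
  qed
qed

text \<open>For \<open>s\<close> the sign of a mollified derivative of \<open>u\<close>, the \<open>L\<^sup>1\<close> norm of that derivative is the value of \<open>\<Lambda>\<close> at a charge
of norm at most \<open>1\<close>.  So all mollified derivatives are bounded by \<open>norm \<Lambda>\<close> in \<open>L\<^sup>1\<close>, and \<open>u\<close> has a gradient measure.  The
charge given by the sign of \<open>u\<close> bounds the \<open>L\<^sup>1\<close> norm of \<open>u\<close> in the same way.\<close>
lemma charge_functional_density_BV:
  fixes \<Lambda> :: "'n::finite sch \<Rightarrow>\<^sub>L real"
  obtains u where "u \<in> BV_cube" "BV_norm u \<le> (1 + 2 * real CARD('n)) * norm \<Lambda>"
    "\<And>f. bounded_borel f \<Longrightarrow> blinfun_apply \<Lambda> (cube_charge f) = (LINT x|lborel. f x * u x)"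
proof -
  obtain u where u: "integrable lborel u" and u0: "AE x in lborel. x \<notin> cbox 0 1 \<longrightarrow> u x = 0"
    and rep: "\<And>f. bounded_borel f \<Longrightarrow> blinfun_apply \<Lambda> (cube_charge f) = (LINT x|lborel. f x * u x)"
    by (rule charge_functional_density[of \<Lambda>]) blast
  have [measurable]: "u \<in> borel_measurable borel" using u by auto
  have le: "\<bar>LINT x|lborel. f x * u x\<bar> \<le> norm \<Lambda>" if "bounded_borel f" "norm (cube_charge f) \<le> 1" for f
  proof -
    have "norm (blinfun_apply \<Lambda> (cube_charge f)) \<le> norm \<Lambda> * norm (cube_charge f)" by (rule norm_blinfun)
    also have "\<dots> \<le> norm \<Lambda> * 1" by (intro mult_left_mono that) simp
    finally show ?thesis using rep[OF that(1)] by simp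
  qed
  have deriv: "(LINT x|lborel. \<bar>moll_deriv u i k x\<bar>) \<le> norm \<Lambda>" for i k
  proof -
    define s where "s x = sgn (moll_deriv u i k x)" for x
    have "moll_deriv u i k \<in> borel_measurable borel" by (intro moll_measurable(2)) measurable
    then have s: "s \<in> borel_measurable borel"
      unfolding s_def[abs_def] by (rule measurable_compose[OF _ borel_measurable_sgn])
    have s1: "\<bar>s x\<bar> \<le> 1" for x by (simp add: s_def sgn_if)
    have "(LINT x|lborel. \<bar>moll_deriv u i k x\<bar>) = (LINT x|lborel. s x * moll_deriv u i k x)"
      by (simp add: s_def abs_sgn mult.commute)
    also have "\<dots> = (LINT x|lborel. adj_deriv s i k x * u x)"
      using moll_deriv_dual(1)[OF u s s1, where i = i and k = k] by (simp add: mult.commute)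
    also have "\<dots> \<le> norm \<Lambda>"
      using le[OF norm_cube_charge_adj_deriv_le[OF s s1, of i k]] by linarith
    finally show ?thesis .
  qed
  \<comment> \<open>The bound on the mollified derivatives has to be positive, and \<open>\<Lambda>\<close> may be \<open>0\<close>.\<close>
  have BV: "u \<in> BV_cube" and tv: "total_variation u \<le> 2 * real CARD('n) * (norm \<Lambda> + e)" if "0 < e" for e
  proof -
    have "0 < norm \<Lambda> + e" using that by (intro add_nonneg_pos) auto
    moreover have "(LINT x|lborel. \<bar>moll_deriv u i k x\<bar>) \<le> norm \<Lambda> + e" for i k
      using deriv[of i k] that by linarith
    ultimately show "u \<in> BV_cube" "total_variation u \<le> 2 * real CARD('n) * (norm \<Lambda> + e)"
      by (rule gradient_measure_of_bounded_mollifications[OF u u0])+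
  qed
  have uBV: "u \<in> BV_cube" by (rule BV[of 1]) simp
  have "total_variation u \<le> 2 * real CARD('n) * norm \<Lambda>"
  proof (rule field_le_epsilon)
    fix e :: real assume "0 < e"
    then show "total_variation u \<le> 2 * real CARD('n) * norm \<Lambda> + e"
      using tv[of "e / (2 * real CARD('n))"] by (simp add: distrib_left)
  qed
  moreover have "(LINT x|lborel. \<bar>u x\<bar>) \<le> norm \<Lambda>"
  proof -
    have s: "(\<lambda>x. sgn (u x)) \<in> borel_measurable borel"
      by (rule measurable_compose[OF \<open>u \<in> borel_measurable borel\<close> borel_measurable_sgn])
    have s1: "\<bar>sgn (u x)\<bar> \<le> 1" for x by (simp add: sgn_if)
    have "(LINT x|lborel. \<bar>u x\<bar>) = (LINT x|lborel. sgn (u x) * u x)" by (simp add: abs_sgn mult.commute)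
    also have "\<dots> \<le> norm \<Lambda>"
      using le[OF bounded_borelI[OF s s1] norm_cube_charge_le_sup[OF s s1]] by linarith
    finally show ?thesis .
  qed
  ultimately have "BV_norm u \<le> (1 + 2 * real CARD('n)) * norm \<Lambda>"
    by (simp add: BV_norm_def total_variation_def distrib_right)
  then show ?thesis using that uBV rep by blast
qed

section \<open>Density of bounded functions among the charges\<close>

definition clamp_fun :: "('a \<Rightarrow> real) \<Rightarrow> nat \<Rightarrow> 'a \<Rightarrow> real"
  where "clamp_fun f n x = max (- real n) (min (real n) (f x))"

lemma clamp_fun_props:
  "\<bar>clamp_fun f n x\<bar> \<le> real n" "\<bar>clamp_fun f m x - clamp_fun f n x\<bar> \<le> \<bar>f x\<bar>" "\<bar>f x - clamp_fun f n x\<bar> \<le> \<bar>f x\<bar>"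
  by (auto simp: clamp_fun_def max_def min_def abs_if)

lemma clamp_fun_tendsto: "(\<lambda>n. clamp_fun f n x) \<longlonglongrightarrow> f x"
proof (rule tendsto_eventually)
  obtain N where N: "\<bar>f x\<bar> \<le> real N" using real_arch_simple by blast
  show "\<forall>\<^sub>F n in sequentially. clamp_fun f n x = f x"
  proof (rule eventually_sequentiallyI)
    fix n assume "N \<le> n"
    then have "\<bar>f x\<bar> \<le> real n" using N by linarith
    then show "clamp_fun f n x = f x" by (auto simp: clamp_fun_def)
  qed
qed

lemma bounded_borel_clamp:
  assumes [measurable]: "f \<in> borel_measurable borel"
  shows "bounded_borel (clamp_fun f n)"
  by (rule bounded_borelI[OF _ clamp_fun_props(1)]) (unfold clamp_fun_def[abs_def], measurable)

text \<open>The Sobolev inequality holds for bounded functions, so it is applied to the difference of two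
truncations.  Letting the higher truncation tend to \<open>f\<close>, with \<open>f u\<close> as dominating function, bounds the distance from
\<open>T\<^sub>f\<close> to a truncation by the \<open>L\<^sup>d\<close> norm of the remainder of \<open>f\<close>.\<close>
lemma truncations_tendsto_charge:
  fixes f :: "real^'n::finite \<Rightarrow> real"
  assumes f: "f \<in> Ld_cube" and \<beta>: "is_T_functional f \<beta>"
  shows "(\<lambda>n. cube_functional (clamp_fun f n)) \<longlonglongrightarrow> \<beta>"
proof -
  let ?d = "CARD('n)" and ?Q = "cbox 0 1 :: (real^'n) set"
  define c where "c = clamp_fun f"
  have fm [measurable]: "f \<in> borel_measurable borel"
    and fd: "integrable lborel (\<lambda>x. indicator ?Q x * \<bar>f x\<bar> ^ ?d)"
    using f by (simp_all add: Ld_cube_def set_integrable_def del: cbox_interval)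
  have cb: "bounded_borel (c n)" for n unfolding c_def by (rule bounded_borel_clamp[OF fm])
  have cm [measurable]: "c n \<in> borel_measurable borel" for n by (rule bounded_borel_measurable[OF cb])
  have Q [measurable]: "?Q \<in> sets borel" by (rule borel_closed[OF closed_cbox])
  have fu_int: "set_integrable lborel ?Q (\<lambda>x. f x * u x)"
    and \<beta>_apply: "blinfun_apply \<beta> (abs_bv u) = (LINT x:?Q|lborel. f x * u x)" if "u \<in> BV_cube" for u
    using \<beta> that unfolding is_T_functional_def by blast+
  define e where "e n = (LINT x|lborel. indicator ?Q x * \<bar>f x - c n x\<bar> ^ ?d)" for n
  have e0: "0 \<le> e n" for n unfolding e_def by (rule Bochner_Integration.integral_nonneg) simp
  have dom: "\<bar>indicator ?Q x * \<bar>z\<bar> ^ ?d\<bar> \<le> indicator ?Q x * \<bar>f x\<bar> ^ ?d" if "\<bar>z\<bar> \<le> \<bar>f x\<bar>" for x z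
    using power_mono[OF that abs_ge_zero, of ?d] by (simp add: indicator_def del: cbox_interval)
  have e_lim: "e \<longlonglongrightarrow> 0"
  proof -
    have "(\<lambda>n. LINT x|lborel. indicator ?Q x * \<bar>f x - c n x\<bar> ^ ?d) \<longlonglongrightarrow> (LINT x|lborel. indicator ?Q x * \<bar>f x - f x\<bar> ^ ?d)"
    proof (rule integral_dominated_convergence[OF _ _ fd])
      show "AE x in lborel. (\<lambda>n. indicator ?Q x * \<bar>f x - c n x\<bar> ^ ?d) \<longlonglongrightarrow> indicator ?Q x * \<bar>f x - f x\<bar> ^ ?d"
        unfolding c_def by (intro AE_I2 tendsto_intros clamp_fun_tendsto)
      show "AE x in lborel. norm (indicator ?Q x * \<bar>f x - c n x\<bar> ^ ?d) \<le> indicator ?Q x * \<bar>f x\<bar> ^ ?d" for n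
        unfolding c_def real_norm_def by (intro AE_I2 dom clamp_fun_props)
    qed measurable
    then show ?thesis by (simp add: e_def[abs_def] power_0_left)
  qed
  have est: "\<bar>LINT x|lborel. indicator ?Q x * ((f x - c n x) * u x)\<bar> ^ ?d \<le> e n * total_variation u ^ ?d"
    if u: "u \<in> BV_cube" for u n
  proof (rule LIMSEQ_le)
    have [measurable]: "u \<in> borel_measurable borel" by (rule BV_cubeD[OF u])
    have fu: "integrable lborel (\<lambda>x. \<bar>indicator ?Q x * (f x * u x)\<bar>)"
      using fu_int[OF u] unfolding set_integrable_def real_scaleR_def by (rule integrable_abs)
    have "(\<lambda>m. LINT x|lborel. indicator ?Q x * ((c m x - c n x) * u x)) \<longlonglongrightarrow> (LINT x|lborel. indicator ?Q x * ((f x - c n x) * u x))"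
    proof (rule integral_dominated_convergence[OF _ _ fu])
      show "AE x in lborel. (\<lambda>m. indicator ?Q x * ((c m x - c n x) * u x)) \<longlonglongrightarrow> indicator ?Q x * ((f x - c n x) * u x)"
        unfolding c_def by (intro AE_I2 tendsto_intros clamp_fun_tendsto)
      show "AE x in lborel. norm (indicator ?Q x * ((c m x - c n x) * u x)) \<le> \<bar>indicator ?Q x * (f x * u x)\<bar>" for m
        unfolding c_def real_norm_def abs_mult
        by (intro AE_I2 mult_left_mono mult_right_mono clamp_fun_props) auto
    qed measurable
    then show "(\<lambda>m. \<bar>LINT x|lborel. indicator ?Q x * ((c m x - c n x) * u x)\<bar> ^ ?d)
        \<longlonglongrightarrow> \<bar>LINT x|lborel. indicator ?Q x * ((f x - c n x) * u x)\<bar> ^ ?d"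
      by (intro tendsto_intros)
    have "(\<lambda>m. LINT x|lborel. indicator ?Q x * \<bar>c m x - c n x\<bar> ^ ?d) \<longlonglongrightarrow> e n"
      unfolding e_def
    proof (rule integral_dominated_convergence[OF _ _ fd])
      show "AE x in lborel. (\<lambda>m. indicator ?Q x * \<bar>c m x - c n x\<bar> ^ ?d) \<longlonglongrightarrow> indicator ?Q x * \<bar>f x - c n x\<bar> ^ ?d"
        unfolding c_def by (intro AE_I2 tendsto_intros clamp_fun_tendsto)
      show "AE x in lborel. norm (indicator ?Q x * \<bar>c m x - c n x\<bar> ^ ?d) \<le> indicator ?Q x * \<bar>f x\<bar> ^ ?d" for m
        unfolding c_def real_norm_def by (intro AE_I2 dom clamp_fun_props)
    qed measurable
    then show "(\<lambda>m. (LINT x|lborel. indicator ?Q x * \<bar>c m x - c n x\<bar> ^ ?d) * total_variation u ^ ?d)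
        \<longlonglongrightarrow> e n * total_variation u ^ ?d"
      by (intro tendsto_intros)
    have "\<bar>c m x - c n x\<bar> \<le> real m + real n" for m x
      unfolding c_def using clamp_fun_props(1)[of f m x] clamp_fun_props(1)[of f n x] by linarith
    from sobolev_bounded[OF u _ this]
    have "\<bar>LINT x|lborel. indicator ?Q x * ((c m x - c n x) * u x)\<bar> ^ ?d
        \<le> (LINT x|lborel. indicator ?Q x * \<bar>c m x - c n x\<bar> ^ ?d) * total_variation u ^ ?d" for m
      by (simp add: set_lebesgue_integral_def del: cbox_interval)
    then show "\<exists>N. \<forall>m\<ge>N. \<bar>LINT x|lborel. indicator ?Q x * ((c m x - c n x) * u x)\<bar> ^ ?d
        \<le> (LINT x|lborel. indicator ?Q x * \<bar>c m x - c n x\<bar> ^ ?d) * total_variation u ^ ?d" by blast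
  qed
  have "norm (cube_functional (c n) - \<beta>) \<le> root ?d (e n)" for n
  proof (rule norm_bv_functional_le)
    show "0 \<le> root ?d (e n)" using e0 by simp
    fix u :: "real^'n \<Rightarrow> real" assume u: "u \<in> BV_cube"
    have i2: "set_integrable lborel ?Q (\<lambda>x. c n x * u x)"
      unfolding set_integrable_def
      by (intro integrable_mult_indicator integrable_bounded_borel_mult cb BV_cubeD u) (simp del: cbox_interval)
    have "blinfun_apply (cube_functional (c n) - \<beta>) (abs_bv u) = (LINT x:?Q|lborel. c n x * u x) - (LINT x:?Q|lborel. f x * u x)"
      unfolding blinfun.diff_left \<beta>_apply[OF u] cube_functional_apply[OF cb u] cube_integral_eq[OF u cm] ..
    also have "\<dots> = - ((LINT x:?Q|lborel. f x * u x) - (LINT x:?Q|lborel. c n x * u x))" by simp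
    also have "(LINT x:?Q|lborel. f x * u x) - (LINT x:?Q|lborel. c n x * u x) = (LINT x:?Q|lborel. f x * u x - c n x * u x)"
      by (rule set_integral_diff(2)[OF fu_int[OF u] i2, symmetric])
    also have "\<dots> = (LINT x|lborel. indicator ?Q x * ((f x - c n x) * u x))"
      unfolding set_lebesgue_integral_def by (simp add: left_diff_distrib del: cbox_interval)
    finally have "\<bar>blinfun_apply (cube_functional (c n) - \<beta>) (abs_bv u)\<bar>
        = \<bar>LINT x|lborel. indicator ?Q x * ((f x - c n x) * u x)\<bar>" by simp
    also have "\<dots> \<le> root ?d (e n) * total_variation u"
      by (rule le_root_mult[OF est[OF u]]) (use e0 in \<open>simp_all add: total_variation_def\<close>)
    also have "\<dots> \<le> root ?d (e n) * BV_norm u"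
      using e0 by (intro mult_left_mono BV_norm_bounds u) simp
    finally show "\<bar>blinfun_apply (cube_functional (c n) - \<beta>) (abs_bv u)\<bar> \<le> root ?d (e n) * BV_norm u" .
  qed
  then have le: "\<forall>n. norm (cube_functional (c n) - \<beta>) \<le> root ?d (e n)" by blast
  have "(\<lambda>n. root ?d (e n)) \<longlonglongrightarrow> 0"
    using tendsto_real_root[OF e_lim, of ?d] by simp
  from Lim_null_comparison[OF always_eventually[OF le] this]
  have "(\<lambda>n. cube_functional (c n) - \<beta>) \<longlonglongrightarrow> 0" .
  then show ?thesis unfolding c_def by (rule LIM_zero_cancel)
qed

lemma bounded_charges_dense:
  fixes \<alpha> :: "'n::finite sch"
  assumes "0 < \<epsilon>"
  obtains f where "bounded_borel f" "norm (cube_charge f - \<alpha>) < \<epsilon>"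
proof -
  have "Rep_sch \<alpha> \<in> closure {\<beta>. \<exists>f\<in>Ld_cube. is_T_functional f \<beta>}"
    using Rep_sch[of \<alpha>] unfolding SCH_def .
  then have "\<exists>\<beta>\<in>{\<beta>. \<exists>f\<in>Ld_cube. is_T_functional f \<beta>}. dist \<beta> (Rep_sch \<alpha>) < \<epsilon> / 2"
    unfolding closure_approachable using half_gt_zero[OF assms] by blast
  then obtain \<beta> f where f: "f \<in> Ld_cube" "is_T_functional f \<beta>" and \<beta>: "dist \<beta> (Rep_sch \<alpha>) < \<epsilon> / 2"
    by blast
  have fm: "f \<in> borel_measurable borel" using f(1) by (simp add: Ld_cube_def)
  obtain n where n: "dist (cube_functional (clamp_fun f n)) \<beta> < \<epsilon> / 2"
    using tendstoD[OF truncations_tendsto_charge[OF f], of "\<epsilon> / 2"] assms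
    by (auto simp: eventually_sequentially)
  have bb: "bounded_borel (clamp_fun f n)" by (rule bounded_borel_clamp[OF fm])
  have "norm (cube_charge (clamp_fun f n) - \<alpha>) = dist (cube_functional (clamp_fun f n)) (Rep_sch \<alpha>)"
    by (simp only: norm_sch.rep_eq Rep_sch_diff Rep_cube_charge[OF bb] dist_norm)
  also have "\<dots> < \<epsilon>"
    using dist_triangle[of "cube_functional (clamp_fun f n)" "Rep_sch \<alpha>" \<beta>] n \<beta> by linarith
  finally show ?thesis using that bb by blast
qed

lemma sch_functional_eqI:
  fixes \<Lambda> \<Gamma> :: "'n::finite sch \<Rightarrow>\<^sub>L real"
  assumes eq: "\<And>f. bounded_borel f \<Longrightarrow> blinfun_apply \<Lambda> (cube_charge f) = blinfun_apply \<Gamma> (cube_charge f)"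
  shows "\<Lambda> = \<Gamma>"
proof (rule blinfun_eqI)
  fix \<alpha> :: "'n sch"
  have "\<bar>blinfun_apply (\<Lambda> - \<Gamma>) \<alpha>\<bar> \<le> 0 + e" if e: "0 < e" for e
  proof -
    define \<delta> where "\<delta> = e / (norm (\<Lambda> - \<Gamma>) + 1)"
    have pos: "0 < norm (\<Lambda> - \<Gamma>) + 1" by (rule add_nonneg_pos) auto
    have \<delta>: "0 < \<delta>" using e pos by (simp add: \<delta>_def)
    obtain f where f: "bounded_borel f" "norm (cube_charge f - \<alpha>) < \<delta>"
      by (rule bounded_charges_dense[OF \<delta>, of \<alpha>])
    have "blinfun_apply (\<Lambda> - \<Gamma>) \<alpha> = - blinfun_apply (\<Lambda> - \<Gamma>) (cube_charge f - \<alpha>)"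
      using eq[OF f(1)] by (simp add: blinfun.diff_right blinfun.diff_left)
    then have "\<bar>blinfun_apply (\<Lambda> - \<Gamma>) \<alpha>\<bar> \<le> norm (\<Lambda> - \<Gamma>) * norm (cube_charge f - \<alpha>)"
      using norm_blinfun[of "\<Lambda> - \<Gamma>" "cube_charge f - \<alpha>"] by simp
    also have "\<dots> \<le> (norm (\<Lambda> - \<Gamma>) + 1) * \<delta>" using f(2) by (intro mult_mono) auto
    also have "\<dots> = e" using pos by (simp add: \<delta>_def)
    finally show ?thesis by simp
  qed
  then have "\<bar>blinfun_apply (\<Lambda> - \<Gamma>) \<alpha>\<bar> \<le> 0" by (rule field_le_epsilon)
  then show "blinfun_apply \<Lambda> \<alpha> = blinfun_apply \<Gamma> \<alpha>" by (simp add: blinfun.diff_left)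
qed

section \<open>The isomorphism\<close>

lemma Upsilon_cube_charge:
  assumes "u \<in> BV_cube" "bounded_borel f"
  shows "blinfun_apply (Upsilon (abs_bv u)) (cube_charge f) = (LINT x|lborel. f x * u x)"
  by (simp add: Upsilon_apply Rep_cube_charge cube_functional_apply assms)

lemma bounded_linear_Upsilon: "bounded_linear (Upsilon :: 'n::finite bv \<Rightarrow> _)"
proof (rule bounded_linear_intro[where K = 1])
  fix U V :: "'n bv" and c :: real
  show "Upsilon (U + V) = Upsilon U + Upsilon V"
    by (rule blinfun_eqI) (simp add: Upsilon_apply blinfun.add_left blinfun.add_right)
  show "Upsilon (c *\<^sub>R U) = c *\<^sub>R Upsilon U"
    by (rule blinfun_eqI) (simp add: Upsilon_apply blinfun.scaleR_left blinfun.scaleR_right)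
  show "norm (Upsilon U) \<le> norm U * 1"
  proof (rule norm_blinfun_bound)
    show "norm (blinfun_apply (Upsilon U) \<alpha>) \<le> norm U * 1 * norm \<alpha>" for \<alpha>
      using norm_blinfun[of "Rep_sch \<alpha>" U] by (simp add: Upsilon_apply norm_sch.rep_eq mult.commute)
  qed simp
qed

text \<open>Pairing \<open>u\<close> with the charge of its own sign gives the \<open>L\<^sup>1\<close> norm of \<open>u\<close>.\<close>
lemma Upsilon_eq_0D:
  fixes U :: "'n::finite bv"
  assumes "Upsilon U = 0"
  shows "U = 0"
proof -
  obtain u where u: "u \<in> BV_cube" "U = abs_bv u" by (rule bv_cases)
  have "u \<in> borel_measurable borel" by (rule BV_cubeD[OF u(1)])
  then have "(\<lambda>x. sgn (u x)) \<in> borel_measurable borel" by (rule measurable_compose[OF _ borel_measurable_sgn])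
  then have bb: "bounded_borel (\<lambda>x. sgn (u x))" by (rule bounded_borelI[of _ 1]) (simp add: sgn_if)
  have "(LINT x|lborel. \<bar>u x\<bar>) = (LINT x|lborel. sgn (u x) * u x)" by (simp add: abs_sgn mult.commute)
  also have "\<dots> = 0" using Upsilon_cube_charge[OF u(1) bb] assms u(2) by simp
  finally have "AE x in lborel. u x = 0"
    using BV_cubeD(1)[OF u(1)] by (simp add: integral_nonneg_eq_0_iff_AE)
  then have "norm U = 0"
    unfolding u(2) norm_abs_bv[OF u(1)] BV_norm_eq_0_iff[OF u(1)] .
  then show ?thesis by simp
qed

lemma Upsilon_surj_bound:
  fixes \<Lambda> :: "'n::finite sch \<Rightarrow>\<^sub>L real"
  obtains U where "Upsilon U = \<Lambda>" "norm U \<le> (1 + 2 * real CARD('n)) * norm \<Lambda>"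
proof -
  obtain u where u: "u \<in> BV_cube" "BV_norm u \<le> (1 + 2 * real CARD('n)) * norm \<Lambda>"
    and rep: "\<And>f. bounded_borel f \<Longrightarrow> blinfun_apply \<Lambda> (cube_charge f) = (LINT x|lborel. f x * u x)"
    by (rule charge_functional_density_BV[of \<Lambda>]) blast
  show ?thesis
  proof (rule that)
    show "Upsilon (abs_bv u) = \<Lambda>"
      by (rule sch_functional_eqI) (simp only: Upsilon_cube_charge[OF u(1)] rep)
    show "norm (abs_bv u) \<le> (1 + 2 * real CARD('n)) * norm \<Lambda>"
      unfolding norm_abs_bv[OF u(1)] by (rule u(2))
  qed
qed

theorem theorem4p2:
  shows "linear (Upsilon :: 'n::finite bv \<Rightarrow> ('n sch \<Rightarrow>\<^sub>L real))
       \<and> bij (Upsilon :: 'n bv \<Rightarrow> ('n sch \<Rightarrow>\<^sub>L real))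
       \<and> continuous_on UNIV (Upsilon :: 'n bv \<Rightarrow> ('n sch \<Rightarrow>\<^sub>L real))
       \<and> continuous_on UNIV (inv (Upsilon :: 'n bv \<Rightarrow> ('n sch \<Rightarrow>\<^sub>L real)))"
proof (intro conjI)
  let ?Y = "Upsilon :: 'n bv \<Rightarrow> ('n sch \<Rightarrow>\<^sub>L real)"
  interpret Y: bounded_linear ?Y by (rule bounded_linear_Upsilon)
  show lin: "linear ?Y" by (rule Y.linear)
  have inj: "inj ?Y"
    unfolding linear_injective_0[OF lin] using Upsilon_eq_0D by blast
  have surj: "surj ?Y"
    unfolding surj_def
  proof
    fix \<Lambda> :: "'n sch \<Rightarrow>\<^sub>L real"
    obtain U where "?Y U = \<Lambda>" by (rule Upsilon_surj_bound)
    then show "\<exists>U. \<Lambda> = ?Y U" by blast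
  qed
  show "bij ?Y" using inj surj by (rule bijI)
  show "continuous_on UNIV ?Y" by (rule linear_continuous_on[OF bounded_linear_Upsilon])
  have bound: "norm (inv ?Y \<Lambda>) \<le> norm \<Lambda> * (1 + 2 * real CARD('n))" for \<Lambda>
  proof -
    obtain U where "?Y U = \<Lambda>" "norm U \<le> (1 + 2 * real CARD('n)) * norm \<Lambda>"
      by (rule Upsilon_surj_bound)
    then show ?thesis using inv_f_f[OF inj, of U] by (simp add: mult.commute)
  qed
  have "bounded_linear (inv ?Y)"
  proof (rule bounded_linear_intro[OF _ _ bound])
    show "inv ?Y (\<Lambda> + \<Gamma>) = inv ?Y \<Lambda> + inv ?Y \<Gamma>" for \<Lambda> \<Gamma>
      by (rule inv_f_eq[OF inj]) (simp add: Y.add surj_f_inv_f[OF surj])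
    show "inv ?Y (c *\<^sub>R \<Lambda>) = c *\<^sub>R inv ?Y \<Lambda>" for c \<Lambda>
      by (rule inv_f_eq[OF inj]) (simp add: Y.scaleR surj_f_inv_f[OF surj])
  qed
  then show "continuous_on UNIV (inv ?Y)" by (rule linear_continuous_on)
qed

end
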